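(* Consider the sequential dynamical system $(T_j)$, operators $\mathcal L_j$ and functions $f_j$ described in the context. Let $x_0$ be distributed according to $\mu_0$ and let $$S_n=\sum_{j=0}^{n-1}f_j\circ T_{j-1}\circ\cdots\circ T_1\circ T_0(x_0).$$ Suppose that $\mathrm{Var}_{\mu_0}(S_n)\ge c_0n$ for some $c_0>0$ and all $n$ large enough. Then $(S_n)$ satisfies the growth condition of order $m$ (see context) for every integer $m\ge2$. Consequently, with $\sigma_n=\|S_n\|_{L^2}$, $(A_n)$ a bounded real sequence, $B_n=\sigma_n+O(1)$ and $W_n=(S_n-A_n)/B_n$, the following hold for every integer $m\ge2$: (1) there is a constant $C$ such that for all $x\in\mathbb R$, $|\mathbb P(W_n\le x)-\Phi(x)|\le C\sigma_n^{-1}(1+|x|)^{-m}$; in particular, $\|\mathbb P(W_n\le\cdot)-\Phi\|_{L^p(dx)}=O(\sigma_n^{-1})$ for every $p>1/m$; (2) there is a constant $R>0$ such that for every a.e. differentiable function $h:\mathbb R\to\mathbb R$ with $H_m(h)=\int_{\mathbb R}\frac{|h'(x)|}{(1+|x|)^m}dx<\infty$, $$\left|\mathbb E[h(W_n)]-\int_{\mathbb R} h(x)\varphi(x)\,dx\right|\le R\,H_m(h)\,\sigma_n^{-1};$$ in particular, for every $q<m$ this bound holds for $h(x)=x^q$ and for $h(x)=|x|^q$.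
   Context: $\Phi,\varphi$: standard normal distribution function and density. Setting: $(\mathcal X_j,\mathcal B_j,\mu_j)$, $j\ge0$, are probability spaces and $T_j:\mathcal X_j\to\mathcal X_{j+1}$ are measurable maps. $\mathcal L_j$ is defined by the duality relation $\int_{\mathcal X_j}g\cdot(u\circ T_j)\,d\mu_j=\int(\mathcal L_jg)\cdot u\,d\mu_{j+1}$ for all bounded $g:\mathcal X_j\to\mathbb R$ and $u:\mathcal X_{j+1}\to\mathbb R$. $B_j$ is a Banach space of measurable functions on $\mathcal X_j$ with a norm $\|\cdot\|_j$ such that $\sup|g|\le C\|g\|_j$ for some constant $C$ not depending on $j$. There are constants $A$ and $\delta\in(0,1)$ and strictly positive functions $h_j\in B_j$ such that for every $j$, every $g\in B_j$ and all $n\ge1$, $$\|\mathcal L_{j+n-1}\circ\cdots\circ\mathcal L_{j+1}\circ\mathcal L_jg-\mu_j(g)h_{j+n}\|_{j+n}\le A\|g\|_j\delta^n.$$ The functions $f_j\in B_j$ are real-valued with $\sup_j\|f_j\|_j<\infty$ and $\mu_j(f_j)=0$. With $\mathcal L_j^{(z)}(g)=\mathcal L_j(e^{zf_j}g)$, $z\in\mathbb C$, the map $z\mapsto\mathcal L_j^{(z)}$ (with values in the space of bounded linear operators from $B_j$ to $B_{j+1}$) is analytic around the complex origin, uniformly in $j$. Growth condition of order $m$ for $(S_n)$ with $\sigma_n=\|S_n\|_{L^2}$: with $\Lambda_n(t)=\ln\mathbb E[e^{itS_n/\sigma_n}]+t^2/2$, for all $3\le j\le m+1$ there exist constants $C_j,\varepsilon_j>0$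 (independent of $n$) such that $\sup_{t\in[-\varepsilon_j\sigma_n,\varepsilon_j\sigma_n]}|\Lambda_n^{(j)}(t)|\le C_j\sigma_n^{-(j-2)}$.
   Formalization: Added, since the claim fails without them: E[S_n] is bounded, the constant 1 lies in B_0, sup_j ||h_j||_j is finite, and h is locally absolutely continuous rather than only a.e. differentiable. Bounds are for n with sigma_n>0 and B_n nonzero. *)

theory Defs
  imports "HOL-Probability.Probability"
begin

text \<open>
  The carrier \<open>B\<close> consists of genuine functions on \<open>space M\<close> (not of classes modulo null sets).
  Totality of HOL functions is dealt with by letting the members of \<open>B\<close> vanish outside
  \<open>space M\<close>, so that \<open>N g = 0\<close> forces \<open>g = (\<lambda>_. 0)\<close> and \<open>B\<close> is a linear subspace
  of \<open>'a \<Rightarrow> complex\<close>.  The values of \<open>N\<close> outside \<open>B\<close> are irrelevant.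
\<close>

definition banach_function_space ::
  "'a measure \<Rightarrow> ('a \<Rightarrow> complex) set \<Rightarrow> (('a \<Rightarrow> complex) \<Rightarrow> real) \<Rightarrow> bool" where
  "banach_function_space M B N \<longleftrightarrow>
     (\<forall>g\<in>B. g \<in> borel_measurable M \<and> (\<forall>x. x \<notin> space M \<longrightarrow> g x = 0)) \<and>
     (\<lambda>_. 0) \<in> B \<and>
     (\<forall>g\<in>B. \<forall>g'\<in>B. (\<lambda>x. g x + g' x) \<in> B) \<and>
     (\<forall>c. \<forall>g\<in>B. (\<lambda>x. c * g x) \<in> B) \<and>
     (\<forall>g\<in>B. 0 \<le> N g \<and> (N g = 0 \<longleftrightarrow> g = (\<lambda>_. 0))) \<and>
     (\<forall>c. \<forall>g\<in>B. N (\<lambda>x. c * g x) = cmod c * N g) \<and>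
     (\<forall>g\<in>B. \<forall>g'\<in>B. N (\<lambda>x. g x + g' x) \<le> N g + N g') \<and>
     (\<forall>u :: nat \<Rightarrow> 'a \<Rightarrow> complex.
        (\<forall>n. u n \<in> B) \<and>
        (\<forall>e>0. \<exists>k. \<forall>i\<ge>k. \<forall>j\<ge>k. N (\<lambda>x. u i x - u j x) < e) \<longrightarrow>
        (\<exists>v\<in>B. (\<lambda>n. N (\<lambda>x. u n x - v x)) \<longlonglongrightarrow> 0))"

definition bounded_linear_between ::
  "('a \<Rightarrow> complex) set \<Rightarrow> (('a \<Rightarrow> complex) \<Rightarrow> real) \<Rightarrow>
   ('a \<Rightarrow> complex) set \<Rightarrow> (('a \<Rightarrow> complex) \<Rightarrow> real) \<Rightarrow>
   (('a \<Rightarrow> complex) \<Rightarrow> ('a \<Rightarrow> complex)) \<Rightarrow> bool" where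
  "bounded_linear_between B N B' N' P \<longleftrightarrow>
     (\<forall>g\<in>B. P g \<in> B') \<and>
     (\<forall>g\<in>B. \<forall>g'\<in>B. P (\<lambda>x. g x + g' x) = (\<lambda>x. P g x + P g' x)) \<and>
     (\<forall>c. \<forall>g\<in>B. P (\<lambda>x. c * g x) = (\<lambda>x. c * P g x)) \<and>
     (\<exists>K. \<forall>g\<in>B. N' (P g) \<le> K * N g)"

text \<open>
  Analyticity around \<open>0\<close> uniformly in \<open>j\<close>: on a disc of radius independent of \<open>j\<close>, the operators
  are bounded in operator norm by a constant independent of \<open>j\<close> and are given by a power series
  whose coefficients are bounded operators; the series converges in operator norm.
\<close>

definition uniformly_analytic_at_0 ::
  "(nat \<Rightarrow> ('a \<Rightarrow> complex) set) \<Rightarrow> (nat \<Rightarrow> ('a \<Rightarrow> complex) \<Rightarrow> real) \<Rightarrow>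
   (nat \<Rightarrow> complex \<Rightarrow> ('a \<Rightarrow> complex) \<Rightarrow> ('a \<Rightarrow> complex)) \<Rightarrow> bool" where
  "uniformly_analytic_at_0 B N P \<longleftrightarrow>
     (\<exists>r>0. \<exists>K. \<forall>j.
        (\<forall>z\<in>ball 0 r.
           bounded_linear_between (B j) (N j) (B (Suc j)) (N (Suc j)) (P j z) \<and>
           (\<forall>g\<in>B j. N (Suc j) (P j z g) \<le> K * N j g)) \<and>
        (\<exists>D :: nat \<Rightarrow> ('a \<Rightarrow> complex) \<Rightarrow> ('a \<Rightarrow> complex).
           (\<forall>k. bounded_linear_between (B j) (N j) (B (Suc j)) (N (Suc j)) (D k)) \<and>
           (\<forall>z\<in>ball 0 r. \<forall>e>0. \<forall>\<^sub>F n in sequentially. \<forall>g\<in>B j.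
              N (Suc j) (\<lambda>x. P j z g x - (\<Sum>k<n. z ^ k * D k g x)) \<le> e * N j g)))"

text \<open>
  The duality relation determines \<open>P g\<close> only almost everywhere; \<open>P\<close> is a choice of versions.
\<close>

definition transfer_operator ::
  "'a measure \<Rightarrow> 'a measure \<Rightarrow> ('a \<Rightarrow> 'a) \<Rightarrow> (('a \<Rightarrow> complex) \<Rightarrow> ('a \<Rightarrow> complex)) \<Rightarrow> bool" where
  "transfer_operator M M' T P \<longleftrightarrow>
     (\<forall>g\<in>borel_measurable M. bounded (g ` space M) \<longrightarrow>
        integrable M' (P g) \<and>
        (\<forall>u\<in>borel_measurable M'. bounded (u ` space M') \<longrightarrow>
           (\<integral>x. g x * u (T x) \<partial>M) = (\<integral>x. P g x * u x \<partial>M')))"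

definition twisted ::
  "(('a \<Rightarrow> complex) \<Rightarrow> ('a \<Rightarrow> complex)) \<Rightarrow> ('a \<Rightarrow> real) \<Rightarrow> complex \<Rightarrow>
   ('a \<Rightarrow> complex) \<Rightarrow> ('a \<Rightarrow> complex)" where
  "twisted P f z g = P (\<lambda>x. exp (z * complex_of_real (f x)) * g x)"

primrec transfer_iter ::
  "(nat \<Rightarrow> ('a \<Rightarrow> complex) \<Rightarrow> ('a \<Rightarrow> complex)) \<Rightarrow> nat \<Rightarrow> nat \<Rightarrow>
   ('a \<Rightarrow> complex) \<Rightarrow> ('a \<Rightarrow> complex)" where
  "transfer_iter L j 0 g = g"
| "transfer_iter L j (Suc n) g = L (j + n) (transfer_iter L j n g)"

primrec orbit :: "(nat \<Rightarrow> 'a \<Rightarrow> 'a) \<Rightarrow> nat \<Rightarrow> 'a \<Rightarrow> 'a" where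
  "orbit T 0 x = x"
| "orbit T (Suc j) x = T j (orbit T j x)"

definition birkhoff_sum ::
  "(nat \<Rightarrow> 'a \<Rightarrow> 'a) \<Rightarrow> (nat \<Rightarrow> 'a \<Rightarrow> real) \<Rightarrow> nat \<Rightarrow> 'a \<Rightarrow> real" where
  "birkhoff_sum T f n x = (\<Sum>j<n. f j (orbit T j x))"

definition rv_L2_norm :: "'a measure \<Rightarrow> ('a \<Rightarrow> real) \<Rightarrow> real" where
  "rv_L2_norm M X = sqrt (\<integral>x. (X x)\<^sup>2 \<partial>M)"

text \<open>\<open>G\<close> is the \<open>k\<close>-th derivative of \<open>F\<close> on \<open>I\<close> (one-sided at end points of \<open>I\<close>).\<close>

definition has_nth_derivative_on ::
  "(real \<Rightarrow> complex) \<Rightarrow> nat \<Rightarrow> (real \<Rightarrow> complex) \<Rightarrow> real set \<Rightarrow> bool" where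
  "has_nth_derivative_on F k G I \<longleftrightarrow>
     (\<exists>D :: nat \<Rightarrow> real \<Rightarrow> complex.
        (\<forall>t\<in>I. D 0 t = F t) \<and>
        (\<forall>i<k. \<forall>t\<in>I. (D i has_vector_derivative D (Suc i) t) (at t within I)) \<and>
        (\<forall>t\<in>I. D k t = G t))"

text \<open>
  The logarithm of the characteristic function is its continuous branch \<open>l\<close> on the interval with
  \<open>l 0 = 0\<close>; the principal value \<open>Ln\<close> would jump when the characteristic function crosses the
  negative real axis.  Indices with \<open>\<sigma>\<^sub>n = 0\<close> (for instance \<open>n = 0\<close>) carry no condition, since the
  normalised sum is then undefined.
\<close>

definition growth_condition :: "'a measure \<Rightarrow> (nat \<Rightarrow> 'a \<Rightarrow> real) \<Rightarrow> nat \<Rightarrow> bool" where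
  "growth_condition M S m \<longleftrightarrow>
     (\<forall>j. 3 \<le> j \<and> j \<le> m + 1 \<longrightarrow>
        (\<exists>C>0. \<exists>\<epsilon>>0. \<forall>n. rv_L2_norm M (S n) > 0 \<longrightarrow>
           (let \<sigma> = rv_L2_norm M (S n); I = {- (\<epsilon> * \<sigma>)..\<epsilon> * \<sigma>} in
            \<exists>l G. continuous_on I l \<and> l 0 = 0 \<and>
              (\<forall>t\<in>I. exp (l t) = char (distr M borel (\<lambda>x. S n x / \<sigma>)) t) \<and>
              has_nth_derivative_on (\<lambda>t. l t + complex_of_real (t\<^sup>2 / 2)) j G I \<and>
              (\<forall>t\<in>I. cmod (G t) \<le> C / \<sigma> ^ (j - 2)))))"

text \<open>
  Almost everywhere differentiable functions that are recovered by integrating their derivative.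
  Without the second clause the derivative would not control the function at all
  (step functions, the Cantor function).  The choice of \<open>deriv h\<close> at points of
  non-differentiability is immaterial because \<open>lebesgue\<close> is complete.
\<close>

definition ae_differentiable :: "(real \<Rightarrow> real) \<Rightarrow> bool" where
  "ae_differentiable h \<longleftrightarrow>
     (AE x in lebesgue. h differentiable (at x)) \<and>
     (\<forall>a b. a \<le> b \<longrightarrow>
        set_integrable lebesgue {a..b} (deriv h) \<and>
        h b - h a = (LINT x:{a..b}|lebesgue. deriv h x))"

definition H_finite :: "nat \<Rightarrow> (real \<Rightarrow> real) \<Rightarrow> bool" where
  "H_finite m h \<longleftrightarrow> integrable lebesgue (\<lambda>x. \<bar>deriv h x\<bar> / (1 + \<bar>x\<bar>) ^ m)"

definition H_weight :: "nat \<Rightarrow> (real \<Rightarrow> real) \<Rightarrow> real" where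
  "H_weight m h = (\<integral>x. \<bar>deriv h x\<bar> / (1 + \<bar>x\<bar>) ^ m \<partial>lebesgue)"

text \<open>Both expectations are required to exist, as the Bochner integral is total.\<close>

definition expectation_bound ::
  "'a measure \<Rightarrow> ('a \<Rightarrow> real) \<Rightarrow> (real \<Rightarrow> real) \<Rightarrow> real \<Rightarrow> bool" where
  "expectation_bound M W h c \<longleftrightarrow>
     integrable M (\<lambda>x. h (W x)) \<and>
     integrable lborel (\<lambda>x. h x * std_normal_density x) \<and>
     \<bar>(\<integral>x. h (W x) \<partial>M) - (\<integral>x. h x * std_normal_density x \<partial>lborel)\<bar> \<le> c"

end

(*
Let Z_n(z) = E exp(z S_n) and let g_n be the iterate of the twisted operators applied to 1, so that
Z_n(z) is the integral of g_n. For small |z| (uniformly in n) the exponential decay of the untwisted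
iterates gives, by induction on n, both |g_n| <= D |Z_n| in norm and |Z_(n+1)/Z_n - 1| < 1/2. Hence
log Z_n = sum_(j<n) Ln (Z_(j+1)/Z_j) is analytic on a disc independent of n and bounded there by
n = O(sigma_n^2), and Cauchy's estimates yield the growth condition and
E exp(i w S_n/sigma_n) = exp(-w^2/2 + O((1+|w|)^3/sigma_n)) for complex w with |w| <= r sigma_n.

For the nonuniform Berry-Esseen bound, convolve with the kernel T |e(T y)|^2 for T of order sigma_n,
where e is the Fourier transform of (1-s^2)^k on [-1,1]. As e is a compactly supported transform, the
smoothed densities of S_n/sigma_n and of the normal law involve only frequencies below 2T; k-fold
integration by parts together with Cauchy's estimate on discs of radius 1/T bounds their difference
by C/sigma_n (1+|x|)^(-k). The smoothed density also controls the concentration of S_n/sigma_n on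
intervals of length 1/T, so the smoothing itself costs only O(1/sigma_n) (1+|x|)^(-m).
Expectations follow from E h(W) = h(0) + int h'(y) (P(W > y) - 1_(y <= 0)) dy.
*)
theory Submission
  imports Defs "HOL-Complex_Analysis.Complex_Analysis"
begin

section \<open>Moment generating functions of bounded variables\<close>

text \<open>The system is not autonomous, so there is no leading eigenvalue to perturb. The ratio of
  consecutive values of Z takes its place, and the iterate divided by Z_n(z) plays the
  eigenfunction. Since |Z_n(z)| may itself shrink geometrically, absolute bounds on the iterate are
  useless: they must be relative to |Z_n(z)|, which is why the norm bound and the control of the
  ratios need one another. Complex frequencies matter because each power of the weight in x costs
  one derivative of the characteristic function; Cauchy's estimate supplies all of them from a
  single bound near the real axis, whatever m is. The kernel is a squared modulus so as to be
  nonnegative: only then does a bound on the smoothed density limit the mass near a point, although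
  S_n need not have any density. With k = m + 2, m powers carry the weight and two make the
  remaining integral converge. T is a small multiple of sigma_n, so that the cubic error in the
  exponent is absorbed by half of the Gaussian decay.\<close>

abbreviation (input) jb :: "real \<Rightarrow> real" where "jb x \<equiv> 1 + \<bar>x\<bar>"

abbreviation (input) normal_dist :: "real measure" ("\<N>") where "\<N> \<equiv> std_normal_distribution"

lemma (in prob_space) integrable_bounded:
  fixes u :: "'a \<Rightarrow> 'b :: {banach, second_countable_topology}"
  assumes "u \<in> borel_measurable M" "\<And>x. x \<in> space M \<Longrightarrow> norm (u x) \<le> c"
  shows "integrable M u"
  using assms by (intro integrable_const_bound[where B = c]) auto

lemma (in prob_space) norm_integral_le:
  fixes u :: "'a \<Rightarrow> 'b :: {banach, second_countable_topology}"
  assumes "u \<in> borel_measurable M" "\<And>x. x \<in> space M \<Longrightarrow> norm (u x) \<le> c"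
  shows "norm (\<integral>x. u x \<partial>M) \<le> c"
proof -
  have "norm (\<integral>x. u x \<partial>M) \<le> (\<integral>x. norm (u x) \<partial>M)" by (rule integral_norm_bound)
  also have "\<dots> \<le> (\<integral>x. c \<partial>M)"
    using assms by (intro integral_mono integrable_norm integrable_bounded[where c = c] integrable_const) auto
  also have "\<dots> = c" by (simp add: prob_space)
  finally show ?thesis .
qed

text \<open>The exponential series may be integrated term by term because its \<open>k\<close>-th
  term is at most \<open>c * (b * cmod z) ^ k / fact k\<close>. The weight \<open>u\<close> is
  carried along so that the derivative can be read off from the same expansion.\<close>

lemma (in prob_space) mgf_sums:
  fixes u :: "'a \<Rightarrow> complex" and X :: "'a \<Rightarrow> real"
  assumes X: "X \<in> borel_measurable M" "\<And>x. x \<in> space M \<Longrightarrow> \<bar>X x\<bar> \<le> b"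
    and u: "u \<in> borel_measurable M" "\<And>x. x \<in> space M \<Longrightarrow> cmod (u x) \<le> c"
  shows "(\<lambda>k. ((\<integral>x. u x * of_real (X x) ^ k \<partial>M) / fact k) * z ^ k) sums (\<integral>x. u x * exp (z * of_real (X x)) \<partial>M)"
proof -
  let ?t = "\<lambda>k x. u x * of_real (X x) ^ k * z ^ k / fact k"
  have b: "cmod (?t k x) \<le> c * (b * cmod z) ^ k / fact k" if "x \<in> space M" for k x
  proof -
    have "cmod (?t k x) = cmod (u x) * (\<bar>X x\<bar> * cmod z) ^ k / fact k"
      by (simp add: norm_mult norm_divide norm_power power_mult_distrib)
    also have "\<dots> \<le> c * (b * cmod z) ^ k / fact k"
    proof (intro divide_right_mono mult_mono power_mono)
      show "0 \<le> c" using u(2)[OF that] norm_ge_zero order.trans by blast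
    qed (use X(2)[OF that] u(2)[OF that] in auto)
    finally show ?thesis .
  qed
  have sm: "summable (\<lambda>k. c * (b * cmod z) ^ k / fact k)"
    using summable_mult[OF summable_exp, of c "b * cmod z"] by (simp add: divide_simps mult_ac)
  have int: "integrable M (?t k)" for k
    using b X(1) u(1) by (intro integrable_bounded[where c = "c * (b * cmod z) ^ k / fact k"]) auto
  have "(\<lambda>k. \<integral>x. ?t k x \<partial>M) sums (\<integral>x. (\<Sum>k. ?t k x) \<partial>M)"
  proof (rule sums_integral[OF int])
    show "AE x in M. summable (\<lambda>k. norm (?t k x))"
      using b sm by (intro AE_I2 summable_comparison_test'[OF sm, of 0]) simp
    have "(\<integral>x. norm (?t k x) \<partial>M) \<le> c * (b * cmod z) ^ k / fact k" for k
    proof -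
      have "norm (\<integral>x. norm (?t k x) \<partial>M) \<le> c * (b * cmod z) ^ k / fact k"
        using b X(1) u(1) by (intro norm_integral_le) auto
      then show ?thesis by simp
    qed
    then show "summable (\<lambda>k. \<integral>x. norm (?t k x) \<partial>M)"
      by (intro summable_comparison_test'[OF sm, of 0]) simp
  qed
  moreover have "(\<Sum>k. ?t k x) = u x * exp (z * of_real (X x))" for x
  proof -
    have "(\<lambda>k. u x * ((z * of_real (X x)) ^ k /\<^sub>R fact k)) sums (u x * exp (z * of_real (X x)))"
      by (intro sums_mult exp_converges)
    then have "(\<lambda>k. ?t k x) sums (u x * exp (z * of_real (X x)))"
      by (simp add: power_mult_distrib scaleR_conv_of_real divide_simps mult_ac)
    then show ?thesis by (simp add: sums_iff)
  qed
  moreover have "(\<integral>x. ?t k x \<partial>M) = ((\<integral>x. u x * of_real (X x) ^ k \<partial>M) / fact k) * z ^ k" for k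
    by simp
  ultimately show ?thesis by simp
qed

text \<open>Nothing is differentiated under the integral sign: the termwise derivative
  \<open>diffs a\<close> is exactly the expansion \<open>mgf_sums\<close> for the weight
  \<open>u * X\<close>.\<close>

lemma (in prob_space) mgf_has_field_derivative:
  fixes u :: "'a \<Rightarrow> complex" and X :: "'a \<Rightarrow> real"
  assumes X: "X \<in> borel_measurable M" "\<And>x. x \<in> space M \<Longrightarrow> \<bar>X x\<bar> \<le> b"
    and u: "u \<in> borel_measurable M" "\<And>x. x \<in> space M \<Longrightarrow> cmod (u x) \<le> c"
  shows "((\<lambda>z. \<integral>x. u x * exp (z * of_real (X x)) \<partial>M) has_field_derivative
    (\<integral>x. u x * of_real (X x) * exp (z * of_real (X x)) \<partial>M)) (at z)"
proof -
  define a where "a = (\<lambda>k. (\<integral>x. u x * of_real (X x) ^ k \<partial>M) / fact k :: complex)"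
  have s: "(\<lambda>k. a k * z ^ k) sums (\<integral>x. u x * exp (z * of_real (X x)) \<partial>M)" for z
    unfolding a_def by (rule mgf_sums[OF X u])
  have "cmod (u x * of_real (X x)) \<le> c * b" if "x \<in> space M" for x
  proof -
    have "0 \<le> c" using u(2)[OF that] norm_ge_zero order.trans by blast
    then show ?thesis using X(2)[OF that] u(2)[OF that] by (simp add: norm_mult mult_mono)
  qed
  then have "(\<lambda>k. ((\<integral>x. (u x * of_real (X x)) * of_real (X x) ^ k \<partial>M) / fact k) * z ^ k) sums
      (\<integral>x. (u x * of_real (X x)) * exp (z * of_real (X x)) \<partial>M)"
    using X(1) u(1) by (intro mgf_sums[OF X, where c = "c * b"]) auto
  moreover have "((\<integral>x. (u x * of_real (X x)) * of_real (X x) ^ k \<partial>M) / fact k) = diffs a k" for k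
    by (simp add: diffs_def a_def mult.assoc[symmetric] fact_Suc divide_simps del: of_nat_Suc)
  ultimately have "(\<Sum>k. diffs a k * z ^ k) = (\<integral>x. u x * of_real (X x) * exp (z * of_real (X x)) \<partial>M)"
    by (simp add: sums_iff)
  moreover have "((\<lambda>z. \<Sum>k. a k * z ^ k) has_field_derivative (\<Sum>k. diffs a k * z ^ k)) (at z)"
    using s by (intro termdiffs_strong_converges_everywhere) (auto simp: sums_iff)
  moreover have "(\<lambda>z. \<Sum>k. a k * z ^ k) = (\<lambda>z. \<integral>x. u x * exp (z * of_real (X x)) \<partial>M)"
    using s by (auto simp: sums_iff)
  ultimately show ?thesis by simp
qed

lemma cmod_exp_minus_1_le: "cmod (exp z - 1) \<le> cmod z * exp (cmod z)"
proof -
  have "cmod (exp z - exp 0) \<le> exp (cmod z) * cmod (z - 0)"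
  proof (rule field_differentiable_bound[where S = "cball 0 (cmod z)"])
    show "(exp has_field_derivative exp w) (at w within cball 0 (cmod z))" for w :: complex
      by (rule DERIV_exp[THEN DERIV_subset]) simp
    show "cmod (exp w) \<le> exp (cmod z)" if "w \<in> cball 0 (cmod z)" for w
      using that norm_exp[of w] by (auto intro: order.trans)
  qed auto
  then show ?thesis by (simp add: mult.commute)
qed

section \<open>Power series of operators between function spaces\<close>

locale banach_functions =
  fixes M :: "'a measure" and B :: "('a \<Rightarrow> complex) set" and N :: "('a \<Rightarrow> complex) \<Rightarrow> real"
  assumes bfs: "banach_function_space M B N"
begin

lemma measurable_mem: "g \<in> B \<Longrightarrow> g \<in> borel_measurable M"
  and zero_mem: "(\<lambda>_. 0) \<in> B"
  and add_mem: "g \<in> B \<Longrightarrow> g' \<in> B \<Longrightarrow> (\<lambda>x. g x + g' x) \<in> B"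
  and scale_mem: "g \<in> B \<Longrightarrow> (\<lambda>x. c * g x) \<in> B"
  and N_nonneg: "g \<in> B \<Longrightarrow> 0 \<le> N g"
  and N_zero: "N (\<lambda>_. 0) = 0"
  and N_scale: "g \<in> B \<Longrightarrow> N (\<lambda>x. c * g x) = cmod c * N g"
  and N_add_le: "g \<in> B \<Longrightarrow> g' \<in> B \<Longrightarrow> N (\<lambda>x. g x + g' x) \<le> N g + N g'"
  using bfs unfolding banach_function_space_def by blast+

lemma diff_mem: "g \<in> B \<Longrightarrow> g' \<in> B \<Longrightarrow> (\<lambda>x. g x - g' x) \<in> B"
  using add_mem[of g "\<lambda>x. (-1) * g' x"] scale_mem[of g' "-1"] by simp

lemma N_diff_le: "g \<in> B \<Longrightarrow> g' \<in> B \<Longrightarrow> N (\<lambda>x. g x - g' x) \<le> N g + N g'"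
  using N_add_le[of g "\<lambda>x. (-1) * g' x"] scale_mem[of g' "-1"] N_scale[of g' "-1"] by simp

lemma sum_mem: "(\<And>i. i \<in> I \<Longrightarrow> u i \<in> B) \<Longrightarrow> (\<lambda>x. \<Sum>i\<in>I. u i x) \<in> B"
  by (induction I rule: infinite_finite_induct) (simp_all add: zero_mem add_mem)

lemma N_sum_le: "(\<And>i. i \<in> I \<Longrightarrow> u i \<in> B) \<Longrightarrow> N (\<lambda>x. \<Sum>i\<in>I. u i x) \<le> (\<Sum>i\<in>I. N (u i))"
proof (induction I rule: infinite_finite_induct)
  case (insert i I)
  have "N (\<lambda>x. u i x + (\<Sum>i\<in>I. u i x)) \<le> N (u i) + N (\<lambda>x. \<Sum>i\<in>I. u i x)"
    using insert.prems by (intro N_add_le sum_mem) auto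
  with insert show ?case by force
qed (simp_all add: N_zero)

end

section \<open>Averages over roots of unity\<close>

definition root_average :: "nat \<Rightarrow> nat \<Rightarrow> nat \<Rightarrow> complex" where
  "root_average n k l =
    (\<Sum>i<n. cis (2 * pi * real i / real n) ^ l * cnj (cis (2 * pi * real i / real n)) ^ k) / of_nat n"

text \<open>The summands are powers of one root of unity, of angle
  \<open>2 * pi * (l - k) / n\<close>, so the sum is geometric and vanishes unless \<open>n\<close>
  divides \<open>l - k\<close>. Beyond \<open>n\<close> other indices alias with \<open>k\<close>,
  and only the bound 1 is kept.\<close>

lemma
  fixes n k l :: nat
  assumes "k < n"
  shows root_average_eq_1: "root_average n k k = 1"
    and root_average_eq_0: "l < n \<Longrightarrow> l \<noteq> k \<Longrightarrow> root_average n k l = 0"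
    and root_average_le_1: "cmod (root_average n k l) \<le> 1"
proof -
  have n: "n > 0" using assms by simp
  have *: "cis (2 * pi * real i / real n) ^ l * cnj (cis (2 * pi * real i / real n)) ^ k
      = cis (2 * pi * (real l - real k) / real n) ^ i" for i l
    unfolding cis_cnj Complex.DeMoivre cis_mult
    by (rule arg_cong[of _ _ cis]) (simp add: algebra_simps diff_divide_distrib add_divide_distrib)
  show "root_average n k k = 1" unfolding root_average_def * using n by simp
  show "cmod (root_average n k l) \<le> 1"
  proof -
    have "cmod (\<Sum>i<n. cis (2 * pi * (real l - real k) / real n) ^ i) \<le> (\<Sum>i<n. 1)"
      by (intro sum_norm_le) (simp add: norm_power)
    then show ?thesis unfolding root_average_def * using n by (simp add: norm_divide)
  qed
  show "root_average n k l = 0" if l: "l < n" "l \<noteq> k"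
  proof -
    let ?x = "cis (2 * pi * (real l - real k) / real n)"
    have "?x ^ n = cis (2 * pi * real_of_int (int l - int k))"
      unfolding Complex.DeMoivre using n by (intro arg_cong[of _ _ cis]) simp
    then have 1: "?x ^ n = 1" using cis_multiple_2pi[of "real_of_int (int l - int k)"] by (metis Ints_of_int)
    have "?x \<noteq> 1"
    proof
      assume "?x = 1"
      then have "cos (2 * pi * (real l - real k) / real n) = 1"
        by (metis cis.sel(1) one_complex.sel(1))
      then obtain j :: int where "2 * pi * (real l - real k) / real n = of_int j * 2 * pi"
        unfolding cos_one_2pi_int by blast
      then have "2 * pi * (real l - real k) = 2 * pi * (of_int j * real n)"
        using n by (simp add: divide_eq_eq)
      then have "real l - real k = of_int j * real n" using pi_neq_zero by (metis mult_cancel_left mult_eq_0_iff zero_neq_numeral)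
      then have "real_of_int (int l - int k) = real_of_int (j * int n)" by simp
      then have "int l - int k = j * int n" unfolding of_int_eq_iff .
      moreover have "\<bar>int l - int k\<bar> < int n" using l assms by linarith
      ultimately have "\<bar>j\<bar> * int n < 1 * int n" by (simp add: abs_mult)
      then have "j = 0" using n by (subst (asm) mult_less_cancel_right) auto
      with \<open>int l - int k = j * int n\<close> l show False by simp
    qed
    then show ?thesis unfolding root_average_def * by (simp add: geometric_sum 1)
  qed
qed

context banach_functions
begin

text \<open>
  Cauchy's estimate without vector-valued integrals: averaging a partial sum over the \<open>m\<close>-th roots of
  unity isolates the \<open>k\<close>-th coefficient up to terms of index at least \<open>m\<close>.
\<close>

lemma power_series_coeff_bound:
  fixes F :: "complex \<Rightarrow> 'a \<Rightarrow> complex" and d :: "nat \<Rightarrow> 'a \<Rightarrow> complex"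
  assumes F: "\<And>z. z \<in> ball 0 r \<Longrightarrow> F z \<in> B" and K: "\<And>z. z \<in> ball 0 r \<Longrightarrow> N (F z) \<le> K"
    and d: "\<And>k. d k \<in> B"
    and conv: "\<And>z e. z \<in> ball 0 r \<Longrightarrow> 0 < e \<Longrightarrow>
        \<forall>\<^sub>F n in sequentially. N (\<lambda>x. F z x - (\<Sum>k<n. z ^ k * d k x)) \<le> e"
    and \<rho>: "0 < \<rho>" "\<rho> < r"
  shows "N (d k) * \<rho> ^ k \<le> K"
proof -
  have S_mem: "(\<lambda>x. \<Sum>k<n. z ^ k * d k x) \<in> B" for n z by (intro sum_mem scale_mem d)
  \<comment> \<open>An intermediate radius: boundedness of \<open>N (d l) * \<rho>' ^ l\<close>
    becomes geometric decay with ratio \<open>q = \<rho> / \<rho>'\<close> at radius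
    \<open>\<rho>\<close>.\<close>
  obtain \<rho>' where \<rho>': "\<rho> < \<rho>'" "\<rho>' < r" using \<rho> dense by blast
  then have "\<rho>' > 0" using \<rho> by simp
  define z' where "z' = complex_of_real \<rho>'"
  have z': "z' \<in> ball 0 r" "cmod z' = \<rho>'" using \<rho>' \<rho> by (auto simp: z'_def)
  obtain n0 where n0: "\<And>n. n \<ge> n0 \<Longrightarrow> N (\<lambda>x. F z' x - (\<Sum>k<n. z' ^ k * d k x)) \<le> 1"
    using conv[OF z'(1), of 1] by (auto simp: eventually_sequentially)
  \<comment> \<open>Consecutive partial sums differ by exactly the \<open>l\<close>-th term, and
    each is within 1 of \<open>F z'\<close>.\<close>
  have large: "N (d l) * \<rho>' ^ l \<le> 2" if "l \<ge> n0" for l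
  proof -
    have "N (\<lambda>x. z' ^ l * d l x) =
        N (\<lambda>x. (F z' x - (\<Sum>k<l. z' ^ k * d k x)) - (F z' x - (\<Sum>k<Suc l. z' ^ k * d k x)))"
      by simp
    also have "\<dots> \<le> 1 + 1"
      using n0[of l] n0[of "Suc l"] that
      by (intro order.trans[OF N_diff_le[OF diff_mem[OF F[OF z'(1)] S_mem] diff_mem[OF F[OF z'(1)] S_mem]]] add_mono) auto
    finally show ?thesis by (simp add: N_scale d norm_power z' mult.commute)
  qed
  \<comment> \<open>\<open>b\<close> depends on the whole series, but it will only multiply
    \<open>q ^ m\<close>, which a large \<open>m\<close> makes negligible.\<close>
  define b where "b = 2 + (\<Sum>l<n0. N (d l) * \<rho>' ^ l)"
  have nn: "0 \<le> N (d l) * \<rho>' ^ l" for l using N_nonneg d \<open>\<rho>' > 0\<close> by simp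
  have b: "N (d l) * \<rho>' ^ l \<le> b" for l
  proof (cases "l \<ge> n0")
    case True
    then show ?thesis using large[of l] sum_nonneg[of "{..<n0}" "\<lambda>l. N (d l) * \<rho>' ^ l"] nn
      by (simp add: b_def)
  next
    case False
    then have "N (d l) * \<rho>' ^ l \<le> (\<Sum>l<n0. N (d l) * \<rho>' ^ l)"
      using nn by (intro member_le_sum) auto
    then show ?thesis by (simp add: b_def)
  qed
  have "b \<ge> 0" using b nn order.trans by blast
  define q where "q = \<rho> / \<rho>'"
  have q: "0 < q" "q < 1" using \<rho>' \<rho> by (auto simp: q_def)
  have dq: "N (d l) * \<rho> ^ l \<le> b * q ^ l" for l
  proof -
    have "N (d l) * \<rho> ^ l = (N (d l) * \<rho>' ^ l) * q ^ l"
      using \<open>\<rho>' > 0\<close> by (simp add: q_def power_divide)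
    also have "\<dots> \<le> b * q ^ l" using b[of l] q by (intro mult_right_mono) auto
    finally show ?thesis .
  qed
  show ?thesis
  proof (rule field_le_epsilon)
    fix e :: real assume e: "e > 0"
    have "(\<lambda>n. b / (1 - q) * q ^ n) \<longlonglongrightarrow> b / (1 - q) * 0"
      using q by (intro tendsto_mult tendsto_const LIMSEQ_power_zero) auto
    then have "\<forall>\<^sub>F n in sequentially. b / (1 - q) * q ^ n < e / 2"
      using e by (intro order_tendstoD) auto
    then have "\<forall>\<^sub>F n in sequentially. n > k \<and> b / (1 - q) * q ^ n < e / 2"
      using eventually_gt_at_top[of k] by eventually_elim auto
    from eventually_happens'[OF sequentially_bot this]
    obtain m where m: "m > k" "b / (1 - q) * q ^ m < e / 2" by blast
    define w where "w = (\<lambda>i. \<rho> * cis (2 * pi * real i / real m))"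
    have w: "w i \<in> ball 0 r" "cmod (w i) = \<rho>" for i
      using \<rho> by (auto simp: w_def norm_mult)
    have "\<forall>\<^sub>F n in sequentially. n \<ge> m \<and>
        (\<forall>i\<in>{..<m}. N (\<lambda>x. F (w i) x - (\<Sum>k<n. w i ^ k * d k x)) \<le> e / 2)"
      using conv[OF w(1) half_gt_zero[OF e]]
      by (intro eventually_conj eventually_ge_at_top eventually_ball_finite) auto
    from eventually_happens'[OF sequentially_bot this] obtain n where
      n: "n \<ge> m" "\<And>i. i < m \<Longrightarrow> N (\<lambda>x. F (w i) x - (\<Sum>k<n. w i ^ k * d k x)) \<le> e / 2" by blast
    define c where "c = root_average m k"
    have c: "c k = 1" "\<And>l. l < m \<Longrightarrow> l \<noteq> k \<Longrightarrow> c l = 0" "\<And>l. cmod (c l) \<le> 1"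
      using root_average_eq_1[OF m(1)] root_average_eq_0[OF m(1)] root_average_le_1[OF m(1)]
      by (auto simp: c_def)
    define u where "u = (\<lambda>i x. (cnj (cis (2 * pi * real i / real m)) ^ k / of_nat m) * (\<Sum>l<n. w i ^ l * d l x))"
    have u_mem: "u i \<in> B" for i unfolding u_def by (intro scale_mem S_mem)
    \<comment> \<open>Exchanging the sums produces root averages: among the indices below
      \<open>m\<close> only \<open>k\<close> survives, and the indices from \<open>m\<close> to
      \<open>n\<close> form the tail controlled by \<open>b * q ^ l\<close>.\<close>
    have "(\<Sum>i<m. u i x) = (\<Sum>i<m. \<Sum>l<n. (cis (2 * pi * real i / real m) ^ l *
         cnj (cis (2 * pi * real i / real m)) ^ k / of_nat m) * \<rho> ^ l * d l x)" for x
      by (simp add: u_def w_def sum_distrib_left power_mult_distrib mult_ac)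
    also have "\<dots> x = (\<Sum>l<n. c l * \<rho> ^ l * d l x)" for x
      by (subst sum.swap) (simp add: c_def root_average_def sum_distrib_right sum_divide_distrib)
    also have "\<dots> x = \<rho> ^ k * d k x + (\<Sum>l\<in>{m..<n}. c l * \<rho> ^ l * d l x)" for x
    proof -
      have "{..<n} = {..<m} \<union> {m..<n}" using n by auto
      then have "(\<Sum>l<n. c l * \<rho> ^ l * d l x) =
          (\<Sum>l<m. c l * \<rho> ^ l * d l x) + (\<Sum>l\<in>{m..<n}. c l * \<rho> ^ l * d l x)"
        by (simp add: sum.union_disjoint ivl_disj_int)
      also have "(\<Sum>l<m. c l * \<rho> ^ l * d l x) = (\<Sum>l<m. if l = k then \<rho> ^ k * d k x else 0)"
        using c by (intro sum.cong) auto
      finally show ?thesis using m by simp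
    qed
    finally have eq: "complex_of_real \<rho> ^ k * d k x =
        (\<Sum>i<m. u i x) - (\<Sum>l\<in>{m..<n}. c l * \<rho> ^ l * d l x)" for x by simp
    have tail_mem: "(\<lambda>x. c l * \<rho> ^ l * d l x) \<in> B" for l by (intro scale_mem d)
    have "N (d k) * \<rho> ^ k = N (\<lambda>x. complex_of_real \<rho> ^ k * d k x)"
      using \<rho> by (simp add: N_scale d norm_power)
    also have "\<dots> \<le> N (\<lambda>x. \<Sum>i<m. u i x) + N (\<lambda>x. \<Sum>l\<in>{m..<n}. c l * \<rho> ^ l * d l x)"
      unfolding eq by (intro N_diff_le sum_mem u_mem tail_mem)
    also have "N (\<lambda>x. \<Sum>i<m. u i x) \<le> (\<Sum>i<m. N (u i))" by (intro N_sum_le u_mem)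
    also have "\<dots> \<le> (\<Sum>i<m. (K + e / 2) / m)"
    proof (rule sum_mono)
      fix i assume i: "i \<in> {..<m}"
      have "N (\<lambda>x. \<Sum>l<n. w i ^ l * d l x) \<le>
          N (\<lambda>x. F (w i) x - (F (w i) x - (\<Sum>l<n. w i ^ l * d l x)))" by simp
      also have "\<dots> \<le> K + e / 2"
        using n(2)[of i] i
        by (intro order.trans[OF N_diff_le[OF F[OF w(1)] diff_mem[OF F[OF w(1)] S_mem]]] add_mono K w) auto
      finally show "N (u i) \<le> (K + e / 2) / m"
        unfolding u_def using m
        by (subst N_scale[OF S_mem]) (simp add: norm_divide norm_power divide_right_mono)
    qed
    also have "\<dots> = K + e / 2" using m by simp
    also have "N (\<lambda>x. \<Sum>l\<in>{m..<n}. c l * \<rho> ^ l * d l x) \<le> (\<Sum>l\<in>{m..<n}. N (\<lambda>x. c l * \<rho> ^ l * d l x))"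
      by (intro N_sum_le tail_mem)
    also have "\<dots> \<le> (\<Sum>l\<in>{m..<n}. b * q ^ l)"
    proof (rule sum_mono)
      fix l
      have "N (\<lambda>x. c l * \<rho> ^ l * d l x) = cmod (c l) * (N (d l) * \<rho> ^ l)"
        using \<rho> by (simp add: N_scale d norm_mult norm_power)
      also have "\<dots> \<le> 1 * (b * q ^ l)"
        using c(3)[of l] N_nonneg[OF d[of l]] \<rho> by (intro mult_mono dq) auto
      finally show "N (\<lambda>x. c l * \<rho> ^ l * d l x) \<le> b * q ^ l" by simp
    qed
    also have "\<dots> = b * ((q ^ m - q ^ n) / (1 - q))"
    proof -
      have "{..<n} = {..<m} \<union> {m..<n}" using n by auto
      then have "(\<Sum>l<n. q ^ l) = (\<Sum>l<m. q ^ l) + (\<Sum>l\<in>{m..<n}. q ^ l)"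
        by (simp add: sum.union_disjoint ivl_disj_int)
      then have "(\<Sum>l\<in>{m..<n}. q ^ l) = (q ^ m - q ^ n) / (1 - q)"
        using q by (simp add: sum_gp_strict diff_divide_distrib)
      then show ?thesis by (simp add: sum_distrib_left[symmetric])
    qed
    also have "\<dots> \<le> b / (1 - q) * q ^ m"
      using q \<open>b \<ge> 0\<close> by (simp add: field_simps divide_right_mono mult_left_mono)
    finally show "N (d k) * \<rho> ^ k \<le> K + e" using m(2) by linarith
  qed
qed

text \<open>The coefficient bound at radius \<open>r / 2\<close> makes the \<open>k\<close>-th term
  at most \<open>K * q ^ k\<close> with \<open>q = 2 * cmod z / r\<close>. For
  \<open>cmod z \<le> r / 4\<close> this ratio is at most 1/2, so the terms from
  \<open>k = 1\<close> on sum to at most \<open>2 * K * q\<close>, the stated bound.\<close>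

lemma power_series_lipschitz:
  fixes F :: "complex \<Rightarrow> 'a \<Rightarrow> complex" and d :: "nat \<Rightarrow> 'a \<Rightarrow> complex"
  assumes F: "\<And>z. z \<in> ball 0 r \<Longrightarrow> F z \<in> B" and K: "\<And>z. z \<in> ball 0 r \<Longrightarrow> N (F z) \<le> K"
    and d: "\<And>k. d k \<in> B"
    and conv: "\<And>z e. z \<in> ball 0 r \<Longrightarrow> 0 < e \<Longrightarrow>
        \<forall>\<^sub>F n in sequentially. N (\<lambda>x. F z x - (\<Sum>k<n. z ^ k * d k x)) \<le> e"
    and r: "0 < r" and z: "cmod z \<le> r / 4"
  shows "N (\<lambda>x. F z x - F 0 x) \<le> 4 * K / r * cmod z"
proof (rule field_le_epsilon)
  fix e :: real assume e: "e > 0"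
  have S_mem: "(\<lambda>x. \<Sum>k<n. z ^ k * d k x) \<in> B" for n z by (intro sum_mem scale_mem d)
  have z': "z \<in> ball 0 r" "0 \<in> ball (0::complex) r" using r z by auto
  have "0 \<le> K" using K[OF z'(2)] N_nonneg[OF F[OF z'(2)]] by simp
  have "\<forall>\<^sub>F n in sequentially. n \<ge> 1 \<and> N (\<lambda>x. F z x - (\<Sum>k<n. z ^ k * d k x)) \<le> e / 2 \<and>
      N (\<lambda>x. F 0 x - (\<Sum>k<n. 0 ^ k * d k x)) \<le> e / 2"
    using e z' by (intro eventually_conj eventually_ge_at_top conv) auto
  from eventually_happens'[OF sequentially_bot this] obtain n where
    n: "n \<ge> 1" "N (\<lambda>x. F z x - (\<Sum>k<n. z ^ k * d k x)) \<le> e / 2"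
       "N (\<lambda>x. F 0 x - (\<Sum>k<n. 0 ^ k * d k x)) \<le> e / 2" by blast
  have n_split: "{..<n} = insert 0 {1..<n}" using n by auto
  have eq0: "(\<Sum>k<n. 0 ^ k * d k x) = d 0 x" for x
    unfolding n_split by (simp add: power_0_left)
  have eq: "(\<Sum>k<n. z ^ k * d k x) - d 0 x = (\<Sum>k\<in>{1..<n}. z ^ k * d k x)" for x
    unfolding n_split by simp
  define q where "q = cmod z / (r / 2)"
  have q: "0 \<le> q" "q \<le> 1 / 2" using z r by (auto simp: q_def field_simps)
  have "N (\<lambda>x. F z x - F 0 x) =
      N (\<lambda>x. (F z x - (\<Sum>k<n. z ^ k * d k x)) + (\<Sum>k\<in>{1..<n}. z ^ k * d k x) - (F 0 x - d 0 x))"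
    by (simp only: eq[symmetric]) simp
  also have "\<dots> \<le> N (\<lambda>x. (F z x - (\<Sum>k<n. z ^ k * d k x)) + (\<Sum>k\<in>{1..<n}. z ^ k * d k x))
      + N (\<lambda>x. F 0 x - d 0 x)"
    by (intro N_diff_le add_mem diff_mem sum_mem scale_mem d F z')
  also have "N (\<lambda>x. F 0 x - d 0 x) \<le> e / 2" using n(3) unfolding eq0 .
  also have "N (\<lambda>x. (F z x - (\<Sum>k<n. z ^ k * d k x)) + (\<Sum>k\<in>{1..<n}. z ^ k * d k x)) \<le>
      N (\<lambda>x. F z x - (\<Sum>k<n. z ^ k * d k x)) + N (\<lambda>x. \<Sum>k\<in>{1..<n}. z ^ k * d k x)"
    by (intro N_add_le diff_mem sum_mem scale_mem d F z')
  also have "N (\<lambda>x. F z x - (\<Sum>k<n. z ^ k * d k x)) \<le> e / 2" by (rule n(2))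
  also have "N (\<lambda>x. \<Sum>k\<in>{1..<n}. z ^ k * d k x) \<le> (\<Sum>k\<in>{1..<n}. N (\<lambda>x. z ^ k * d k x))"
    by (intro N_sum_le scale_mem d)
  also have "\<dots> \<le> (\<Sum>k\<in>{1..<n}. K * q ^ k)"
  proof (rule sum_mono)
    fix k
    have "N (\<lambda>x. z ^ k * d k x) = q ^ k * (N (d k) * (r / 2) ^ k)"
      using r by (simp add: N_scale d norm_power q_def power_divide)
    also have "\<dots> \<le> q ^ k * K"
      using r q by (intro mult_left_mono power_series_coeff_bound[OF F K d conv, where r=r]) auto
    finally show "N (\<lambda>x. z ^ k * d k x) \<le> K * q ^ k" by (simp add: mult.commute)
  qed
  also have "\<dots> \<le> K * (2 * q)"
  proof -
    have "(\<Sum>k<n. q ^ k) = 1 + (\<Sum>k\<in>{1..<n}. q ^ k)" unfolding n_split by simp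
    then have "(\<Sum>k\<in>{1..<n}. q ^ k) = (1 - q ^ n) / (1 - q) - 1" using q by (simp add: sum_gp_strict)
    also have "\<dots> \<le> 1 / (1 - q) - 1" using q by (intro diff_right_mono divide_right_mono) auto
    also have "\<dots> = q / (1 - q)" using q by (simp add: field_simps)
    also have "\<dots> \<le> q / (1 / 2)" using q by (intro divide_left_mono) auto
    finally have "(\<Sum>k\<in>{1..<n}. q ^ k) \<le> 2 * q" by simp
    then show ?thesis using \<open>0 \<le> K\<close> by (simp add: sum_distrib_left[symmetric] mult_left_mono)
  qed
  also have "K * (2 * q) = 4 * K / r * cmod z" by (simp add: q_def)
  finally show "N (\<lambda>x. F z x - F 0 x) \<le> 4 * K / r * cmod z + e" by linarith
qed

end

lemma bounded_linear_betweenD: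
  assumes "bounded_linear_between B N B' N' P" "g \<in> B"
  shows "P g \<in> B'" "g' \<in> B \<Longrightarrow> P (\<lambda>x. g x + g' x) = (\<lambda>x. P g x + P g' x)"
    "P (\<lambda>x. c * g x) = (\<lambda>x. c * P g x)"
  using assms unfolding bounded_linear_between_def by blast+

text \<open>Linearity and a Lipschitz bound at the origin, with constants free of \<open>j\<close>,
  are all that the operator argument takes from analyticity; holomorphy of the moment generating
  functions comes from boundedness of the sums instead.\<close>

lemma uniformly_analytic_lipschitz:
  assumes bfs: "\<And>j. banach_function_space (M j) (B j) (N j)"
    and an: "uniformly_analytic_at_0 B N P"
  obtains r K where "0 < r" "0 \<le> K"
    "\<And>j z. cmod z \<le> r \<Longrightarrow> bounded_linear_between (B j) (N j) (B (Suc j)) (N (Suc j)) (P j z)"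
    "\<And>j z g. cmod z \<le> r \<Longrightarrow> g \<in> B j \<Longrightarrow> N (Suc j) (\<lambda>x. P j z g x - P j 0 g x) \<le> K * cmod z * N j g"
proof -
  obtain r K where r: "r > 0" and *: "\<forall>j.
        (\<forall>z\<in>ball 0 r. bounded_linear_between (B j) (N j) (B (Suc j)) (N (Suc j)) (P j z) \<and>
           (\<forall>g\<in>B j. N (Suc j) (P j z g) \<le> K * N j g)) \<and>
        (\<exists>D :: nat \<Rightarrow> ('a \<Rightarrow> complex) \<Rightarrow> ('a \<Rightarrow> complex).
           (\<forall>k. bounded_linear_between (B j) (N j) (B (Suc j)) (N (Suc j)) (D k)) \<and>
           (\<forall>z\<in>ball 0 r. \<forall>e>0. \<forall>\<^sub>F n in sequentially. \<forall>g\<in>B j.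
              N (Suc j) (\<lambda>x. P j z g x - (\<Sum>k<n. z ^ k * D k g x)) \<le> e * N j g))"
    using an unfolding uniformly_analytic_at_0_def by blast
  show ?thesis
  proof (rule that[of "r / 4" "\<bar>4 * K / r\<bar>"])
    show "0 < r / 4" "0 \<le> \<bar>4 * K / r\<bar>" using r by auto
    show "bounded_linear_between (B j) (N j) (B (Suc j)) (N (Suc j)) (P j z)" if "cmod z \<le> r / 4" for j z
      using * that r by auto
    fix j z g assume z: "cmod z \<le> r / 4" and g: "g \<in> B j"
    interpret J: banach_functions "M j" "B j" "N j" by unfold_locales (rule bfs)
    interpret J': banach_functions "M (Suc j)" "B (Suc j)" "N (Suc j)" by unfold_locales (rule bfs)
    obtain D where D: "\<And>k. bounded_linear_between (B j) (N j) (B (Suc j)) (N (Suc j)) (D k)"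
      and conv: "\<And>z e. z \<in> ball 0 r \<Longrightarrow> e > 0 \<Longrightarrow> \<forall>\<^sub>F n in sequentially. \<forall>g\<in>B j.
              N (Suc j) (\<lambda>x. P j z g x - (\<Sum>k<n. z ^ k * D k g x)) \<le> e * N j g"
      using *[THEN spec, of j, THEN conjunct2] by blast
    have "N (Suc j) (\<lambda>x. P j z g x - P j 0 g x) \<le> 4 * (K * N j g) / r * cmod z"
    proof (rule J'.power_series_lipschitz[where F = "\<lambda>z. P j z g" and d = "\<lambda>k. D k g"])
      show "P j z g \<in> B (Suc j)" "N (Suc j) (P j z g) \<le> K * N j g" if "z \<in> ball 0 r" for z
        using *[THEN spec, of j] that g by (auto dest: bounded_linear_betweenD)
      show "D k g \<in> B (Suc j)" for k using bounded_linear_betweenD(1)[OF D g] .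
      show "\<forall>\<^sub>F n in sequentially. N (Suc j) (\<lambda>x. P j z g x - (\<Sum>k<n. z ^ k * D k g x)) \<le> e"
        if "z \<in> ball 0 r" "0 < e" for z e
      proof -
        \<comment> \<open>The hypothesis bounds the error relative to \<open>N j g\<close>; dividing
          \<open>e\<close> by \<open>N j g + 1\<close> covers the case \<open>N j g = 0\<close> as
          well.\<close>
        have pos: "N j g + 1 > 0" using J.N_nonneg[OF g] by simp
        have "\<forall>\<^sub>F n in sequentially. \<forall>g\<in>B j. N (Suc j) (\<lambda>x. P j z g x - (\<Sum>k<n. z ^ k * D k g x)) \<le> e / (N j g0 + 1) * N j g"
          if "g0 \<in> B j" for g0
          using \<open>0 < e\<close> J.N_nonneg[OF that] by (intro conv \<open>z \<in> ball 0 r\<close>) auto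
        from this[OF g] show ?thesis
        proof eventually_elim
          case (elim n)
          then have "N (Suc j) (\<lambda>x. P j z g x - (\<Sum>k<n. z ^ k * D k g x)) \<le> e / (N j g + 1) * N j g"
            using g by blast
          also have "\<dots> \<le> e" using pos \<open>0 < e\<close> by (simp add: field_simps)
          finally show ?case .
        qed
      qed
    qed (use r z in auto)
    also have "\<dots> = (4 * K / r) * (cmod z * N j g)" by simp
    also have "\<dots> \<le> \<bar>4 * K / r\<bar> * (cmod z * N j g)"
      using J.N_nonneg[OF g] by (intro mult_right_mono abs_ge_self) auto
    finally show "N (Suc j) (\<lambda>x. P j z g x - P j 0 g x) \<le> \<bar>4 * K / r\<bar> * cmod z * N j g" by (simp add: mult.assoc)
  qed
qed

section \<open>Twisted transfer operators\<close>

lemma transfer_iter_Suc_left: "transfer_iter L j (Suc n) g = transfer_iter L (Suc j) n (L j g)"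
  by (induction n) simp_all



text \<open>The existential constants of the theorem are named here. The analytic family appears
  only through its Lipschitz bound and linearity, and \<open>f\<close> only through measurability
  and the uniform bound \<open>b\<close>.\<close>

locale sequential_system =
  fixes M :: "nat \<Rightarrow> 'a measure"
    and T :: "nat \<Rightarrow> 'a \<Rightarrow> 'a"
    and L :: "nat \<Rightarrow> ('a \<Rightarrow> complex) \<Rightarrow> ('a \<Rightarrow> complex)"
    and B :: "nat \<Rightarrow> ('a \<Rightarrow> complex) set"
    and N :: "nat \<Rightarrow> ('a \<Rightarrow> complex) \<Rightarrow> real"
    and h f :: "nat \<Rightarrow> 'a \<Rightarrow> real"
    and A \<delta> C H b r\<^sub>0 K :: real
  assumes prob: "\<And>j. prob_space (M j)"
    and T_meas: "\<And>j. T j \<in> measurable (M j) (M (Suc j))"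
    and transfer: "\<And>j. transfer_operator (M j) (M (Suc j)) (T j) (L j)"
    and banach: "\<And>j. banach_function_space (M j) (B j) (N j)"
    and C: "0 \<le> C" "\<And>j g x. g \<in> B j \<Longrightarrow> x \<in> space (M j) \<Longrightarrow> cmod (g x) \<le> C * N j g"
    and \<delta>: "0 < \<delta>" "\<delta> < 1"
    and h_mem: "\<And>j. (\<lambda>x. complex_of_real (h j x)) \<in> B j"
    and H: "\<And>j. N j (\<lambda>x. complex_of_real (h j x)) \<le> H"
    and decay: "\<And>j n g. g \<in> B j \<Longrightarrow> n \<ge> 1 \<Longrightarrow>
        N (j + n) (\<lambda>x. transfer_iter L j n g x -
                        (\<integral>y. g y \<partial>M j) * complex_of_real (h (j + n) x)) \<le> A * N j g * \<delta> ^ n"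
    and f_meas: "\<And>j. f j \<in> borel_measurable (M j)"
    and f_le: "\<And>j x. x \<in> space (M j) \<Longrightarrow> \<bar>f j x\<bar> \<le> b"
    and b: "0 \<le> b"
    and r\<^sub>0: "0 < r\<^sub>0" and K: "0 \<le> K"
    and twisted_linear: "\<And>j z. cmod z \<le> r\<^sub>0 \<Longrightarrow>
        bounded_linear_between (B j) (N j) (B (Suc j)) (N (Suc j)) (twisted (L j) (f j) z)"
    and twisted_lipschitz: "\<And>j z g. cmod z \<le> r\<^sub>0 \<Longrightarrow> g \<in> B j \<Longrightarrow>
        N (Suc j) (\<lambda>x. twisted (L j) (f j) z g x - twisted (L j) (f j) 0 g x) \<le> K * cmod z * N j g"
    and one_mem: "indicator (space (M 0)) \<in> B 0"
begin

sublocale M: prob_space "M j" for j by (rule prob)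
sublocale BN: banach_functions "M j" "B j" "N j" for j by unfold_locales (rule banach)

abbreviation S :: "nat \<Rightarrow> 'a \<Rightarrow> real" where "S \<equiv> birkhoff_sum T f"

section \<open>Duality between twisted iterates and moment generating functions\<close>

definition Z :: "nat \<Rightarrow> complex \<Rightarrow> complex" where "Z n z = (\<integral>x. exp (z * of_real (S n x)) \<partial>M 0)"

text \<open>The start is an indicator rather than the constant 1 because members of
  \<open>B 0\<close> vanish outside the space.\<close>

primrec twisted_iter :: "complex \<Rightarrow> nat \<Rightarrow> 'a \<Rightarrow> complex" where
  "twisted_iter z 0 = indicator (space (M 0))"
| "twisted_iter z (Suc n) = twisted (L n) (f n) z (twisted_iter z n)"

lemma twisted_0 [simp]: "twisted (L j) (f j) 0 = L j"
  by (simp add: twisted_def fun_eq_iff)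

lemma L_linear: "bounded_linear_between (B j) (N j) (B (Suc j)) (N (Suc j)) (L j)"
  using twisted_linear[of 0 j] r\<^sub>0 by simp

lemma L_mem: "g \<in> B j \<Longrightarrow> L j g \<in> B (Suc j)"
  by (rule bounded_linear_betweenD(1)[OF L_linear])

lemma transfer_iter_mem: "g \<in> B j \<Longrightarrow> transfer_iter L j n g \<in> B (j + n)"
  by (induction n) (auto intro: L_mem)

lemma L_diff:
  assumes "g \<in> B j" "g' \<in> B j"
  shows "L j (\<lambda>x. g x - g' x) = (\<lambda>x. L j g x - L j g' x)"
proof -
  have "L j (\<lambda>x. g x + (-1) * g' x) = (\<lambda>x. L j g x + L j (\<lambda>x. (-1) * g' x) x)"
    by (rule bounded_linear_betweenD(2)[OF L_linear assms(1) BN.scale_mem[OF assms(2)]])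
  also have "L j (\<lambda>x. (-1) * g' x) = (\<lambda>x. (-1) * L j g' x)"
    by (rule bounded_linear_betweenD(3)[OF L_linear assms(2)])
  finally show ?thesis by simp
qed

lemma transfer_iter_diff:
  assumes "g \<in> B j" "g' \<in> B j"
  shows "transfer_iter L j n (\<lambda>x. g x - g' x) = (\<lambda>x. transfer_iter L j n g x - transfer_iter L j n g' x)"
  by (induction n) (auto simp: L_diff transfer_iter_mem assms)

lemma twisted_iter_mem: "cmod z \<le> r\<^sub>0 \<Longrightarrow> twisted_iter z n \<in> B n"
  by (induction n) (auto intro: bounded_linear_betweenD(1)[OF twisted_linear] one_mem)

lemma orbit_measurable [measurable]: "orbit T n \<in> measurable (M 0) (M n)"
proof (induction n)
  case (Suc n)
  have "(\<lambda>x. T n (orbit T n x)) \<in> measurable (M 0) (M (Suc n))"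
    using measurable_compose[OF Suc T_meas[of n]] .
  then show ?case by simp
qed simp

lemma S_Suc: "S (Suc n) x = S n x + f n (orbit T n x)"
  by (simp add: birkhoff_sum_def)

lemma S_measurable [measurable]: "S n \<in> borel_measurable (M 0)"
  unfolding birkhoff_sum_def
  by (intro borel_measurable_sum measurable_compose[OF orbit_measurable f_meas])

lemma S_le: "x \<in> space (M 0) \<Longrightarrow> \<bar>S n x\<bar> \<le> real n * b"
proof -
  assume x: "x \<in> space (M 0)"
  have "\<bar>S n x\<bar> \<le> (\<Sum>j<n. \<bar>f j (orbit T j x)\<bar>)" unfolding birkhoff_sum_def by (rule sum_abs)
  also have "\<dots> \<le> (\<Sum>j<n. b)"
    using measurable_space[OF orbit_measurable x] by (intro sum_mono f_le) auto
  finally show ?thesis by simp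
qed

lemma exp_le:
  assumes "\<bar>y\<bar> \<le> c"
  shows "cmod (exp (z * of_real y)) \<le> exp (cmod z * c)"
proof -
  have "cmod (exp (z * of_real y)) \<le> exp (cmod (z * of_real y))" by (rule norm_exp)
  also have "\<dots> \<le> exp (cmod z * c)" using assms by (simp add: norm_mult mult_left_mono)
  finally show ?thesis .
qed

lemma integral_transfer:
  assumes "g \<in> borel_measurable (M j)" "\<And>x. x \<in> space (M j) \<Longrightarrow> cmod (g x) \<le> c"
    and "u \<in> borel_measurable (M (Suc j))" "\<And>x. x \<in> space (M (Suc j)) \<Longrightarrow> cmod (u x) \<le> c'"
  shows "(\<integral>x. L j g x * u x \<partial>M (Suc j)) = (\<integral>x. g x * u (T j x) \<partial>M j)"
proof -
  have "bounded (g ` space (M j))" "bounded (u ` space (M (Suc j)))"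
    using assms by (auto simp: bounded_iff)
  then show ?thesis
    using transfer[of j, unfolded transfer_operator_def, THEN bspec, OF assms(1)] assms(3) by simp
qed

text \<open>A general test function keeps the induction going: one use of duality replaces
  \<open>u\<close> by the product of \<open>exp (z * f n)\<close> and \<open>u\<close> composed with
  \<open>T n\<close>. The case \<open>u = 1\<close> identifies \<open>Z\<close>.\<close>

lemma integral_twisted_iter:
  assumes z: "cmod z \<le> r\<^sub>0"
    and u: "u \<in> borel_measurable (M n)" "\<And>x. x \<in> space (M n) \<Longrightarrow> cmod (u x) \<le> c"
  shows "(\<integral>x. twisted_iter z n x * u x \<partial>M n) = (\<integral>x. exp (z * of_real (S n x)) * u (orbit T n x) \<partial>M 0)"
  using u
proof (induction n arbitrary: u c)
  case 0
  show ?case by (intro Bochner_Integration.integral_cong) (auto simp: birkhoff_sum_def)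
next
  case (Suc n)
  note twisted_iter_mem[OF z, of n]
  note twisted_iter = BN.measurable_mem[OF this] C(2)[OF this]
  have [measurable]: "twisted_iter z n \<in> borel_measurable (M n)" "f n \<in> borel_measurable (M n)" by (rule twisted_iter f_meas)+
  have uT[measurable]: "(\<lambda>x. u (T n x)) \<in> borel_measurable (M n)"
    using measurable_compose[OF T_meas Suc.prems(1)] .
  have uT': "cmod (u (T n x)) \<le> c" if "x \<in> space (M n)" for x
    using measurable_space[OF T_meas that] by (rule Suc.prems(2))
  have "(\<integral>x. twisted_iter z (Suc n) x * u x \<partial>M (Suc n)) = (\<integral>x. exp (z * of_real (f n x)) * twisted_iter z n x * u (T n x) \<partial>M n)"
    unfolding twisted_iter.simps twisted_def
  proof (rule integral_transfer[OF _ _ Suc.prems])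
    fix x assume x: "x \<in> space (M n)"
    show "cmod (exp (z * of_real (f n x)) * twisted_iter z n x) \<le> exp (cmod z * b) * (C * N n (twisted_iter z n))"
      unfolding norm_mult by (intro mult_mono exp_le f_le twisted_iter x) auto
  qed auto
  also have "\<dots> = (\<integral>x. twisted_iter z n x * (exp (z * of_real (f n x)) * u (T n x)) \<partial>M n)" by (simp add: mult_ac)
  also have "\<dots> = (\<integral>x. exp (z * of_real (S n x)) * (exp (z * of_real (f n (orbit T n x))) * u (T n (orbit T n x))) \<partial>M 0)"
  proof (rule Suc.IH)
    fix x assume x: "x \<in> space (M n)"
    show "cmod (exp (z * of_real (f n x)) * u (T n x)) \<le> exp (cmod z * b) * c"
      unfolding norm_mult by (intro mult_mono exp_le f_le uT' x) auto
  qed auto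
  also have "\<dots> = (\<integral>x. exp (z * of_real (S (Suc n) x)) * u (orbit T (Suc n) x) \<partial>M 0)"
    by (simp add: S_Suc exp_add algebra_simps)
  finally show ?case .
qed

lemma Z_eq_integral_twisted_iter: "cmod z \<le> r\<^sub>0 \<Longrightarrow> Z n z = (\<integral>x. twisted_iter z n x \<partial>M n)"
  using integral_twisted_iter[of z "\<lambda>_. 1" n 1] by (simp add: Z_def)

lemma Z_0 [simp]: "Z 0 z = 1" by (simp add: Z_def birkhoff_sum_def M.prob_space)

text \<open>Both values are integrals of the same iterate, with and without the factor
  \<open>exp (z * f n)\<close>. The difference carries \<open>exp (z * f n) - 1\<close>, whose size
  is of order \<open>cmod z * b\<close>.\<close>

lemma Z_Suc_diff_le:
  assumes z: "cmod z \<le> r\<^sub>0"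
  shows "cmod (Z (Suc n) z - Z n z) \<le> cmod z * b * exp (cmod z * b) * (C * N n (twisted_iter z n))"
proof -
  note twisted_iter_mem[OF z, of n]
  note twisted_iter = BN.measurable_mem[OF this] C(2)[OF this]
  have [measurable]: "twisted_iter z n \<in> borel_measurable (M n)" "f n \<in> borel_measurable (M n)" by (rule twisted_iter f_meas)+
  have e: "cmod (exp (z * of_real (f n x))) \<le> exp (cmod z * b)" if "x \<in> space (M n)" for x
    by (intro exp_le f_le that)
  have "Z (Suc n) z = (\<integral>x. twisted_iter z n x * exp (z * of_real (f n x)) \<partial>M n)"
    unfolding Z_def S_Suc
    by (subst integral_twisted_iter[OF z _ e]) (simp_all add: exp_add algebra_simps)
  moreover have "integrable (M n) (\<lambda>x. twisted_iter z n x * exp (z * of_real (f n x)))"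
  proof (rule M.integrable_bounded[where c = "(C * N n (twisted_iter z n)) * exp (cmod z * b)"])
    fix x assume x: "x \<in> space (M n)"
    have "0 \<le> C * N n (twisted_iter z n)" using order.trans[OF norm_ge_zero twisted_iter(2)[OF x]] .
    then show "cmod (twisted_iter z n x * exp (z * of_real (f n x))) \<le> (C * N n (twisted_iter z n)) * exp (cmod z * b)"
      unfolding norm_mult by (intro mult_mono twisted_iter(2) e x) auto
  qed measurable
  moreover have "integrable (M n) (twisted_iter z n)" using twisted_iter by (intro M.integrable_bounded)
  ultimately have "Z (Suc n) z - Z n z = (\<integral>x. (exp (z * of_real (f n x)) - 1) * twisted_iter z n x \<partial>M n)"
    using z by (simp add: Z_eq_integral_twisted_iter algebra_simps)
  also have "cmod \<dots> \<le> (cmod z * b * exp (cmod z * b)) * (C * N n (twisted_iter z n))"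
  proof (rule M.norm_integral_le)
    fix x assume x: "x \<in> space (M n)"
    have "cmod (z * of_real (f n x)) \<le> cmod z * b" using f_le[OF x] by (simp add: norm_mult mult_left_mono)
    then have "cmod (exp (z * of_real (f n x)) - 1) \<le> cmod z * b * exp (cmod z * b)"
      using b by (intro order.trans[OF cmod_exp_minus_1_le] mult_mono) auto
    then show "cmod ((exp (z * of_real (f n x)) - 1) * twisted_iter z n x) \<le> (cmod z * b * exp (cmod z * b)) * (C * N n (twisted_iter z n))"
      unfolding norm_mult using b by (intro mult_mono twisted_iter x) auto
  qed auto
  finally show ?thesis .
qed

section \<open>Loss of memory along the twisted iteration\<close>

definition A' :: real where "A' = max A (1 + C * H)"

lemma H_nonneg: "0 \<le> H" using order.trans[OF BN.N_nonneg[OF h_mem] H] .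

lemma A'_ge_1: "1 \<le> A'" unfolding A'_def using C(1) H_nonneg by (simp add: max.coboundedI2)

lemma integral_le: "g \<in> B j \<Longrightarrow> cmod (\<integral>x. g x \<partial>M j) \<le> C * N j g"
  by (intro M.norm_integral_le C(2) BN.measurable_mem)

text \<open>The assumption \<open>decay\<close> starts at \<open>n = 1\<close>. For
  \<open>n = 0\<close> the triangle inequality with \<open>integral_le\<close> and \<open>H\<close>
  gives the factor \<open>1 + C * H\<close>, which explains the second entry of
  \<open>A'\<close>.\<close>

lemma decay_iter: 
  assumes g: "g \<in> B j"
  shows "N (j + n) (\<lambda>x. transfer_iter L j n g x - (\<integral>y. g y \<partial>M j) * complex_of_real (h (j + n) x))
    \<le> A' * N j g * \<delta> ^ n"
proof (cases "n \<ge> 1")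
  case True
  have "N (j + n) (\<lambda>x. transfer_iter L j n g x - (\<integral>y. g y \<partial>M j) * complex_of_real (h (j + n) x))
    \<le> A * (N j g * \<delta> ^ n)" using decay[OF g True] by (simp add: mult.assoc)
  also have "\<dots> \<le> A' * (N j g * \<delta> ^ n)"
    using BN.N_nonneg[OF g] \<delta> by (intro mult_right_mono) (auto simp: A'_def)
  finally show ?thesis by (simp add: mult.assoc)
next
  case False
  have "N j (\<lambda>x. g x - (\<integral>y. g y \<partial>M j) * complex_of_real (h j x)) \<le>
      N j g + cmod (\<integral>y. g y \<partial>M j) * N j (\<lambda>x. complex_of_real (h j x))"
    using BN.N_diff_le[OF g BN.scale_mem[OF h_mem]] BN.N_scale[OF h_mem] by metis
  also have "\<dots> \<le> N j g + (C * N j g) * H"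
    using BN.N_nonneg[OF g] C(1) BN.N_nonneg[OF h_mem] by (intro add_left_mono mult_mono integral_le g H) auto
  also have "\<dots> = (1 + C * H) * N j g" by (simp add: algebra_simps)
  also have "\<dots> \<le> A' * N j g" using BN.N_nonneg[OF g] by (intro mult_right_mono) (auto simp: A'_def)
  finally show ?thesis using False by (simp add: not_le less_Suc_eq)
qed

text \<open>Solves \<open>D = D / 2 + A' * N1 + H\<close>, with \<open>N1\<close> the norm of the
  initial function: in the inductive step the accumulated perturbations return half of
  \<open>D\<close>, and the rest pays for the initial value and for the limit function
  \<open>h\<close>.\<close>

definition D :: real where "D = 2 * (H + A' * N 0 (indicator (space (M 0))))"

text \<open>
  Both bounds are proved together: the norm bound for indices below \<open>n\<close> keeps consecutive ratios of
  \<open>Z\<close> above \<open>a = (1 + \<delta>) / 2 > \<delta>\<close>, so the perturbations created at time \<open>j\<close> are forgotten at the rate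
  \<open>\<delta> / a < 1\<close> relative to \<open>Z n z\<close>.
\<close>

lemma twisted_iter_le:
  assumes z: "cmod z \<le> r\<^sub>0" and \<epsilon>: "A' * (K * cmod z) \<le> (1 - \<delta>) / 4"
    and \<eta>: "cmod z * b * exp (cmod z * b) * (C * D) \<le> (1 - \<delta>) / 2"
  shows "N n (twisted_iter z n) \<le> D * cmod (Z n z) \<and> ((1 + \<delta>) / 2) ^ n \<le> cmod (Z n z)"
proof (induction n rule: less_induct)
  case (less n)
  define a where "a = (1 + \<delta>) / 2"
  define q where "q = \<delta> / a"
  define N1 where "N1 = N 0 (indicator (space (M 0)))"
  have N1: "0 \<le> N1" unfolding N1_def by (intro BN.N_nonneg one_mem)
  have D: "0 \<le> D" using H_nonneg A'_ge_1 N1 unfolding D_def N1_def[symmetric] by simp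
  have a: "0 < a" "\<delta> < a" "a < 1" using \<delta> by (auto simp: a_def)
  have q: "0 < q" "q < 1" using a \<delta> by (auto simp: q_def)
  \<comment> \<open>The hypothesis \<open>\<eta>\<close> makes the relative change at most
    \<open>(1 - \<delta>) / 2 = 1 - a\<close>.\<close>
  have step: "a * cmod (Z j z) \<le> cmod (Z (Suc j) z)" if "j < n" for j
  proof -
    have "cmod (Z (Suc j) z - Z j z) \<le> cmod z * b * exp (cmod z * b) * (C * N j (twisted_iter z j))"
      by (rule Z_Suc_diff_le[OF z])
    also have "\<dots> \<le> cmod z * b * exp (cmod z * b) * (C * (D * cmod (Z j z)))"
      using less[OF that] b C(1) by (intro mult_left_mono) auto
    also have "\<dots> = (cmod z * b * exp (cmod z * b) * (C * D)) * cmod (Z j z)" by simp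
    also have "\<dots> \<le> ((1 - \<delta>) / 2) * cmod (Z j z)" using \<eta> by (intro mult_right_mono) auto
    finally have "cmod (Z j z) - ((1 - \<delta>) / 2) * cmod (Z j z) \<le> cmod (Z (Suc j) z)"
      using norm_triangle_ineq2[of "Z j z" "Z j z - Z (Suc j) z"] by (simp add: norm_minus_commute)
    then show ?thesis by (simp add: a_def field_simps)
  qed
  have ratio: "j \<le> n \<Longrightarrow> a ^ (n - j) * cmod (Z j z) \<le> cmod (Z n z)" for j
  proof (induction "n - j" arbitrary: j)
    case (Suc k)
    then have j: "j < n" "n - j = Suc (n - Suc j)" by auto
    have "a ^ (n - j) * cmod (Z j z) = a ^ (n - Suc j) * (a * cmod (Z j z))"
      unfolding j(2) by simp
    also have "\<dots> \<le> a ^ (n - Suc j) * cmod (Z (Suc j) z)" using a j by (intro mult_left_mono step) auto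
    also have "\<dots> \<le> cmod (Z n z)" using Suc j by auto
    finally show ?case .
  qed simp
  \<comment> \<open>Twisted operators up to time \<open>j\<close>, untwisted ones afterwards, minus
    the expected limit. \<open>v n\<close> is the deviation of the iterate itself and
    \<open>v 0\<close> that of the purely untwisted evolution, so their difference telescopes over
    the times at which a single operator is exchanged.\<close>
  define v where "v = (\<lambda>j x. transfer_iter L j (n - j) (twisted_iter z j) x - Z j z * complex_of_real (h n x))"
  have iter_mem: "transfer_iter L j (n - j) g \<in> B n" if "j \<le> n" "g \<in> B j" for j g
    using transfer_iter_mem[OF that(2), of "n - j"] that by simp
  have v_mem: "v j \<in> B n" if "j \<le> n" for j
    unfolding v_def using that by (intro BN.diff_mem BN.scale_mem h_mem iter_mem twisted_iter_mem z)
  \<comment> \<open>Exchanging one operator creates the perturbation \<open>R\<close>, small by the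
    Lipschitz bound. Its mean is \<open>Z (Suc j) z - Z j z\<close>, so what remains after removing
    the mean is contracted by the untwisted evolution up to time \<open>n\<close>.\<close>
  have v_step: "N n (\<lambda>x. v (Suc j) x - v j x) \<le> A' * (K * cmod z) * D / a * cmod (Z n z) * q ^ (n - Suc j)"
    if j: "j < n" for j
  proof -
    define R where "R = (\<lambda>x. twisted_iter z (Suc j) x - L j (twisted_iter z j) x)"
    have R: "R \<in> B (Suc j)" unfolding R_def by (intro BN.diff_mem L_mem twisted_iter_mem z)
    have NR: "N (Suc j) R \<le> K * cmod z * N j (twisted_iter z j)"
      using twisted_lipschitz[OF z twisted_iter_mem[OF z, of j]] by (simp add: R_def)
    have int_tw: "integrable (M i) (twisted_iter z i)" for i
      using twisted_iter_mem[OF z] BN.measurable_mem C(2) by (intro M.integrable_bounded) blast+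
    have int_L: "(\<integral>x. L j (twisted_iter z j) x \<partial>M (Suc j)) = Z j z"
      using integral_transfer[of "twisted_iter z j" j _ "\<lambda>_. 1" 1, OF BN.measurable_mem C(2)] twisted_iter_mem[OF z, of j] z
      by (simp add: Z_eq_integral_twisted_iter)
    have "integrable (M (Suc j)) (L j (twisted_iter z j))"
      using L_mem[OF twisted_iter_mem[OF z, of j]] BN.measurable_mem C(2) by (intro M.integrable_bounded) blast+
    then have intR: "(\<integral>x. R x \<partial>M (Suc j)) = Z (Suc j) z - Z j z"
      unfolding R_def using int_tw[of "Suc j"]
      by (subst Bochner_Integration.integral_diff) (simp_all add: int_L Z_eq_integral_twisted_iter[OF z] del: twisted_iter.simps)
    have nj: "n - j = Suc (n - Suc j)" "Suc j + (n - Suc j) = n" using j by auto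
    have "(\<lambda>x. v (Suc j) x - v j x) =
        (\<lambda>x. transfer_iter L (Suc j) (n - Suc j) R x - (\<integral>x. R x \<partial>M (Suc j)) * complex_of_real (h n x))"
    proof -
      have "transfer_iter L (Suc j) (n - Suc j) R = (\<lambda>x. transfer_iter L (Suc j) (n - Suc j) (twisted_iter z (Suc j)) x
          - transfer_iter L (Suc j) (n - Suc j) (L j (twisted_iter z j)) x)"
        unfolding R_def by (intro transfer_iter_diff twisted_iter_mem[OF z] L_mem)
      then show ?thesis
        unfolding v_def intR nj(1) transfer_iter_Suc_left by (simp add: algebra_simps del: twisted_iter.simps)
    qed
    then have "N n (\<lambda>x. v (Suc j) x - v j x) \<le> A' * N (Suc j) R * \<delta> ^ (n - Suc j)"
      using decay_iter[OF R, of "n - Suc j"] unfolding nj(2) by simp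
    also have "\<dots> \<le> A' * (K * cmod z * (D * cmod (Z j z))) * \<delta> ^ (n - Suc j)"
    proof -
      have "N (Suc j) R \<le> K * cmod z * (D * cmod (Z j z))"
        using less[OF j] K by (intro order.trans[OF NR] mult_left_mono) auto
      then show ?thesis using A'_ge_1 \<delta> by (intro mult_right_mono mult_left_mono) auto
    qed
    \<comment> \<open>Passing from \<open>Z j z\<close> to \<open>Z n z\<close> costs a factor
      \<open>1 / a\<close> per step, which the decay by \<open>\<delta>\<close> outweighs. The
      exponents \<open>n - j\<close> and \<open>n - Suc j\<close> differ by one, which leaves the
      single factor \<open>1 / a\<close>.\<close>
    also have "\<dots> = (A' * (K * cmod z) * D / a) * (a ^ (n - j) * cmod (Z j z)) * q ^ (n - Suc j)"
      using a unfolding nj(1) by (simp add: q_def power_divide)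
    also have "\<dots> \<le> (A' * (K * cmod z) * D / a) * cmod (Z n z) * q ^ (n - Suc j)"
      using a A'_ge_1 K D q j by (intro mult_right_mono mult_left_mono ratio) auto
    finally show ?thesis .
  qed
  have v0: "N n (v 0) \<le> A' * N1 * cmod (Z n z)"
  proof -
    have "N n (v 0) \<le> A' * N1 * \<delta> ^ n"
      using decay_iter[OF one_mem, of n] Z_eq_integral_twisted_iter[OF z, of 0] by (simp add: v_def N1_def)
    also have "\<dots> \<le> A' * N1 * a ^ n"
      using a \<delta> A'_ge_1 N1 by (intro mult_left_mono power_mono) auto
    also have "\<dots> \<le> A' * N1 * cmod (Z n z)"
      using ratio[of 0] A'_ge_1 N1 by (intro mult_left_mono) auto
    finally show ?thesis .
  qed
  have "N n (\<lambda>x. v n x - v 0 x) \<le> (\<Sum>j<n. N n (\<lambda>x. v (Suc j) x - v j x))"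
  proof -
    have "(\<lambda>x. v n x - v 0 x) = (\<lambda>x. \<Sum>j<n. v (Suc j) x - v j x)"
      using sum_lessThan_telescope[of "\<lambda>j. v j _" n] by (intro ext) simp
    moreover have "N n (\<lambda>x. \<Sum>j<n. v (Suc j) x - v j x) \<le> (\<Sum>j<n. N n (\<lambda>x. v (Suc j) x - v j x))"
      by (intro BN.N_sum_le BN.diff_mem v_mem) auto
    ultimately show ?thesis by simp
  qed
  also have "\<dots> \<le> (\<Sum>j<n. A' * (K * cmod z) * D / a * cmod (Z n z) * q ^ (n - Suc j))"
    by (intro sum_mono v_step) auto
  also have "\<dots> = A' * (K * cmod z) * D / a * cmod (Z n z) * (\<Sum>j<n. q ^ j)"
    by (simp only: sum_distrib_left[symmetric] sum.nat_diff_reindex[of "\<lambda>j. q ^ j"])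
  also have "\<dots> \<le> A' * (K * cmod z) * D / a * cmod (Z n z) * (1 / (1 - q))"
  proof -
    have "(\<Sum>j<n. q ^ j) \<le> 1 / (1 - q)" using q by (simp add: sum_gp_strict divide_right_mono)
    then show ?thesis using a A'_ge_1 K D by (intro mult_left_mono) auto
  qed
  \<comment> \<open>Here \<open>a * (1 - q) = a - \<delta> = (1 - \<delta>) / 2\<close>; together
    with the quarter in hypothesis \<open>\<epsilon>\<close> this leaves exactly
    \<open>D / 2\<close>.\<close>
  also have "\<dots> = (A' * (K * cmod z)) * (2 / (1 - \<delta>)) * D * cmod (Z n z)"
  proof -
    have "a * (1 - q) = (1 - \<delta>) / 2" using a by (simp add: q_def a_def field_simps)
    moreover have "1 / a * (1 / (1 - q)) = 1 / (a * (1 - q))" by simp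
    ultimately have "1 / a * (1 / (1 - q)) = 2 / (1 - \<delta>)" by (simp only:) simp
    then have "(A' * (K * cmod z)) * (1 / a * (1 / (1 - q))) * D * cmod (Z n z) =
       (A' * (K * cmod z)) * (2 / (1 - \<delta>)) * D * cmod (Z n z)" by simp
    then show ?thesis by (simp add: mult_ac)
  qed
  also have "\<dots> \<le> ((1 - \<delta>) / 4) * (2 / (1 - \<delta>)) * D * cmod (Z n z)"
    using \<epsilon> \<delta> D by (intro mult_right_mono) auto
  also have "((1 - \<delta>) / 4) * (2 / (1 - \<delta>)) = 1 / 2" using \<delta> by (simp add: divide_simps)
  also have "1 / 2 * D * cmod (Z n z) = D / 2 * cmod (Z n z)" by simp
  finally have v: "N n (\<lambda>x. v n x - v 0 x) \<le> D / 2 * cmod (Z n z)" .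
  have "twisted_iter z n = (\<lambda>x. (v n x - v 0 x) + v 0 x + Z n z * complex_of_real (h n x))"
    by (simp add: v_def)
  then have "N n (twisted_iter z n) \<le> N n (\<lambda>x. (v n x - v 0 x) + v 0 x) + N n (\<lambda>x. Z n z * complex_of_real (h n x))"
    using BN.N_add_le[of "\<lambda>x. (v n x - v 0 x) + v 0 x" n "\<lambda>x. Z n z * complex_of_real (h n x)"]
    by (simp, metis v_mem BN.scale_mem h_mem order_refl)
  also have "N n (\<lambda>x. (v n x - v 0 x) + v 0 x) \<le> N n (\<lambda>x. v n x - v 0 x) + N n (v 0)"
    by (intro BN.N_add_le BN.diff_mem v_mem) auto
  also have "N n (\<lambda>x. Z n z * complex_of_real (h n x)) \<le> cmod (Z n z) * H"
    by (simp add: BN.N_scale h_mem mult_left_mono H)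
  finally have "N n (twisted_iter z n) \<le> D / 2 * cmod (Z n z) + A' * N1 * cmod (Z n z) + cmod (Z n z) * H"
    using v v0 by linarith
  also have "\<dots> = D * cmod (Z n z)" by (simp add: D_def N1_def[symmetric] algebra_simps)
  finally show ?case using ratio[of 0] by (simp add: a_def)
qed

lemma Z_has_field_derivative:
  "(Z n has_field_derivative (\<integral>x. of_real (S n x) * exp (z * of_real (S n x)) \<partial>M 0)) (at z)"
proof -
  have "((\<lambda>z. \<integral>x. 1 * exp (z * of_real (S n x)) \<partial>M 0) has_field_derivative
      (\<integral>x. 1 * of_real (S n x) * exp (z * of_real (S n x)) \<partial>M 0)) (at z)"
    by (rule M.mgf_has_field_derivative[OF S_measurable S_le, where c = 1]) auto
  moreover have "Z n = (\<lambda>z. \<integral>x. 1 * exp (z * of_real (S n x)) \<partial>M 0)" by (simp add: Z_def fun_eq_iff)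
  ultimately show ?thesis by simp
qed

lemma Z_holomorphic: "Z n holomorphic_on X"
proof -
  have "Z n holomorphic_on UNIV"
    unfolding holomorphic_on_open[OF open_UNIV] using Z_has_field_derivative by blast
  then show ?thesis by (rule holomorphic_on_subset) simp
qed

text \<open>The logarithm is a sum of principal logarithms of consecutive ratios, since
  \<open>Z n z\<close> itself may cross the branch cut. Each ratio lies within 1/2 of 1, where
  \<open>Ln\<close> is holomorphic and at most 1 in modulus; this is where the linear bound in
  \<open>n\<close> comes from.\<close>

lemma log_Z:
  obtains r l where "0 < r" "\<And>n. l n holomorphic_on ball 0 r" "\<And>n. l n 0 = 0"
    "\<And>n z. z \<in> ball 0 r \<Longrightarrow> exp (l n z) = Z n z" "\<And>n z. z \<in> ball 0 r \<Longrightarrow> cmod (l n z) \<le> real n"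
proof -
  define \<theta> where "\<theta> = (\<lambda>x. A' * (K * x))"
  define \<theta>' where "\<theta>' = (\<lambda>x. x * b * exp (x * b) * (C * D))"
  have "isCont \<theta> 0" "isCont \<theta>' 0" unfolding \<theta>_def \<theta>'_def by (intro continuous_intros)+
  then have "(\<theta> \<longlongrightarrow> 0) (at 0)" "(\<theta>' \<longlongrightarrow> 0) (at 0)"
    by (auto simp: isCont_def \<theta>_def \<theta>'_def)
  then have "\<forall>\<^sub>F x in at 0. \<theta> x < (1 - \<delta>) / 4 \<and> \<theta>' x < (1 - \<delta>) / 2"
    using \<delta> by (intro eventually_conj order_tendstoD(2)) auto
  then obtain d where d: "0 < d"
      "\<And>x. x \<noteq> 0 \<Longrightarrow> dist x 0 < d \<Longrightarrow> \<theta> x < (1 - \<delta>) / 4 \<and> \<theta>' x < (1 - \<delta>) / 2"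
    unfolding eventually_at by auto
  \<comment> \<open>Halving puts \<open>r\<close> strictly below both \<open>d\<close> and
    \<open>r\<^sub>0\<close>. Both smallness conditions are monotone in \<open>cmod z\<close>, so
    they need checking only at \<open>r\<close>.\<close>
  define r where "r = min (d / 2) (r\<^sub>0 / 2)"
  have r: "0 < r" "\<theta> r < (1 - \<delta>) / 4" "\<theta>' r < (1 - \<delta>) / 2" "r < r\<^sub>0"
    using d(1) d(2)[of r] r\<^sub>0 by (auto simp: r_def min_def split: if_splits)
  have D: "0 \<le> D" using H_nonneg A'_ge_1 BN.N_nonneg[OF one_mem] unfolding D_def by simp
  have small: "cmod z \<le> r\<^sub>0" "A' * (K * cmod z) \<le> (1 - \<delta>) / 4"
      "cmod z * b * exp (cmod z * b) * (C * D) \<le> (1 - \<delta>) / 2" if "z \<in> ball 0 r" for z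
  proof -
    have z: "cmod z \<le> r" using that by simp
    show "cmod z \<le> r\<^sub>0" using z r by simp
    have "A' * (K * cmod z) \<le> \<theta> r" unfolding \<theta>_def using z A'_ge_1 K by (intro mult_left_mono) auto
    then show "A' * (K * cmod z) \<le> (1 - \<delta>) / 4" using r by simp
    have "cmod z * b * exp (cmod z * b) * (C * D) \<le> \<theta>' r"
      unfolding \<theta>'_def using z C(1) D b r(1) by (intro mult_right_mono mult_mono) (auto intro: mult_right_mono)
    then show "cmod z * b * exp (cmod z * b) * (C * D) \<le> (1 - \<delta>) / 2" using r by simp
  qed
  have nz: "Z n z \<noteq> 0" if "z \<in> ball 0 r" for n z
  proof -
    have "0 < ((1 + \<delta>) / 2) ^ n" using \<delta> by simp
    then show ?thesis using twisted_iter_le[OF small[OF that], of n] by auto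
  qed
  have ratio: "cmod (Z (Suc n) z / Z n z - 1) < 1 / 2" if z: "z \<in> ball 0 r" for n z
  proof -
    have "cmod (Z (Suc n) z - Z n z) \<le> cmod z * b * exp (cmod z * b) * (C * N n (twisted_iter z n))"
      by (rule Z_Suc_diff_le[OF small(1)[OF z]])
    also have "\<dots> \<le> cmod z * b * exp (cmod z * b) * (C * (D * cmod (Z n z)))"
      using twisted_iter_le[OF small[OF z], of n] b C(1) by (intro mult_left_mono) auto
    also have "\<dots> = (cmod z * b * exp (cmod z * b) * (C * D)) * cmod (Z n z)" by simp
    also have "\<dots> \<le> ((1 - \<delta>) / 2) * cmod (Z n z)" using small[OF z] by (intro mult_right_mono) auto
    also have "\<dots> < 1 / 2 * cmod (Z n z)" using \<delta> nz[OF z] by (intro mult_strict_right_mono) auto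
    finally have "cmod (Z (Suc n) z - Z n z) / cmod (Z n z) < 1 / 2" using nz[OF z] by (simp add: divide_less_eq)
    moreover have "Z (Suc n) z / Z n z - 1 = (Z (Suc n) z - Z n z) / Z n z" using nz[OF z] by (simp add: divide_simps)
    ultimately show ?thesis by (simp add: norm_divide)
  qed
  define l where "l = (\<lambda>n z. \<Sum>j<n. Ln (Z (Suc j) z / Z j z))"
  have Re: "Re (Z (Suc n) z / Z n z) > 0" if "z \<in> ball 0 r" for n z
  proof -
    have "\<bar>Re (Z (Suc n) z / Z n z - 1)\<bar> \<le> 1 / 2"
      using order.trans[OF abs_Re_le_cmod less_imp_le[OF ratio[OF that]]] .
    then show ?thesis unfolding minus_complex.sel one_complex.sel by linarith
  qed
  show ?thesis
  proof (rule that[of r l])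
    show "0 < r" by (rule r)
    show "l n 0 = 0" for n by (simp add: l_def Z_def M.prob_space)
    show "l n holomorphic_on ball 0 r" for n
      unfolding l_def
    proof (intro holomorphic_intros Z_holomorphic)
      show "Z (Suc j) z / Z j z \<notin> \<real>\<^sub>\<le>\<^sub>0" if "z \<in> ball 0 r" for j z
        using Re[OF that, of j] by (auto simp: complex_nonpos_Reals_iff)
    qed (use nz in auto)
    show "exp (l n z) = Z n z" if "z \<in> ball 0 r" for n z
      by (induction n) (use nz[OF that] Re[OF that] in \<open>auto simp: l_def exp_add exp_Ln\<close>)
    show "cmod (l n z) \<le> real n" if "z \<in> ball 0 r" for n z
    proof -
      have "cmod (Ln (Z (Suc j) z / Z j z)) \<le> 1" for j
        using norm_Ln_le[of "Z (Suc j) z / Z j z - 1"] ratio[OF that, of j] by simp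
      then have "cmod (l n z) \<le> (\<Sum>j<n. 1)" unfolding l_def by (intro sum_norm_le)
      then show ?thesis by simp
    qed
  qed
qed

end

section \<open>The logarithm of the moment generating function\<close>

text \<open>What is retained of the dynamics: bounded variables whose moment generating functions
  have holomorphic logarithms on a common disc, of at most linear size in \<open>n\<close>, with
  \<open>n\<close> bounded by a multiple of the second moment whenever that moment is
  positive.\<close>

locale bounded_sums = prob_space +
  fixes S :: "nat \<Rightarrow> 'a \<Rightarrow> real" and bd :: "nat \<Rightarrow> real" and l :: "nat \<Rightarrow> complex \<Rightarrow> complex" and r c :: real
  assumes S_meas [measurable]: "\<And>n. S n \<in> borel_measurable M"
    and S_bound: "\<And>n x. x \<in> space M \<Longrightarrow> \<bar>S n x\<bar> \<le> bd n"
    and r: "0 < r" and l_holo: "\<And>n. l n holomorphic_on ball 0 r"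
    and l_0: "\<And>n. l n 0 = 0"
    and exp_l: "\<And>n z. z \<in> ball 0 r \<Longrightarrow> exp (l n z) = (\<integral>x. exp (z * of_real (S n x)) \<partial>M)"
    and l_le: "\<And>n z. z \<in> ball 0 r \<Longrightarrow> cmod (l n z) \<le> real n"
    and c: "0 \<le> c" "\<And>n. 0 < rv_L2_norm M (S n) \<Longrightarrow> real n \<le> c * (rv_L2_norm M (S n))\<^sup>2"
begin

abbreviation \<sigma> :: "nat \<Rightarrow> real" where "\<sigma> n \<equiv> rv_L2_norm M (S n)"

lemma char_normalised:
  "char (distr M borel (\<lambda>x. S n x / s)) t = (\<integral>x. exp (\<i> * of_real t / of_real s * of_real (S n x)) \<partial>M)"
  unfolding char_def by (subst integral_distr) (auto simp: mult_ac)

lemma l_derivative: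
  "w \<in> ball 0 r \<Longrightarrow> ((deriv ^^ k) (l n) has_field_derivative (deriv ^^ Suc k) (l n) w) (at w)"
  using holomorphic_derivI[OF holomorphic_higher_deriv[OF l_holo open_ball]] by simp

text \<open>A disc of radius \<open>r / 4\<close> about such a \<open>w\<close> stays inside the
  disc where \<open>cmod (l n z) \<le> n\<close>, so Cauchy's inequality applies.\<close>

lemma l_higher_deriv_le:
  assumes "cmod w \<le> r / 2"
  shows "cmod ((deriv ^^ k) (l n) w) \<le> fact k * real n * (4 / r) ^ k"
proof -
  have sub: "cball w (r / 4) \<subseteq> ball 0 r"
  proof
    fix z assume "z \<in> cball w (r / 4)"
    then have "cmod (z - w) \<le> r / 4" by (simp add: dist_norm norm_minus_commute)
    then show "z \<in> ball 0 r" using norm_triangle_ineq[of "z - w" w] assms r by simp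
  qed
  have "cmod ((deriv ^^ k) (l n) w) \<le> fact k * real n / (r / 4) ^ k"
  proof (rule Cauchy_inequality)
    show "l n holomorphic_on ball w (r / 4)"
      using sub ball_subset_cball by (intro holomorphic_on_subset[OF l_holo]) blast
    show "continuous_on (cball w (r / 4)) (l n)"
      by (intro holomorphic_on_imp_continuous_on holomorphic_on_subset[OF l_holo] sub)
    show "cmod (l n x) \<le> real n" if "cmod (w - x) = r / 4" for x
      using that sub by (intro l_le) (auto simp: dist_norm subset_iff)
  qed (use r in auto)
  then show ?thesis by (simp add: power_divide)
qed

text \<open>Each derivative of \<open>l n (\<i> * t / s)\<close> in \<open>t\<close> brings a factor
  \<open>1 / s\<close>, while the derivatives of \<open>l n\<close> are of size \<open>n\<close>,
  hence at most a multiple of \<open>s ^ 2\<close>. One width \<open>\<epsilon> = r / 2\<close>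
  serves all orders.\<close>

lemma growth_condition: "growth_condition M S m"
  unfolding growth_condition_def
proof (intro allI impI)
  fix j :: nat assume j: "3 \<le> j \<and> j \<le> m + 1"
  \<comment> \<open>The summand 1 keeps \<open>C\<close> positive when \<open>c = 0\<close>.\<close>
  define C where "C = fact j * c * (4 / r) ^ j + 1"
  show "\<exists>C>0. \<exists>\<epsilon>>0. \<forall>n. \<sigma> n > 0 \<longrightarrow>
           (let \<sigma> = \<sigma> n; I = {- (\<epsilon> * \<sigma>)..\<epsilon> * \<sigma>} in
            \<exists>l G. continuous_on I l \<and> l 0 = 0 \<and>
              (\<forall>t\<in>I. exp (l t) = char (distr M borel (\<lambda>x. S n x / \<sigma>)) t) \<and>
              has_nth_derivative_on (\<lambda>t. l t + complex_of_real (t\<^sup>2 / 2)) j G I \<and>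
              (\<forall>t\<in>I. cmod (G t) \<le> C / \<sigma> ^ (j - 2)))"
    unfolding Let_def
  proof (rule exI[of _ C], rule conjI, goal_cases)
    case 1
    show "0 < C" using c r by (simp add: C_def add_nonneg_pos)
  next
    case 2
    show ?case
    proof (rule exI[of _ "r / 2"], intro conjI allI impI)
      show "0 < r / 2" using r by simp
      fix n assume pos: "\<sigma> n > 0"
      define s where "s = \<sigma> n"
      have s: "s > 0" using pos by (simp add: s_def)
      define I where "I = {- (r / 2 * s)..r / 2 * s}"
      define w where "w = (\<lambda>t. \<i> * of_real t / of_real s :: complex)"
      have w: "cmod (w t) \<le> r / 2" "w t \<in> ball 0 r" if "t \<in> I" for t
      proof -
        have "\<bar>t\<bar> \<le> r / 2 * s" using that by (auto simp: I_def)
        then show "cmod (w t) \<le> r / 2" using s by (simp add: w_def norm_mult norm_divide field_simps)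
        then show "w t \<in> ball 0 r" using r by simp
      qed
      \<comment> \<open>\<open>p k\<close> is the \<open>k\<close>-th derivative of
        \<open>t ^ 2 / 2\<close>, which is zero for the orders \<open>j \<ge> 3\<close> of the
        condition.\<close>
      define p where "p = (\<lambda>(k::nat) t. if k = 0 then t\<^sup>2 / 2 else if k = 1 then t else if k = 2 then 1 else (0::real))"
      define D where "D = (\<lambda>k t. (\<i> / of_real s) ^ k * (deriv ^^ k) (l n) (w t) + complex_of_real (p k t))"
      have p': "(p k has_field_derivative p (Suc k) t) (at t within I)" for k t
      proof -
        have "(p k has_field_derivative p (Suc k) t) (at t)"
        proof -
          have "k = 0 \<or> k = 1 \<or> k \<ge> 2" by auto
          then show ?thesis unfolding p_def by (elim disjE) (auto intro!: derivative_eq_intros)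
        qed
        then show ?thesis
          by (rule has_field_derivative_at_within)
      qed
      have D': "(D k has_vector_derivative D (Suc k) t) (at t within I)" if t: "t \<in> I" for k t
      proof -
        have "(w has_vector_derivative \<i> / of_real s) (at t within I)"
          unfolding w_def using s by (auto intro!: derivative_eq_intros has_vector_derivative_mult_left simp: has_vector_derivative_def scaleR_conv_of_real)
        moreover have "((deriv ^^ k) (l n) has_field_derivative (deriv ^^ Suc k) (l n) (w t)) (at (w t) within w ` I)"
          by (rule has_field_derivative_at_within[OF l_derivative[OF w(2)[OF t]]])
        ultimately have "((deriv ^^ k) (l n) \<circ> w has_vector_derivative (\<i> / of_real s) * (deriv ^^ Suc k) (l n) (w t)) (at t within I)"
          by (rule field_vector_diff_chain_within)
        then have "((\<lambda>t. (\<i> / of_real s) ^ k * ((deriv ^^ k) (l n) \<circ> w) t) has_vector_derivative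
            (\<i> / of_real s) ^ k * ((\<i> / of_real s) * (deriv ^^ Suc k) (l n) (w t))) (at t within I)"
          by (rule has_vector_derivative_mult_right)
        moreover have "((\<lambda>t. complex_of_real (p k t)) has_vector_derivative of_real (p (Suc k) t)) (at t within I)"
          by (intro has_vector_derivative_of_real p')
        ultimately have *: "((\<lambda>t. (\<i> / of_real s) ^ k * ((deriv ^^ k) (l n) \<circ> w) t + complex_of_real (p k t)) has_vector_derivative
            (\<i> / of_real s) ^ k * ((\<i> / of_real s) * (deriv ^^ Suc k) (l n) (w t)) + of_real (p (Suc k) t)) (at t within I)"
          by (rule has_vector_derivative_add)
        have "D (Suc k) t = (\<i> / of_real s) ^ k * ((\<i> / of_real s) * (deriv ^^ Suc k) (l n) (w t)) + of_real (p (Suc k) t)"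
          by (simp only: D_def power_Suc mult_ac)
        moreover have "D k = (\<lambda>t. (\<i> / of_real s) ^ k * ((deriv ^^ k) (l n) \<circ> w) t + complex_of_real (p k t))"
          by (simp only: D_def comp_def)
        ultimately show ?thesis using * by (simp only:)
      qed
      have "continuous_on I (\<lambda>t. l n (w t))"
        unfolding w_def using w(2) s
        by (intro continuous_on_compose2[OF holomorphic_on_imp_continuous_on[OF l_holo]] continuous_intros)
           (auto simp: w_def)
      moreover have "exp (l n (w t)) = char (distr M borel (\<lambda>x. S n x / s)) t" if "t \<in> I" for t
        using exp_l[OF w(2)[OF that]] by (simp add: char_normalised w_def)
      moreover have "has_nth_derivative_on (\<lambda>t. l n (w t) + complex_of_real (t\<^sup>2 / 2)) j (D j) I"
        unfolding has_nth_derivative_on_def by (rule exI[of _ D]) (use D' in \<open>auto simp: D_def p_def\<close>)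
      moreover have "cmod (D j t) \<le> C / s ^ (j - 2)" if t: "t \<in> I" for t
      proof -
        have "cmod (D j t) = cmod ((deriv ^^ j) (l n) (w t)) / s ^ j"
          using j s by (simp add: D_def p_def norm_mult norm_power norm_divide power_divide)
        also have "\<dots> \<le> (fact j * (c * s\<^sup>2) * (4 / r) ^ j) / s ^ j"
        proof (intro divide_right_mono order.trans[OF l_higher_deriv_le[OF w(1)[OF t]]] mult_right_mono mult_left_mono)
          show "real n \<le> c * s\<^sup>2" using c(2)[OF pos] by (simp add: s_def)
        qed (use s r in auto)
        also have "\<dots> = (C - 1) * (s\<^sup>2 / s ^ j)" by (simp add: C_def)
        also have "s\<^sup>2 / s ^ j = 1 / s ^ (j - 2)"
        proof -
          have "j = 2 + (j - 2)" using j by arith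
          then have "s ^ j = s\<^sup>2 * s ^ (j - 2)" by (metis power_add)
          then show ?thesis using s by simp
        qed
        also have "(C - 1) * (1 / s ^ (j - 2)) \<le> C / s ^ (j - 2)" using s by (simp add: divide_right_mono)
        finally show ?thesis .
      qed
      ultimately show "\<exists>l G. continuous_on {- (r / 2 * \<sigma> n)..r / 2 * \<sigma> n} l \<and> l 0 = 0 \<and>
          (\<forall>t\<in>{- (r / 2 * \<sigma> n)..r / 2 * \<sigma> n}. exp (l t) = char (distr M borel (\<lambda>x. S n x / \<sigma> n)) t) \<and>
          has_nth_derivative_on (\<lambda>t. l t + complex_of_real (t\<^sup>2 / 2)) j G {- (r / 2 * \<sigma> n)..r / 2 * \<sigma> n} \<and>
          (\<forall>t\<in>{- (r / 2 * \<sigma> n)..r / 2 * \<sigma> n}. cmod (G t) \<le> C / \<sigma> n ^ (j - 2))"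
        unfolding s_def[symmetric] I_def[symmetric]
        by (intro exI[of _ "\<lambda>t. l n (w t)"] exI[of _ "D j"]) (auto simp: w_def l_0)
    qed
  qed
qed

section \<open>The first two cumulants and the third-order remainder\<close>

lemma l_deriv_0:
  "deriv (l n) 0 = of_real (\<integral>x. S n x \<partial>M)"
  "(deriv ^^ 2) (l n) 0 = of_real ((\<sigma> n)\<^sup>2 - (\<integral>x. S n x \<partial>M)\<^sup>2)"
proof -
  define Z0 where "Z0 = (\<lambda>z::complex. \<integral>x. exp (z * of_real (S n x)) \<partial>M)"
  define Z1 where "Z1 = (\<lambda>z::complex. \<integral>x. of_real (S n x) * exp (z * of_real (S n x)) \<partial>M)"
  define Z2 where "Z2 = (\<lambda>z::complex. \<integral>x. of_real (S n x) * of_real (S n x) * exp (z * of_real (S n x)) \<partial>M)"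
  have Z0: "(Z0 has_field_derivative Z1 z) (at z)" for z
    using mgf_has_field_derivative[OF S_meas[of n] S_bound, where u = "\<lambda>_. 1" and c = 1 and z = z]
    by (simp add: Z0_def Z1_def)
  have Z1: "(Z1 has_field_derivative Z2 z) (at z)" for z
    unfolding Z1_def Z2_def
    by (rule mgf_has_field_derivative[OF S_meas S_bound, where c = "bd n"]) (auto intro: S_bound)
  have in_ball: "0 \<in> ball (0::complex) r" using r by simp
  \<comment> \<open>Differentiating \<open>exp (l n z) = Z0 z\<close> once; differentiating this
    product again gives the second cumulant. As \<open>\<sigma> n\<close> is an L2 norm and not a
    standard deviation, the squared mean has to be subtracted.\<close>
  have eq1: "Z0 z * deriv (l n) z = Z1 z" if z: "z \<in> ball 0 r" for z
  proof -
    have "((\<lambda>z. exp (l n z)) has_field_derivative exp (l n z) * deriv (l n) z) (at z)"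
      using l_derivative[OF z, of 0] by (auto intro!: derivative_eq_intros)
    then have "(Z0 has_field_derivative exp (l n z) * deriv (l n) z) (at z)"
      by (rule has_field_derivative_transform_within_open[OF _ open_ball z]) (simp add: exp_l Z0_def)
    then show ?thesis using DERIV_unique[OF Z0] exp_l[OF z] by (simp add: Z0_def)
  qed
  have "((\<lambda>z. Z0 z * deriv (l n) z) has_field_derivative Z1 0 * deriv (l n) 0 + (deriv ^^ 2) (l n) 0 * Z0 0) (at 0)"
    using l_derivative[OF in_ball, of 1 n] by (intro DERIV_mult Z0) (simp add: numeral_2_eq_2)
  then have "(Z1 has_field_derivative Z1 0 * deriv (l n) 0 + (deriv ^^ 2) (l n) 0 * Z0 0) (at 0)"
    by (rule has_field_derivative_transform_within_open[OF _ open_ball in_ball]) (simp add: eq1)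
  then have eq2: "Z1 0 * deriv (l n) 0 + (deriv ^^ 2) (l n) 0 * Z0 0 = Z2 0"
    by (rule DERIV_unique[OF _ Z1])
  have [simp]: "Z0 0 = 1" "Z1 0 = of_real (\<integral>x. S n x \<partial>M)" by (simp_all add: Z0_def Z1_def prob_space)
  show 1: "deriv (l n) 0 = of_real (\<integral>x. S n x \<partial>M)" using eq1[OF in_ball] by simp
  have "Z2 0 = (\<integral>x. of_real ((S n x)\<^sup>2) \<partial>M)" by (simp add: Z2_def power2_eq_square)
  also have "\<dots> = of_real (\<integral>x. (S n x)\<^sup>2 \<partial>M)" by (rule integral_complex_of_real)
  also have "(\<integral>x. (S n x)\<^sup>2 \<partial>M) = (\<sigma> n)\<^sup>2" by (simp add: rv_L2_norm_def)
  finally show "(deriv ^^ 2) (l n) 0 = of_real ((\<sigma> n)\<^sup>2 - (\<integral>x. S n x \<partial>M)\<^sup>2)"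
    using eq2 by (simp add: 1 power2_eq_square eq_diff_eq add.commute)
qed

text \<open>Normalising by the L2 norm without centring leaves two corrections to
  \<open>- w ^ 2 / 2\<close>: a linear term of size \<open>\<mu> * cmod w / s\<close> and a
  quadratic one of size \<open>\<mu> ^ 2 * cmod w ^ 2 / (2 * s ^ 2)\<close>. The cubic Taylor
  remainder is of order \<open>n / s ^ 3\<close>, so all three are of order
  \<open>1 / s\<close>.\<close>

lemma log_char_expansion:
  assumes mean: "\<And>n. \<bar>\<integral>x. S n x \<partial>M\<bar> \<le> \<mu>"
  shows "\<exists>C\<ge>0. \<forall>n w. 1 \<le> \<sigma> n \<longrightarrow> cmod w \<le> r / 2 * \<sigma> n \<longrightarrow>
    cmod (l n (\<i> * w / of_real (\<sigma> n)) + w\<^sup>2 / 2) \<le> C * (1 + cmod w) ^ 3 / \<sigma> n"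
proof -
  \<comment> \<open>The factor 3 is \<open>fact 3 / fact 2\<close>: Cauchy's bound on the third
    derivative over the factorial that \<open>complex_Taylor\<close> puts below the
    remainder.\<close>
  define C1 where "C1 = 3 * c * (4 / r) ^ 3"
  have \<mu>: "0 \<le> \<mu>" using mean[of 0] by simp
  have C1: "0 \<le> C1" using c r by (simp add: C1_def)
  have "cmod (l n (\<i> * w / of_real (\<sigma> n)) + w\<^sup>2 / 2) \<le> (\<mu> + \<mu>\<^sup>2 + C1) * (1 + cmod w) ^ 3 / \<sigma> n"
    if s1: "1 \<le> \<sigma> n" and w: "cmod w \<le> r / 2 * \<sigma> n" for n w
  proof -
    define s where "s = \<sigma> n"
    define m where "m = (\<integral>x. S n x \<partial>M)"
    define z where "z = \<i> * w / of_real s"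
    have s: "1 \<le> s" using s1 by (simp add: s_def)
    have z: "cmod z = cmod w / s" "cmod z \<le> r / 2"
      using s w by (simp_all add: z_def norm_mult norm_divide s_def[symmetric] field_simps)
    have ns: "real n \<le> c * s\<^sup>2" using c(2)[of n] s by (simp add: s_def)
    have "cmod ((deriv ^^ 0) (l n) z - (\<Sum>i\<le>2. (deriv ^^ i) (l n) 0 * (z - 0) ^ i / fact i))
        \<le> (fact (Suc 2) * real n * (4 / r) ^ Suc 2) * cmod (z - 0) ^ Suc 2 / fact 2"
    proof (rule complex_Taylor[where S = "cball 0 (r / 2)"])
      show "((deriv ^^ i) (l n) has_field_derivative (deriv ^^ Suc i) (l n) x) (at x within cball 0 (r / 2))"
        if "x \<in> cball 0 (r / 2)" for i x
        by (rule has_field_derivative_at_within[OF l_derivative]) (use that r in auto)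
      show "cmod ((deriv ^^ Suc 2) (l n) x) \<le> fact (Suc 2) * real n * (4 / r) ^ Suc 2"
        if "x \<in> cball 0 (r / 2)" for x
        using that by (intro l_higher_deriv_le) auto
    qed (use r z in auto)
    moreover have "(\<Sum>i\<le>2. (deriv ^^ i) (l n) 0 * (z - 0) ^ i / fact i) = of_real m * z + of_real (s\<^sup>2 - m\<^sup>2) * z\<^sup>2 / 2"
      using l_deriv_0[of n] by (simp add: atMost_Suc numeral_2_eq_2 l_0 m_def s_def)
    moreover have "of_real (s\<^sup>2 - m\<^sup>2) * z\<^sup>2 / 2 = - w\<^sup>2 / 2 + of_real (m\<^sup>2) * w\<^sup>2 / (2 * of_real (s\<^sup>2))"
      using s by (simp add: z_def power_divide power_mult_distrib field_simps)
    moreover have "(fact (Suc 2) * real n * (4 / r) ^ Suc 2) * cmod (z - 0) ^ Suc 2 / fact 2 = 3 * real n * (4 / r) ^ 3 * (cmod w / s) ^ 3"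
      using z by (simp add: fact_numeral numeral_3_eq_3)
    moreover have "(deriv ^^ 0) (l n) z = l n z" by simp
    ultimately have T: "cmod (l n z - (of_real m * z + (- w\<^sup>2 / 2 + of_real (m\<^sup>2) * w\<^sup>2 / (2 * of_real (s\<^sup>2)))))
        \<le> 3 * real n * (4 / r) ^ 3 * (cmod w / s) ^ 3" by (simp only:)
    define x where "x = cmod w"
    have x: "0 \<le> x" by (simp add: x_def)
    have pw: "x \<le> (1 + x) ^ 3" "x\<^sup>2 \<le> (1 + x) ^ 3" "x ^ 3 \<le> (1 + x) ^ 3"
      using x by (auto simp: power2_eq_square power3_eq_cube algebra_simps intro: power_mono)
    have m: "\<bar>m\<bar> \<le> \<mu>" using mean by (simp add: m_def)
    have m2: "m\<^sup>2 \<le> \<mu>\<^sup>2" using m by (metis abs_le_square_iff abs_of_nonneg \<mu>)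
    have "cmod (l n z + w\<^sup>2 / 2) \<le> 3 * real n * (4 / r) ^ 3 * (x / s) ^ 3 + cmod (of_real m * z) + cmod (of_real (m\<^sup>2) * w\<^sup>2 / (2 * of_real (s\<^sup>2)))"
    proof -
      have "l n z + w\<^sup>2 / 2 = (l n z - (of_real m * z + (- w\<^sup>2 / 2 + of_real (m\<^sup>2) * w\<^sup>2 / (2 * of_real (s\<^sup>2)))))
          + of_real m * z + of_real (m\<^sup>2) * w\<^sup>2 / (2 * of_real (s\<^sup>2))" by simp
      then show ?thesis using T unfolding x_def by (smt (verit) norm_triangle_ineq)
    qed
    also have "3 * real n * (4 / r) ^ 3 * (x / s) ^ 3 \<le> 3 * (c * s\<^sup>2) * (4 / r) ^ 3 * (x / s) ^ 3"
      using ns r x s by (intro mult_right_mono mult_left_mono) auto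
    also have "\<dots> = C1 * x ^ 3 / s" using s by (simp add: C1_def power_divide power2_eq_square power3_eq_cube)
    also have "\<dots> \<le> C1 * (1 + x) ^ 3 / s" using C1 pw s by (intro divide_right_mono mult_left_mono) auto
    also have "cmod (of_real m * z) = \<bar>m\<bar> * x / s" using z by (simp add: norm_mult x_def)
    also have "\<dots> \<le> \<mu> * (1 + x) ^ 3 / s" using m pw x s \<mu> by (intro divide_right_mono mult_mono) auto
    also have "cmod (of_real (m\<^sup>2) * w\<^sup>2 / (2 * of_real (s\<^sup>2))) = m\<^sup>2 * x\<^sup>2 / (2 * s\<^sup>2)"
      by (simp add: norm_mult norm_divide norm_power x_def)
    also have "\<dots> \<le> \<mu>\<^sup>2 * (1 + x) ^ 3 / s"
    proof (intro frac_le mult_mono m2 pw)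
      have "s * 1 \<le> s * s" using s by (intro mult_left_mono) auto
      then show "s \<le> 2 * s\<^sup>2" using s by (simp add: power2_eq_square)
    qed (use x s in auto)
    finally have "cmod (l n z + w\<^sup>2 / 2) \<le> C1 * (1 + x) ^ 3 / s + \<mu> * (1 + x) ^ 3 / s + \<mu>\<^sup>2 * (1 + x) ^ 3 / s" by simp
    also have "\<dots> = (\<mu> + \<mu>\<^sup>2 + C1) * (1 + x) ^ 3 / s" by (simp add: add_divide_distrib algebra_simps)
    finally show ?thesis by (simp add: z_def x_def s_def)
  qed
  then show ?thesis using \<mu> C1 by (intro exI[of _ "\<mu> + \<mu>\<^sup>2 + C1"]) auto
qed

end

section \<open>Oscillatory integrals\<close>

text \<open>Each differentiation uses up one power of \<open>w - a\<close>, and the cofactor stays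
  holomorphic, so the induction can continue.\<close>

lemma higher_deriv_zero_factor:
  assumes "open S" "H holomorphic_on S" "j \<le> k"
  shows "\<exists>H'. H' holomorphic_on S \<and>
    (\<forall>w\<in>S. (deriv ^^ j) (\<lambda>w. (w - a) ^ k * H w) w = (w - a) ^ (k - j) * H' w)"
  using assms(3)
proof (induction j)
  case 0
  show ?case using assms by auto
next
  case (Suc j)
  then obtain H' where H': "H' holomorphic_on S"
    "\<And>w. w \<in> S \<Longrightarrow> (deriv ^^ j) (\<lambda>w. (w - a) ^ k * H w) w = (w - a) ^ (k - j) * H' w" by auto
  define H'' where "H'' = (\<lambda>w. of_nat (k - j) * H' w + (w - a) * deriv H' w)"
  have kj: "k - j = Suc (k - Suc j)" using Suc.prems by simp
  have "H'' holomorphic_on S"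
    unfolding H''_def using assms(1) H'(1) by (intro holomorphic_intros holomorphic_deriv) auto
  moreover have "(deriv ^^ Suc j) (\<lambda>w. (w - a) ^ k * H w) w = (w - a) ^ (k - Suc j) * H'' w" if w: "w \<in> S" for w
  proof -
    have d: "(H' has_field_derivative deriv H' w) (at w)"
      by (rule holomorphic_derivI[OF H'(1) assms(1) w])
    have "((\<lambda>w. (w - a) ^ (k - j) * H' w) has_field_derivative (w - a) ^ (k - Suc j) * H'' w) (at w)"
      by (rule derivative_eq_intros d refl)+ (simp add: kj H''_def algebra_simps)
    then have "((deriv ^^ j) (\<lambda>w. (w - a) ^ k * H w) has_field_derivative (w - a) ^ (k - Suc j) * H'' w) (at w)"
      by (rule has_field_derivative_transform_within_open[OF _ assms(1) w]) (simp add: H'(2))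
    then show ?thesis by (simp add: DERIV_imp_deriv)
  qed
  ultimately show ?case by blast
qed

lemma higher_deriv_at_zero:
  assumes "open S" "H holomorphic_on S" "j < k" "a \<in> S" "\<And>w. w \<in> S \<Longrightarrow> G w = (w - a) ^ k * H w"
  shows "(deriv ^^ j) G a = 0"
proof -
  obtain H' where "\<forall>w\<in>S. (deriv ^^ j) (\<lambda>w. (w - a) ^ k * H w) w = (w - a) ^ (k - j) * H' w"
    using higher_deriv_zero_factor[OF assms(1,2), of j k a] assms(3) by auto
  moreover have "(deriv ^^ j) G a = (deriv ^^ j) (\<lambda>w. (w - a) ^ k * H w) a"
    using assms by (intro higher_deriv_cong_ev eventually_nhds_in_open[THEN eventually_mono]) auto
  ultimately show ?thesis using assms(3,4) by simp
qed

lemma integral_by_parts_oscillatory: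
  fixes \<xi> :: real
  assumes S: "open S" "G holomorphic_on S" "\<And>s. s \<in> {-1..1} \<Longrightarrow> complex_of_real s \<in> S"
    and zero: "G 1 = 0" "G (-1) = 0"
  shows "\<i> * \<xi> * integral {-1..1} (\<lambda>s. G (of_real s) * exp (\<i> * \<xi> * of_real s)) =
     - integral {-1..1} (\<lambda>s. deriv G (of_real s) * exp (\<i> * \<xi> * of_real s))"
proof -
  let ?e = "\<lambda>s::real. exp (\<i> * \<xi> * of_real s)"
  have G': "deriv G holomorphic_on S" by (rule holomorphic_deriv[OF S(2,1)])
  have cont: "continuous_on {-1..1} (\<lambda>s. G (of_real s))" "continuous_on {-1..1} (\<lambda>s. deriv G (of_real s))"
    using S(3) by (auto intro!: continuous_on_compose2[OF holomorphic_on_imp_continuous_on[OF S(2)]]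
      continuous_on_compose2[OF holomorphic_on_imp_continuous_on[OF G']] continuous_intros)
  have d: "((\<lambda>s. G (of_real s) * ?e s) has_vector_derivative
      G (of_real s) * (\<i> * \<xi> * ?e s) + deriv G (of_real s) * ?e s) (at s within {-1..1})" if s: "s \<in> {-1..1}" for s
  proof -
    have "((\<lambda>w. G w * exp (\<i> * \<xi> * w)) has_field_derivative
        G (of_real s) * (\<i> * \<xi> * ?e s) + deriv G (of_real s) * ?e s) (at (of_real s))"
      by (rule derivative_eq_intros holomorphic_derivI[OF S(2,1) S(3)[OF s]] refl)+ (simp add: mult_ac)
    then show ?thesis by (rule has_vector_derivative_real_field)
  qed
  have "((\<lambda>s. G (of_real s) * (\<i> * \<xi> * ?e s) + deriv G (of_real s) * ?e s) has_integral
      G (of_real 1) * ?e 1 - G (of_real (-1)) * ?e (-1)) {-1..1}"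
    by (rule fundamental_theorem_of_calculus[OF _ d]) auto
  then have "integral {-1..1} (\<lambda>s. G (of_real s) * (\<i> * \<xi> * ?e s) + deriv G (of_real s) * ?e s) = 0"
    using zero by (simp add: integral_unique)
  moreover have "integral {-1..1} (\<lambda>s. G (of_real s) * (\<i> * \<xi> * ?e s) + deriv G (of_real s) * ?e s) =
      integral {-1..1} (\<lambda>s. G (of_real s) * (\<i> * \<xi> * ?e s)) + integral {-1..1} (\<lambda>s. deriv G (of_real s) * ?e s)"
    by (intro Henstock_Kurzweil_Integration.integral_add integrable_continuous_interval continuous_intros cont)
  moreover have "integral {-1..1} (\<lambda>s. G (of_real s) * (\<i> * \<xi> * ?e s)) = \<i> * \<xi> * integral {-1..1} (\<lambda>s. G (of_real s) * ?e s)"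
    by (subst Henstock_Kurzweil_Integration.integral_mult_right[symmetric]) (simp add: mult_ac)
  ultimately show ?thesis by (simp add: add_eq_0_iff2)
qed

lemma integral_by_parts_oscillatory_iterated:
  fixes \<xi> :: real
  assumes S: "open S" "G holomorphic_on S" "\<And>s. s \<in> {-1..1} \<Longrightarrow> complex_of_real s \<in> S"
    and zero: "\<And>j. j < k \<Longrightarrow> (deriv ^^ j) G 1 = 0 \<and> (deriv ^^ j) G (-1) = 0"
  shows "(\<i> * \<xi>) ^ k * integral {-1..1} (\<lambda>s. G (of_real s) * exp (\<i> * \<xi> * of_real s)) =
     (-1) ^ k * integral {-1..1} (\<lambda>s. (deriv ^^ k) G (of_real s) * exp (\<i> * \<xi> * of_real s))"
  using zero
proof (induction k)
  case (Suc k)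
  have "(\<i> * \<xi>) ^ Suc k * integral {-1..1} (\<lambda>s. G (of_real s) * exp (\<i> * \<xi> * of_real s)) =
     (\<i> * \<xi>) * ((\<i> * \<xi>) ^ k * integral {-1..1} (\<lambda>s. G (of_real s) * exp (\<i> * \<xi> * of_real s)))" by simp
  also have "\<dots> = (-1) ^ k * (\<i> * \<xi> * integral {-1..1} (\<lambda>s. (deriv ^^ k) G (of_real s) * exp (\<i> * \<xi> * of_real s)))"
    using Suc by simp
  also have "\<i> * \<xi> * integral {-1..1} (\<lambda>s. (deriv ^^ k) G (of_real s) * exp (\<i> * \<xi> * of_real s)) =
     - integral {-1..1} (\<lambda>s. deriv ((deriv ^^ k) G) (of_real s) * exp (\<i> * \<xi> * of_real s))"
    using Suc.prems[of k] by (intro integral_by_parts_oscillatory[OF S(1) _ S(3)] holomorphic_higher_deriv S) auto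
  finally show ?case by simp
qed simp

section \<open>The integrable weight and the polynomial bump\<close>

lemma integrable_inverse_1_plus_abs_square: "integrable lborel (\<lambda>u::real. 1 / (jb u)\<^sup>2)"
proof (rule Bochner_Integration.integrable_bound)
  show "integrable lborel (\<lambda>u::real. inverse (1 + u\<^sup>2))"
    using integrable_inverse_1_plus_square unfolding set_integrable_def by simp
  have "inverse ((jb u)\<^sup>2) \<le> inverse (1 + u\<^sup>2)" for u :: real
    by (rule le_imp_inverse_le) (auto simp: power2_eq_square algebra_simps add_pos_nonneg)
  then show "AE u::real in lborel. norm (1 / (jb u)\<^sup>2) \<le> norm (inverse (1 + u\<^sup>2))"
    by (simp add: inverse_eq_divide)
qed measurable

definition sq_mass :: real where "sq_mass = (\<integral>u. 1 / (jb u)\<^sup>2 \<partial>lborel)"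

lemma sq_mass_nonneg: "0 \<le> sq_mass" unfolding sq_mass_def by (intro integral_nonneg_AE) auto

text \<open>The substitution \<open>u = (s - s') * T\<close> gains the factor \<open>1 / T\<close>
  that later cancels the \<open>T\<close> in front of a smoothed density.\<close>

lemma integral_scaled_sq_le:
  assumes "0 < T"
  shows "integral {-1..1} (\<lambda>s. 1 / (jb ((s - s') * T))\<^sup>2) \<le> sq_mass / T"
proof -
  let ?g = "\<lambda>u::real. 1 / (jb u)\<^sup>2"
  have eq: "- s' * T + T * s = (s - s') * T" for s by (simp add: algebra_simps)
  have int: "integrable lborel (\<lambda>s. ?g ((s - s') * T))"
    using lborel_integrable_real_affine[OF integrable_inverse_1_plus_abs_square, of T "- s' * T"] assms
    unfolding eq by simp
  have "sq_mass = T * (\<integral>s. ?g (- s' * T + T * s) \<partial>lborel)"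
    unfolding sq_mass_def using assms by (subst lborel_integral_real_affine[where c = T and t = "- s' * T"]) auto
  then have "(\<integral>s. ?g ((s - s') * T) \<partial>lborel) = sq_mass / T" using assms by (simp add: eq field_simps)
  moreover have "integral {-1..1} (\<lambda>s. ?g ((s - s') * T)) = (LINT s:{-1..1}|lborel. ?g ((s - s') * T))"
    by (intro set_borel_integral_eq_integral(2)[symmetric])
      (unfold set_integrable_def, intro integrable_mult_indicator int, simp)
  moreover have "\<dots> \<le> (\<integral>s. ?g ((s - s') * T) \<partial>lborel)"
    unfolding set_lebesgue_integral_def
    by (intro integral_mono integrable_mult_indicator int) (auto simp: indicator_def)
  ultimately show ?thesis by simp
qed

definition bump :: "nat \<Rightarrow> real \<Rightarrow> real" where "bump k s = (1 - s\<^sup>2) ^ k"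

lemma bump_le_1: "s \<in> {-1..1} \<Longrightarrow> \<bar>bump k s\<bar> \<le> 1"
  unfolding bump_def power_abs by (intro power_le_one) (auto simp: abs_le_iff abs_square_le_1)

lemma one_plus_power_le: "0 \<le> (x::real) \<Longrightarrow> (1 + x) ^ k \<le> 2 ^ k * (1 + x ^ k)"
proof -
  assume x: "0 \<le> x"
  have "(1 + x) ^ k \<le> (2 * max 1 x) ^ k" using x by (intro power_mono) auto
  also have "\<dots> = 2 ^ k * (max 1 x) ^ k" by (simp add: power_mult_distrib)
  also have "(max 1 x) ^ k \<le> 1 + x ^ k" using x by (auto simp: max_def)
  finally show ?thesis by simp
qed

text \<open>
  The bump vanishes to order \<open>k\<close> at both end points, so \<open>k\<close> integrations by parts leave no boundary
  terms; Cauchy's estimate on discs of radius \<open>1 / T\<close> bounds the \<open>k\<close>-th derivative by \<open>T ^ k\<close>, which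
  cancels the frequency \<open>(T * x) ^ k\<close>.
\<close>

lemma bump_transform_bound:
  fixes D :: "complex \<Rightarrow> complex" and T K x s' :: real
  assumes T: "1 \<le> T" and K: "0 \<le> K" and D: "D holomorphic_on ball 0 (2 * T + 2)"
    and D_le: "\<And>t w. \<bar>t\<bar> \<le> 2 * T \<Longrightarrow> cmod (w - of_real t) \<le> 1 \<Longrightarrow> cmod (D w) \<le> K / (jb t)\<^sup>2"
    and s': "s' \<in> {-1..1}"
  shows "jb x ^ k * cmod (integral {-1..1}
      (\<lambda>s. of_real (bump k s) * D (of_real ((s - s') * T)) * exp (\<i> * of_real (T * x) * of_real s)))
    \<le> 2 ^ k * (1 + fact k * 5 ^ k) * K * sq_mass / T"
proof -
  define S where "S = (\<lambda>w::complex. (w - of_real s') * of_real T) -` ball 0 (2 * T + 2)"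
  have "open S" unfolding S_def by (intro open_vimage open_ball continuous_intros)
  define D1 where "D1 = (\<lambda>w. D ((w - of_real s') * of_real T))"
  define G where "G = (\<lambda>w. (1 - w\<^sup>2) ^ k * D1 w)"
  have D1: "D1 holomorphic_on S"
  proof -
    have "D \<circ> (\<lambda>w. (w - of_real s') * of_real T) holomorphic_on S"
      by (rule holomorphic_on_compose_gen[OF _ D]) (auto intro!: holomorphic_intros simp: S_def)
    then show ?thesis by (simp add: D1_def comp_def)
  qed
  have G: "G holomorphic_on S" unfolding G_def by (intro holomorphic_intros D1)
  have norm_eq: "cmod (complex_of_real s - of_real s') = \<bar>s - s'\<bar>" for s
    by (metis norm_of_real of_real_diff)
  have ss: "\<bar>s - s'\<bar> \<le> 2" if "s \<in> {-1..1}" for s using that s' by (auto simp: abs_le_iff)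
  \<comment> \<open>The distance from the origin is at most
    \<open>1 / T * T + 2 * T = 2 * T + 1\<close>, so the discs for Cauchy's estimate stay where
    \<open>D\<close> is holomorphic; this is why its domain has radius
    \<open>2 * T + 2\<close>.\<close>
  have cb: "w \<in> S" if s: "s \<in> {-1..1}" and w: "cmod (w - of_real s) \<le> 1 / T" for s w
  proof -
    have "(w - of_real s') * of_real T = (w - of_real s) * of_real T + (of_real s - of_real s') * of_real T"
      by (simp add: algebra_simps)
    then have "cmod ((w - of_real s') * of_real T) \<le> cmod (w - of_real s) * T + \<bar>s - s'\<bar> * T"
      using norm_triangle_ineq[of "(w - of_real s) * of_real T" "(of_real s - of_real s') * of_real T"] T
      by (simp add: norm_mult norm_eq)
    also have "\<dots> \<le> 1 / T * T + 2 * T" using w ss[OF s] T by (intro add_mono mult_right_mono) auto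
    finally show ?thesis using T by (simp add: S_def)
  qed
  have seg: "complex_of_real s \<in> S" if "s \<in> {-1..1}" for s using cb[OF that] T by simp
  have ends: "1 \<in> S" "-1 \<in> S" using seg[of 1] seg[of "-1"] by auto
  define Q where "Q = (\<lambda>s. K / (jb ((s - s') * T))\<^sup>2)"
  have Qint: "Q integrable_on {-1..1}"
    unfolding Q_def by (intro integrable_continuous_interval continuous_intros) (auto simp: add_nonneg_eq_0_iff)
  have Qle: "integral {-1..1} Q \<le> K * (sq_mass / T)"
  proof -
    have "integral {-1..1} Q = K * integral {-1..1} (\<lambda>s. 1 / (jb ((s - s') * T))\<^sup>2)"
      unfolding Q_def by (subst Henstock_Kurzweil_Integration.integral_mult_right[symmetric]) simp
    also have "\<dots> \<le> K * (sq_mass / T)" using T K by (intro mult_left_mono integral_scaled_sq_le) auto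
    finally show ?thesis .
  qed
  have D1_le: "cmod (D1 w) \<le> Q s" if s: "s \<in> {-1..1}" and w: "cmod (w - of_real s) \<le> 1 / T" for s w
    unfolding D1_def Q_def
  proof (rule D_le)
    show "\<bar>(s - s') * T\<bar> \<le> 2 * T" using ss[OF s] T by (simp add: abs_mult)
    have "(w - of_real s') * of_real T - of_real ((s - s') * T) = (w - of_real s) * of_real T"
      by (simp add: algebra_simps)
    then have "cmod ((w - of_real s') * of_real T - of_real ((s - s') * T)) = cmod (w - of_real s) * T"
      using T by (simp add: norm_mult)
    also have "\<dots> \<le> 1 / T * T" using w T by (intro mult_right_mono) auto
    finally show "cmod ((w - of_real s') * of_real T - of_real ((s - s') * T)) \<le> 1" using T by simp
  qed
  let ?e = "\<lambda>s::real. exp (\<i> * of_real (T * x) * of_real s)"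
  define J where "J = integral {-1..1} (\<lambda>s. G (of_real s) * ?e s)"
  have contG: "continuous_on {-1..1} (\<lambda>s. (deriv ^^ j) G (of_real s))" for j
    using seg \<open>open S\<close> G
    by (intro continuous_on_compose2[OF holomorphic_on_imp_continuous_on[OF holomorphic_higher_deriv[OF G \<open>open S\<close>]]] continuous_intros) auto
  have intG: "(\<lambda>s. (deriv ^^ j) G (of_real s) * ?e s) integrable_on {-1..1}" for j
    by (intro integrable_continuous_interval continuous_intros contG)
  have J0: "cmod J \<le> K * (sq_mass / T)"
  proof -
    have "cmod J \<le> integral {-1..1} Q"
      unfolding J_def
    proof (rule integral_norm_bound_integral[OF _ Qint])
      show "(\<lambda>s. G (of_real s) * ?e s) integrable_on {-1..1}" using intG[of 0] by simp
      fix s :: real assume s: "s \<in> {-1..1}"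
      have "cmod (G (of_real s) * ?e s) = \<bar>bump k s\<bar> * cmod (D1 (of_real s))"
      proof -
        have "(1 - (complex_of_real s)\<^sup>2) ^ k = of_real (bump k s)" by (simp add: bump_def)
        then show ?thesis by (simp add: G_def norm_mult)
      qed
      also have "\<dots> \<le> 1 * Q s" using T by (intro mult_mono bump_le_1 s D1_le) auto
      finally show "cmod (G (of_real s) * ?e s) \<le> Q s" by simp
    qed
    then show ?thesis using Qle by simp
  qed
  have Jk: "(T * \<bar>x\<bar>) ^ k * cmod J \<le> (fact k * 5 ^ k * T ^ k) * (K * (sq_mass / T))"
  proof -
    \<comment> \<open>The factorisation \<open>1 - w ^ 2 = (w - 1) * (- 1 - w)\<close> exhibits the
      zero of order \<open>k\<close> at 1; the one at -1 is analogous.\<close>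
    have z1: "(deriv ^^ j) G 1 = 0" if "j < k" for j
    proof (rule higher_deriv_at_zero[OF \<open>open S\<close> _ that ends(1)])
      show "(\<lambda>w. (- 1 - w) ^ k * D1 w) holomorphic_on S" by (intro holomorphic_intros D1)
      show "G w = (w - 1) ^ k * ((- 1 - w) ^ k * D1 w)" for w
        unfolding G_def mult.assoc[symmetric] power_mult_distrib[symmetric] by (simp add: power2_eq_square algebra_simps)
    qed
    have z2: "(deriv ^^ j) G (-1) = 0" if "j < k" for j
    proof (rule higher_deriv_at_zero[OF \<open>open S\<close> _ that ends(2)])
      show "(\<lambda>w. (1 - w) ^ k * D1 w) holomorphic_on S" by (intro holomorphic_intros D1)
      show "G w = (w - - 1) ^ k * ((1 - w) ^ k * D1 w)" for w
        unfolding G_def mult.assoc[symmetric] power_mult_distrib[symmetric] by (simp add: power2_eq_square algebra_simps)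
    qed
    have "(T * \<bar>x\<bar>) ^ k * cmod J = cmod ((\<i> * of_real (T * x)) ^ k * J)"
      using T by (simp add: norm_mult norm_power abs_mult)
    also have "\<dots> = cmod (integral {-1..1} (\<lambda>s. (deriv ^^ k) G (of_real s) * ?e s))"
      unfolding J_def using z1 z2
      by (subst integral_by_parts_oscillatory_iterated[OF \<open>open S\<close> G seg]) (auto simp: norm_mult norm_power)
    also have "\<dots> \<le> integral {-1..1} (\<lambda>s. (fact k * 5 ^ k * T ^ k) * Q s)"
    proof (rule integral_norm_bound_integral[OF intG])
      show "(\<lambda>s. fact k * 5 ^ k * T ^ k * Q s) integrable_on {-1..1}"
        by (rule integrable_on_mult_right[OF Qint])
      fix s :: real assume s: "s \<in> {-1..1}"
      have "cmod ((deriv ^^ k) G (of_real s)) \<le> fact k * (5 ^ k * Q s) / (1 / T) ^ k"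
      proof (rule Cauchy_inequality)
        have sub: "cball (of_real s) (1 / T) \<subseteq> S" using cb[OF s] by (auto simp: dist_norm norm_minus_commute)
        then show "continuous_on (cball (of_real s) (1 / T)) G"
          by (intro holomorphic_on_imp_continuous_on holomorphic_on_subset[OF G])
        show "G holomorphic_on ball (of_real s) (1 / T)"
          using sub ball_subset_cball by (intro holomorphic_on_subset[OF G]) blast
        fix w assume w: "cmod (of_real s - w) = 1 / T"
        \<comment> \<open>As \<open>1 / T \<le> 1\<close>, the circle stays in the disc of radius 2,
          where \<open>1 - w ^ 2\<close> is at most 5 in modulus. This produces the constant
          \<open>5 ^ k\<close>.\<close>
        have "cmod w \<le> 2"
        proof -
          have "cmod w \<le> cmod (of_real s) + cmod (of_real s - w)" by (metis norm_triangle_sub norm_minus_commute)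
          also have "cmod (of_real s :: complex) \<le> 1" using s by (auto simp: abs_le_iff)
          also have "cmod (of_real s - w) \<le> 1" using w T by simp
          finally show ?thesis by simp
        qed
        then have "cmod (1 - w\<^sup>2) \<le> 1 + 2\<^sup>2"
          by (intro order.trans[OF norm_triangle_ineq4] add_mono) (auto simp: norm_power intro: power_mono[of _ 2 2, simplified])
        then have "cmod (1 - w\<^sup>2) \<le> 5" by simp
        then show "cmod (G w) \<le> 5 ^ k * Q s"
          unfolding G_def norm_mult norm_power
          using w by (intro mult_mono power_mono D1_le[OF s]) (auto simp: norm_minus_commute)
      qed (use T in auto)
      also have "\<dots> = (fact k * 5 ^ k * T ^ k) * Q s" by (simp add: power_divide)
      finally show "cmod ((deriv ^^ k) G (of_real s) * ?e s) \<le> (fact k * 5 ^ k * T ^ k) * Q s"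
        by (simp add: norm_mult)
    qed
    also have "\<dots> = (fact k * 5 ^ k * T ^ k) * integral {-1..1} Q"
      by (rule Henstock_Kurzweil_Integration.integral_mult_right)
    also have "\<dots> \<le> (fact k * 5 ^ k * T ^ k) * (K * (sq_mass / T))"
      using T by (intro mult_left_mono Qle) auto
    finally show ?thesis .
  qed
  have "T ^ k * (\<bar>x\<bar> ^ k * cmod J) \<le> T ^ k * (fact k * 5 ^ k * (K * (sq_mass / T)))"
    using Jk by (simp add: power_mult_distrib mult_ac)
  then have Jx: "\<bar>x\<bar> ^ k * cmod J \<le> fact k * 5 ^ k * (K * (sq_mass / T))"
    using T by (subst (asm) mult_le_cancel_left_pos) auto
  \<comment> \<open>The plain bound serves bounded \<open>x\<close>, the one with
    \<open>\<bar>x\<bar> ^ k\<close> serves large \<open>x\<close>; \<open>one_plus_power_le\<close>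
    merges them.\<close>
  have "jb x ^ k * cmod J \<le> 2 ^ k * (1 + \<bar>x\<bar> ^ k) * cmod J"
    by (intro mult_right_mono one_plus_power_le) auto
  also have "\<dots> = 2 ^ k * (cmod J + \<bar>x\<bar> ^ k * cmod J)" by (simp add: algebra_simps)
  also have "\<dots> \<le> 2 ^ k * (K * (sq_mass / T) + fact k * 5 ^ k * (K * (sq_mass / T)))"
    using J0 Jx by (intro mult_left_mono add_mono) auto
  also have "\<dots> = 2 ^ k * (1 + fact k * 5 ^ k) * K * sq_mass / T" by (simp add: algebra_simps add_divide_distrib)
  finally show ?thesis by (simp add: J_def G_def D1_def bump_def)
qed

section \<open>A smoothing kernel with compactly supported Fourier transform\<close>

text \<open>A bound on the inner L1 norms uniform in \<open>y\<close> is enough for joint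
  integrability, as the outer measure has total mass one.\<close>

lemma (in real_distribution) fubini_lborel:
  fixes f :: "real \<Rightarrow> real \<Rightarrow> 'b :: {banach, second_countable_topology}"
  assumes f: "(\<lambda>(y, s). f y s) \<in> borel_measurable (borel \<Otimes>\<^sub>M borel)"
    and int: "\<And>y. integrable lborel (f y)" and le: "\<And>y. (\<integral>s. norm (f y s) \<partial>lborel) \<le> c"
  shows "integrable lborel (\<lambda>s. \<integral>y. f y s \<partial>M)" "(\<integral>y. (\<integral>s. f y s \<partial>lborel) \<partial>M) = (\<integral>s. (\<integral>y. f y s \<partial>M) \<partial>lborel)"
proof -
  interpret P: pair_sigma_finite M lborel ..
  have m: "(\<lambda>(y, s). f y s) \<in> borel_measurable (M \<Otimes>\<^sub>M lborel)"
    using f by (simp cong: measurable_cong_sets sets_pair_measure_cong)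
  have m': "(\<lambda>(y, s). norm (f y s)) \<in> borel_measurable (M \<Otimes>\<^sub>M lborel)"
    using measurable_compose[OF m borel_measurable_norm] by (simp add: case_prod_unfold)
  have i: "integrable (M \<Otimes>\<^sub>M lborel) (\<lambda>(y, s). f y s)"
  proof (rule P.Fubini_integrable[OF m])
    have "(\<lambda>y. \<integral>s. norm (f y s) \<partial>lborel) \<in> borel_measurable M"
      using lborel.borel_measurable_lebesgue_integral[OF m'] by simp
    then show "integrable M (\<lambda>y. \<integral>s. norm (case (y, s) of (y, s) \<Rightarrow> f y s) \<partial>lborel)"
      using le by (auto intro!: integrable_const_bound[where B = c])
  qed (use int in simp)
  show "integrable lborel (\<lambda>s. \<integral>y. f y s \<partial>M)" using P.integrable_snd[OF i] .
  show "(\<integral>y. (\<integral>s. f y s \<partial>lborel) \<partial>M) = (\<integral>s. (\<integral>y. f y s \<partial>M) \<partial>lborel)" using P.Fubini_integral[OF i] by simp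
qed

definition bump0 :: "nat \<Rightarrow> real \<Rightarrow> real" where "bump0 k s = indicator {-1..1} s * bump k s"

lemma bump0_measurable [measurable]: "bump0 k \<in> borel_measurable borel"
  unfolding bump0_def bump_def by measurable

lemma bump0_nonneg: "0 \<le> bump0 k s" and bump0_le: "bump0 k s \<le> indicator {-1..1} s"
  using bump_le_1[of s k] by (auto simp: bump0_def bump_def indicator_def abs_square_le_1 abs_le_iff)

lemma integrable_indicator_unit: "integrable lborel (indicator {-1..1::real} :: real \<Rightarrow> real)"
  by (simp add: integrable_indicator_iff)

lemma integrable_bump0_mult:
  fixes g :: "real \<Rightarrow> complex"
  assumes "g \<in> borel_measurable borel" "\<And>s. cmod (g s) \<le> c"
  shows "integrable lborel (\<lambda>s. of_real (bump0 k s) * g s)"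
    "(\<integral>s. cmod (of_real (bump0 k s) * g s) \<partial>lborel) \<le> 2 * c"
proof -
  have c: "0 \<le> c" using assms(2)[of 0] norm_ge_zero order.trans by blast
  have le: "cmod (of_real (bump0 k s) * g s) \<le> c * indicator {-1..1} s" for s
    unfolding norm_mult using mult_mono[OF bump0_le[of k s] assms(2)[of s]] bump0_nonneg[of k s]
    by (simp add: mult.commute)
  have i: "integrable lborel (\<lambda>s. c * indicator {-1..1::real} s :: real)"
    by (intro integrable_mult_right integrable_indicator_unit)
  show 1: "integrable lborel (\<lambda>s. of_real (bump0 k s) * g s)"
    using le assms(1) by (intro Bochner_Integration.integrable_bound[OF i]) (auto intro: order.trans[OF _ abs_ge_self])
  have "(\<integral>s. cmod (of_real (bump0 k s) * g s) \<partial>lborel) \<le> (\<integral>s. c * indicator {-1..1::real} s \<partial>lborel)"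
    by (intro integral_mono integrable_norm 1 i le)
  also have "\<dots> = 2 * c" by simp
  finally show "(\<integral>s. cmod (of_real (bump0 k s) * g s) \<partial>lborel) \<le> 2 * c" .
qed

lemma integral_bump0_mult:
  fixes g :: "real \<Rightarrow> complex"
  assumes "continuous_on {-1..1} g"
  shows "(\<integral>s. of_real (bump0 k s) * g s \<partial>lborel) = integral {-1..1} (\<lambda>s. of_real (bump k s) * g s)"
proof -
  have "continuous_on {-1..1} (\<lambda>s. of_real (bump k s) * g s)"
    unfolding bump_def by (intro continuous_intros assms)
  then have "set_integrable lborel {-1..1} (\<lambda>s. of_real (bump k s) * g s)"
    unfolding set_integrable_def by (intro borel_integrable_compact) auto
  from set_borel_integral_eq_integral(2)[OF this]
  have "(\<integral>s. indicator {-1..1} s *\<^sub>R (of_real (bump k s) * g s) \<partial>lborel) = integral {-1..1} (\<lambda>s. of_real (bump k s) * g s)"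
    unfolding set_lebesgue_integral_def .
  moreover have "indicator {-1..1} s *\<^sub>R (of_real (bump k s) * g s) = of_real (bump0 k s) * g s" for s
    by (simp add: bump0_def scaleR_conv_of_real)
  ultimately show ?thesis by (simp only:)
qed

section \<open>The kernel: decay and positivity\<close>

definition osc :: "nat \<Rightarrow> real \<Rightarrow> complex" where
  "osc k y = (\<integral>s. of_real (bump0 k s) * exp (\<i> * of_real y * of_real s) \<partial>lborel)"

lemma osc_measurable [measurable]: "osc k \<in> borel_measurable borel"
  unfolding osc_def by measurable

lemma osc_le: "cmod (osc k y) \<le> 2"
  unfolding osc_def
  using order.trans[OF integral_norm_bound integrable_bump0_mult(2)[of "\<lambda>s. exp (\<i> * of_real y * of_real s)" 1 k]] by simp

text \<open>The squared modulus is nonnegative, and its Fourier transform is supported in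
  \<open>[-2, 2]\<close>, being up to a constant the autocorrelation of the truncated bump.\<close>

definition kern :: "nat \<Rightarrow> real \<Rightarrow> real" where "kern k y = (cmod (osc k y))\<^sup>2"

lemma kern_measurable [measurable]: "kern k \<in> borel_measurable borel"
  unfolding kern_def by measurable

lemma kern_nonneg: "0 \<le> kern k y" by (simp add: kern_def)

text \<open>Only one of the two factors of the squared modulus is written as an integral, so that
  the two frequency integrals can be unfolded one after the other.\<close>

lemma kern_eq: "complex_of_real (kern k y) = (\<integral>s. of_real (bump0 k s) * (exp (- (\<i> * of_real y * of_real s)) * osc k y) \<partial>lborel)"
proof -
  have "cnj (osc k y) = (\<integral>s. cnj (of_real (bump0 k s) * exp (\<i> * of_real y * of_real s)) \<partial>lborel)"
    unfolding osc_def by (rule Bochner_Integration.integral_cnj[symmetric])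
  also have "\<dots> = (\<integral>s. of_real (bump0 k s) * exp (- (\<i> * of_real y * of_real s)) \<partial>lborel)"
    by (simp add: exp_cnj)
  finally have "cnj (osc k y) * osc k y = (\<integral>s. (of_real (bump0 k s) * exp (- (\<i> * of_real y * of_real s))) * osc k y \<partial>lborel)"
    by simp
  moreover have "complex_of_real (kern k y) = cnj (osc k y) * osc k y"
    unfolding kern_def complex_norm_square by (rule mult.commute)
  ultimately show ?thesis by (simp add: mult.assoc)
qed

text \<open>The square of \<open>bump_transform_bound\<close> for the constant function
  \<open>D = 1\<close> with \<open>T = 1\<close> and \<open>s' = 0\<close>; there 9 dominates
  \<open>(1 + \<bar>t\<bar>) ^ 2\<close> for \<open>\<bar>t\<bar> \<le> 2\<close>.\<close>

lemma kern_decay: "\<exists>C\<ge>0. \<forall>y. kern k y \<le> C / jb y ^ (2 * k)"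
proof -
  define C where "C = 2 ^ k * (1 + fact k * 5 ^ k) * 9 * sq_mass / 1"
  have "kern k y \<le> C\<^sup>2 / jb y ^ (2 * k)" for y
  proof -
    have "jb y ^ k * cmod (integral {-1..1}
      (\<lambda>s. of_real (bump k s) * (\<lambda>_. 1) (complex_of_real ((s - 0) * 1)) * exp (\<i> * of_real (1 * y) * of_real s))) \<le> C"
      unfolding C_def
    proof (rule bump_transform_bound)
      show "cmod 1 \<le> 9 / (jb t)\<^sup>2" if "\<bar>t\<bar> \<le> 2 * 1" for t :: real
      proof -
        have "(jb t)\<^sup>2 \<le> 3\<^sup>2" using that by (intro power_mono) auto
        then show ?thesis by (simp add: le_divide_eq add_nonneg_eq_0_iff)
      qed
    qed auto
    moreover have "osc k y = integral {-1..1} (\<lambda>s. of_real (bump k s) * exp (\<i> * of_real y * of_real s))"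
      unfolding osc_def by (intro integral_bump0_mult continuous_intros)
    ultimately have "jb y ^ k * cmod (osc k y) \<le> C" by simp
    then have "(jb y ^ k * cmod (osc k y))\<^sup>2 \<le> C\<^sup>2" by (intro power_mono) auto
    moreover have "(jb y ^ k * cmod (osc k y))\<^sup>2 = kern k y * jb y ^ (2 * k)"
      unfolding kern_def power_mult_distrib power_even_eq by (rule mult.commute)
    ultimately show ?thesis by (subst pos_le_divide_eq) (auto intro: add_pos_nonneg)
  qed
  then show ?thesis by (intro exI[of _ "C\<^sup>2"]) auto
qed

text \<open>For \<open>\<bar>y\<bar> \<le> 1\<close> the phases \<open>y * s\<close> lie in
  \<open>[-1, 1]\<close>, where the cosine is at least \<open>cos 1 > 0\<close>. Hence the real part
  of \<open>osc k y\<close> is at least \<open>cos 1\<close> times the integral of the nonnegative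
  bump.\<close>

lemma kern_pos: "\<exists>c>0. \<forall>y. \<bar>y\<bar> \<le> 1 \<longrightarrow> c \<le> kern k y"
proof -
  define I where "I = integral {-1..1} (\<lambda>s. bump k s)"
  have cb: "continuous_on {-1..1} (bump k)" unfolding bump_def by (intro continuous_intros)
  have bn: "0 \<le> bump k s" if "s \<in> {-1..1}" for s
    using bump0_nonneg[of k s] that by (simp add: bump0_def)
  have "I \<noteq> 0"
  proof
    assume "I = 0"
    then have "\<forall>s\<in>{-1..1}. bump k s = 0" using integral_eq_0_iff[OF cb _ bn] by (simp add: I_def)
    then have "bump k 0 = 0" by simp
    then show False by (simp add: bump_def)
  qed
  moreover have "0 \<le> I" unfolding I_def using bn by (intro integral_nonneg integrable_continuous_interval cb) auto
  ultimately have I: "0 < I" by simp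
  have cos1: "0 < cos (1::real)" by (rule cos_gt_zero_pi) (use pi_gt3 in auto)
  have "(cos 1 * I)\<^sup>2 \<le> kern k y" if y: "\<bar>y\<bar> \<le> 1" for y
  proof -
    have eq: "osc k y = integral {-1..1} (\<lambda>s. of_real (bump k s) * exp (\<i> * of_real y * of_real s))"
      unfolding osc_def by (intro integral_bump0_mult continuous_intros)
    have io: "(\<lambda>s. complex_of_real (bump k s) * exp (\<i> * of_real y * of_real s)) integrable_on {-1..1}"
      by (intro integrable_continuous_interval continuous_intros cb)
    have "cos 1 * I = integral {-1..1} (\<lambda>s. cos 1 * bump k s)"
      unfolding I_def by (rule Henstock_Kurzweil_Integration.integral_mult_right[symmetric])
    also have "\<dots> \<le> integral {-1..1} (\<lambda>s. Re (of_real (bump k s) * exp (\<i> * of_real y * of_real s)))"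
    proof (rule integral_le)
      show "(\<lambda>s. cos 1 * bump k s) integrable_on {-1..1}"
        by (intro integrable_continuous_interval continuous_intros cb)
      show "(\<lambda>s. Re (of_real (bump k s) * exp (\<i> * of_real y * of_real s))) integrable_on {-1..1}"
        using integrable_linear[OF io bounded_linear_Re] by (simp add: comp_def)
      fix s :: real assume s: "s \<in> {-1..1}"
      have "\<bar>y * s\<bar> \<le> 1 * 1" unfolding abs_mult using y s by (intro mult_mono) auto
      then have "cos 1 \<le> cos \<bar>y * s\<bar>" using pi_gt3 by (subst cos_mono_le_eq) auto
      then have "cos 1 * bump k s \<le> cos (y * s) * bump k s" using bn[OF s] by (intro mult_right_mono) auto
      then show "cos 1 * bump k s \<le> Re (of_real (bump k s) * exp (\<i> * of_real y * of_real s))"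
        by (simp add: Re_exp mult.commute)
    qed
    also have "\<dots> = Re (osc k y)"
      unfolding eq using integral_linear[OF io bounded_linear_Re] by (simp add: comp_def)
    also have "\<dots> \<le> cmod (osc k y)" by (rule complex_Re_le_cmod)
    finally show ?thesis unfolding kern_def using cos1 I by (intro power_mono) auto
  qed
  then show ?thesis using cos1 I by (intro exI[of _ "(cos 1 * I)\<^sup>2"]) auto
qed

text \<open>The density of \<open>M\<close> smoothed at scale \<open>1 / T\<close>. It is not
  normalised: its total mass is the integral of the kernel, later called
  \<open>kmass\<close>.\<close>

abbreviation (input) dens :: "nat \<Rightarrow> real \<Rightarrow> real measure \<Rightarrow> real \<Rightarrow> real" where
  "dens k T M x \<equiv> T * (\<integral>y. kern k (T * (y - x)) \<partial>M)"

text \<open>The two factors of the kernel contribute frequencies \<open>s\<close> and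
  \<open>s'\<close> of opposite sign, and integrating out \<open>y\<close> leaves the characteristic
  function at \<open>(s - s') * T\<close>. So only frequencies up to \<open>2 * T\<close> enter, a
  range in which the characteristic function will extend holomorphically.\<close>

lemma (in real_distribution) integral_kern:
  fixes T x :: real and k :: nat
  defines "A \<equiv> (\<lambda>s'. of_real (bump0 k s') * exp (\<i> * of_real (T * x) * of_real s') *
    integral {-1..1} (\<lambda>s. of_real (bump k s) * char M ((s - s') * T) * exp (\<i> * of_real (T * (- x)) * of_real s)))"
  shows "integrable lborel A" "complex_of_real (\<integral>y. kern k (T * (y - x)) \<partial>M) = (\<integral>s'. A s' \<partial>lborel)"
proof -
  let ?f = "\<lambda>y s'. of_real (bump0 k s') * (exp (- (\<i> * of_real (T * (y - x)) * of_real s')) * osc k (T * (y - x)))"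
  have le: "cmod (exp (- (\<i> * of_real (T * (y - x)) * of_real s')) * osc k (T * (y - x))) \<le> 2" for y s'
    using osc_le by (simp add: norm_mult)
  note fub = fubini_lborel[of ?f "2 * 2", OF _ integrable_bump0_mult[OF _ le]]
  have fm: "(\<lambda>(y, s'). ?f y s') \<in> borel_measurable (borel \<Otimes>\<^sub>M borel)" by measurable
  have A: "(\<integral>y. ?f y s' \<partial>M) = A s'" for s'
  proof -
    let ?g = "\<lambda>y s. of_real (bump0 k s) * (exp (- (\<i> * of_real (T * (y - x)) * of_real s')) * exp (\<i> * of_real (T * (y - x)) * of_real s))"
    have gle: "cmod (exp (- (\<i> * of_real (T * (y - x)) * of_real s')) * exp (\<i> * of_real (T * (y - x)) * of_real s)) \<le> 1" for y s
      by (simp add: norm_mult)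
    have gm: "(\<lambda>(y, s). ?g y s) \<in> borel_measurable (borel \<Otimes>\<^sub>M borel)" by measurable
    have "(\<integral>y. ?f y s' \<partial>M) = of_real (bump0 k s') * (\<integral>y. exp (- (\<i> * of_real (T * (y - x)) * of_real s')) * osc k (T * (y - x)) \<partial>M)"
      by simp
    also have "(\<integral>y. exp (- (\<i> * of_real (T * (y - x)) * of_real s')) * osc k (T * (y - x)) \<partial>M) =
        (\<integral>y. (\<integral>s. ?g y s \<partial>lborel) \<partial>M)"
      unfolding osc_def by (simp flip: integral_mult_right_zero add: mult_ac)
    also have "\<dots> = (\<integral>s. (\<integral>y. ?g y s \<partial>M) \<partial>lborel)"
      by (rule fubini_lborel(2)[OF gm integrable_bump0_mult[OF _ gle]]) measurable
    also have "(\<lambda>s. \<integral>y. ?g y s \<partial>M) = (\<lambda>s. exp (\<i> * of_real (T * x) * of_real s') * (of_real (bump0 k s) *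
        (char M ((s - s') * T) * exp (\<i> * of_real (T * (- x)) * of_real s))))"
    proof
      fix s
      have "?g y s = (exp (\<i> * of_real (T * x) * of_real s') * of_real (bump0 k s) * exp (\<i> * of_real (T * (- x)) * of_real s))
          * iexp ((s - s') * T * y)" for y
      proof -
        have "exp (- (\<i> * of_real (T * (y - x)) * of_real s')) * exp (\<i> * of_real (T * (y - x)) * of_real s) =
            exp (\<i> * of_real (T * x) * of_real s') * exp (\<i> * of_real (T * (- x)) * of_real s) * iexp ((s - s') * T * y)"
          unfolding exp_add[symmetric] by (rule arg_cong[of _ _ exp]) (simp add: algebra_simps)
        then show ?thesis by (simp only: mult_ac)
      qed
      then show "(\<integral>y. ?g y s \<partial>M) = exp (\<i> * of_real (T * x) * of_real s') * (of_real (bump0 k s) *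
        (char M ((s - s') * T) * exp (\<i> * of_real (T * (- x)) * of_real s)))"
        by (simp only: char_def integral_mult_right_zero) (simp add: mult_ac)
    qed
    also have "(\<integral>s. exp (\<i> * of_real (T * x) * of_real s') * (of_real (bump0 k s) *
        (char M ((s - s') * T) * exp (\<i> * of_real (T * (- x)) * of_real s))) \<partial>lborel) =
      exp (\<i> * of_real (T * x) * of_real s') * integral {-1..1} (\<lambda>s. of_real (bump k s) *
        (char M ((s - s') * T) * exp (\<i> * of_real (T * (- x)) * of_real s)))"
    proof -
      have "continuous_on {-1..1} (\<lambda>s. char M ((s - s') * T))"
        by (intro continuous_at_imp_continuous_on ballI isCont_o2[OF _ isCont_char]) (intro continuous_intros)
      then show ?thesis
        by (subst integral_mult_right_zero, subst integral_bump0_mult) (intro continuous_intros, auto)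
    qed
    finally show ?thesis by (simp add: A_def mult_ac)
  qed
  show "integrable lborel A" using fub(1)[OF fm] unfolding A by simp
  have "complex_of_real (\<integral>y. kern k (T * (y - x)) \<partial>M) = (\<integral>y. (\<integral>s'. ?f y s' \<partial>lborel) \<partial>M)"
    by (simp only: integral_complex_of_real[symmetric] kern_eq)
  also have "\<dots> = (\<integral>s'. A s' \<partial>lborel)" using fub(2)[OF fm] unfolding A by simp
  finally show "complex_of_real (\<integral>y. kern k (T * (y - x)) \<partial>M) = (\<integral>s'. A s' \<partial>lborel)" .
qed

section \<open>Bounds for smoothed densities\<close>

lemma norm_bump_integral_le:
  fixes J :: "real \<Rightarrow> complex"
  assumes "\<And>s'. s' \<in> {-1..1} \<Longrightarrow> cmod (J s') \<le> c" "0 \<le> c"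
  shows "cmod (\<integral>s'. of_real (bump0 k s') * exp (\<i> * of_real y * of_real s') * J s' \<partial>lborel) \<le> 2 * c"
proof -
  let ?g = "\<lambda>s'. of_real (bump0 k s') * exp (\<i> * of_real y * of_real s') * J s'"
  have le: "cmod (?g s') \<le> c * indicator {-1..1} s'" for s'
  proof (cases "s' \<in> {-1..1}")
    case True
    then show ?thesis
      using mult_mono[OF bump0_le[of k s'] assms(1)[OF True]] bump0_nonneg[of k s'] by (simp add: norm_mult)
  qed (simp add: bump0_def)
  have i: "integrable lborel (\<lambda>s. c * indicator {-1..1::real} s :: real)"
    by (intro integrable_mult_right integrable_indicator_unit)
  have "cmod (\<integral>s'. ?g s' \<partial>lborel) \<le> (\<integral>s'. cmod (?g s') \<partial>lborel)" by (rule integral_norm_bound)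
  also have "\<dots> \<le> (\<integral>s. c * indicator {-1..1::real} s \<partial>lborel)"
    using le assms(2) by (intro integral_mono_AE' i) auto
  also have "\<dots> = 2 * c" by simp
  finally show ?thesis .
qed

text \<open>The leading 2 is the length of the range of \<open>s'\<close>; the rest is the constant
  of \<open>bump_transform_bound\<close>, freed of the \<open>1 / T\<close> that cancels against
  \<open>dens\<close>.\<close>

definition smooth_const :: "nat \<Rightarrow> real" where
  "smooth_const k = 2 * (2 ^ k * (1 + fact k * 5 ^ k) * sq_mass)"

lemma smooth_const_nonneg: "0 \<le> smooth_const k"
  unfolding smooth_const_def using sq_mass_nonneg by simp

lemma bump_transform_le:
  fixes D :: "complex \<Rightarrow> complex"
  assumes "1 \<le> T" "0 \<le> K" "D holomorphic_on ball 0 (2 * T + 2)"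
    "\<And>t w. \<bar>t\<bar> \<le> 2 * T \<Longrightarrow> cmod (w - of_real t) \<le> 1 \<Longrightarrow> cmod (D w) \<le> K / (jb t)\<^sup>2" "s' \<in> {-1..1}"
  shows "cmod (integral {-1..1} (\<lambda>s. of_real (bump k s) * D (of_real ((s - s') * T)) * exp (\<i> * of_real (T * (- x)) * of_real s)))
    \<le> 2 ^ k * (1 + fact k * 5 ^ k) * K * sq_mass / T / jb x ^ k" (is "cmod ?J \<le> _")
proof -
  define J where "J = ?J"
  have "jb x ^ k * cmod J \<le> 2 ^ k * (1 + fact k * 5 ^ k) * K * sq_mass / T"
    using bump_transform_bound[OF assms, of "- x" k] unfolding J_def abs_minus_cancel .
  then show ?thesis unfolding J_def[symmetric]
    by (subst pos_le_divide_eq) (auto simp: mult.commute intro: add_pos_nonneg)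
qed

text \<open>\<open>D\<close> is a holomorphic extension of the characteristic function. Its size on
  unit discs about the real segment replaces separate bounds on the first \<open>k\<close>
  derivatives.\<close>

lemma (in real_distribution) integral_kern_le:
  fixes D :: "complex \<Rightarrow> complex"
  assumes T: "1 \<le> T" and K: "0 \<le> K" and D: "D holomorphic_on ball 0 (2 * T + 2)"
    and D_le: "\<And>t w. \<bar>t\<bar> \<le> 2 * T \<Longrightarrow> cmod (w - of_real t) \<le> 1 \<Longrightarrow> cmod (D w) \<le> K / (jb t)\<^sup>2"
    and D_eq: "\<And>t. \<bar>t\<bar> \<le> 2 * T \<Longrightarrow> D (of_real t) = char M t"
  shows "dens k T M x \<le> smooth_const k * K / jb x ^ k"
proof -
  define c where "c = 2 ^ k * (1 + fact k * 5 ^ k) * K * sq_mass / T / jb x ^ k"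
  have "cmod (complex_of_real (\<integral>y. kern k (T * (y - x)) \<partial>M)) \<le> 2 * c"
    unfolding integral_kern(2)
  proof (rule norm_bump_integral_le)
    show "0 \<le> c" unfolding c_def using K T sq_mass_nonneg by simp
    fix s' :: real assume s': "s' \<in> {-1..1}"
    have "integral {-1..1} (\<lambda>s. of_real (bump k s) * char M ((s - s') * T) * exp (\<i> * of_real (T * (- x)) * of_real s)) =
        integral {-1..1} (\<lambda>s. of_real (bump k s) * D (of_real ((s - s') * T)) * exp (\<i> * of_real (T * (- x)) * of_real s))"
    proof (rule Henstock_Kurzweil_Integration.integral_cong)
      fix s :: real assume "s \<in> {-1..1}"
      then have "\<bar>(s - s') * T\<bar> \<le> 2 * T" using s' T by (auto simp: abs_mult abs_le_iff)
      then show "of_real (bump k s) * char M ((s - s') * T) * exp (\<i> * of_real (T * (- x)) * of_real s) =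
          of_real (bump k s) * D (of_real ((s - s') * T)) * exp (\<i> * of_real (T * (- x)) * of_real s)"
        by (simp only: D_eq)
    qed
    then show "cmod (integral {-1..1} (\<lambda>s. of_real (bump k s) * char M ((s - s') * T) * exp (\<i> * of_real (T * (- x)) * of_real s))) \<le> c"
      using bump_transform_le[OF T K D D_le s'] by (simp only: c_def)
  qed
  then have "(\<integral>y. kern k (T * (y - x)) \<partial>M) \<le> 2 * c" by (simp only: norm_of_real abs_le_iff)
  then have "dens k T M x \<le> T * (2 * c)" using T by (intro mult_left_mono) auto
  also have "\<dots> = smooth_const k * K / jb x ^ k" using T by (simp add: c_def smooth_const_def)
  finally show ?thesis .
qed

text \<open>The frequency representation is linear in the characteristic function, so the estimate
  applies to an extension of the difference.\<close>

lemma integral_kern_diff_le: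
  fixes D :: "complex \<Rightarrow> complex"
  assumes M1: "real_distribution M1" and M2: "real_distribution M2"
    and T: "1 \<le> T" and K: "0 \<le> K" and D: "D holomorphic_on ball 0 (2 * T + 2)"
    and D_le: "\<And>t w. \<bar>t\<bar> \<le> 2 * T \<Longrightarrow> cmod (w - of_real t) \<le> 1 \<Longrightarrow> cmod (D w) \<le> K / (jb t)\<^sup>2"
    and D_eq: "\<And>t. \<bar>t\<bar> \<le> 2 * T \<Longrightarrow> D (of_real t) = char M1 t - char M2 t"
  shows "\<bar>dens k T M1 x - dens k T M2 x\<bar> \<le> smooth_const k * K / jb x ^ k"
proof -
  interpret M1: real_distribution M1 by (rule M1)
  interpret M2: real_distribution M2 by (rule M2)
  define c where "c = 2 ^ k * (1 + fact k * 5 ^ k) * K * sq_mass / T / jb x ^ k"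
  define I where "I = (\<lambda>M s'. integral {-1..1} (\<lambda>s. of_real (bump k s) * char M ((s - s') * T) * exp (\<i> * of_real (T * (- x)) * of_real s)))"
  have "complex_of_real ((\<integral>y. kern k (T * (y - x)) \<partial>M1) - (\<integral>y. kern k (T * (y - x)) \<partial>M2)) =
      (\<integral>s'. of_real (bump0 k s') * exp (\<i> * of_real (T * x) * of_real s') * I M1 s' -
         of_real (bump0 k s') * exp (\<i> * of_real (T * x) * of_real s') * I M2 s' \<partial>lborel)"
    unfolding I_def of_real_diff M1.integral_kern(2) M2.integral_kern(2)
    by (rule Bochner_Integration.integral_diff[symmetric]) (rule M1.integral_kern M2.integral_kern)+
  also have "\<dots> = (\<integral>s'. of_real (bump0 k s') * exp (\<i> * of_real (T * x) * of_real s') * (I M1 s' - I M2 s') \<partial>lborel)"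
    by (simp add: algebra_simps)
  also have "cmod \<dots> \<le> 2 * c"
  proof (rule norm_bump_integral_le)
    show "0 \<le> c" unfolding c_def using K T sq_mass_nonneg by simp
    fix s' :: real assume s': "s' \<in> {-1..1}"
    have int: "(\<lambda>s. of_real (bump k s) * char M ((s - s') * T) * exp (\<i> * of_real (T * (- x)) * of_real s)) integrable_on {-1..1}"
      if "real_distribution M" for M
    proof -
      have "continuous_on {-1..1} (\<lambda>s. char M ((s - s') * T))"
        by (intro continuous_at_imp_continuous_on ballI isCont_o2[OF _ real_distribution.isCont_char[OF that]]) (intro continuous_intros)
      then show ?thesis unfolding bump_def by (intro integrable_continuous_interval continuous_intros)
    qed
    have "I M1 s' - I M2 s' = integral {-1..1} (\<lambda>s. of_real (bump k s) * char M1 ((s - s') * T) * exp (\<i> * of_real (T * (- x)) * of_real s)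
        - of_real (bump k s) * char M2 ((s - s') * T) * exp (\<i> * of_real (T * (- x)) * of_real s))"
      unfolding I_def by (rule Henstock_Kurzweil_Integration.integral_diff[symmetric]) (rule int M1 M2)+
    also have "\<dots> = integral {-1..1} (\<lambda>s. of_real (bump k s) * D (of_real ((s - s') * T)) * exp (\<i> * of_real (T * (- x)) * of_real s))"
    proof (rule Henstock_Kurzweil_Integration.integral_cong)
      fix s :: real assume "s \<in> {-1..1}"
      then have "\<bar>(s - s') * T\<bar> \<le> 2 * T" using s' T by (auto simp: abs_mult abs_le_iff)
      then show "of_real (bump k s) * char M1 ((s - s') * T) * exp (\<i> * of_real (T * (- x)) * of_real s) -
          of_real (bump k s) * char M2 ((s - s') * T) * exp (\<i> * of_real (T * (- x)) * of_real s) =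
          of_real (bump k s) * D (of_real ((s - s') * T)) * exp (\<i> * of_real (T * (- x)) * of_real s)"
        by (simp only: D_eq) (simp add: algebra_simps)
    qed
    finally show "cmod (I M1 s' - I M2 s') \<le> c"
      using bump_transform_le[OF T K D D_le s'] by (simp only: c_def)
  qed
  finally have "\<bar>(\<integral>y. kern k (T * (y - x)) \<partial>M1) - (\<integral>y. kern k (T * (y - x)) \<partial>M2)\<bar> \<le> 2 * c"
    by (simp only: norm_of_real)
  then have "T * \<bar>(\<integral>y. kern k (T * (y - x)) \<partial>M1) - (\<integral>y. kern k (T * (y - x)) \<partial>M2)\<bar> \<le> T * (2 * c)"
    using T by (intro mult_left_mono) auto
  moreover have "T * \<bar>(\<integral>y. kern k (T * (y - x)) \<partial>M1) - (\<integral>y. kern k (T * (y - x)) \<partial>M2)\<bar> =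
      \<bar>dens k T M1 x - dens k T M2 x\<bar>"
    using T by (simp add: abs_mult right_diff_distrib[symmetric])
  moreover have "T * (2 * c) = smooth_const k * K / jb x ^ k" using T by (simp add: c_def smooth_const_def)
  ultimately show ?thesis by simp
qed

section \<open>The cost of smoothing\<close>

text \<open>An inequality of Peetre type: it moves a polynomial weight from \<open>x + s\<close> to
  \<open>x\<close> at the cost of the same power of \<open>1 + \<bar>s\<bar>\<close>.\<close>

lemma one_plus_abs_shift: "1 + \<bar>x\<bar> \<le> jb (x + s) * jb s" for x s :: real
proof -
  have "\<bar>x\<bar> \<le> \<bar>x + s\<bar> + \<bar>s\<bar>" by arith
  moreover have "0 \<le> \<bar>x + s\<bar> * \<bar>s\<bar>" by simp
  moreover have "jb (x + s) * jb s = 1 + \<bar>x + s\<bar> + \<bar>s\<bar> + \<bar>x + s\<bar> * \<bar>s\<bar>"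
    unfolding distrib_left distrib_right by simp
  ultimately show ?thesis by linarith
qed

context
  fixes m k :: nat and C c :: real
  assumes k: "k = m + 2" and C: "0 \<le> C" "\<And>y. kern k y \<le> C / jb y ^ (2 * k)"
    and c: "0 < c" "\<And>y. \<bar>y\<bar> \<le> 1 \<Longrightarrow> c \<le> kern k y"
begin

text \<open>The exponent \<open>2 * k\<close> is split as \<open>k + 2 + m\<close>: \<open>k\<close>
  powers for decay of tails, two for integrability, and the last \<open>m\<close> are
  dropped.\<close>

lemma kern_le_split: "kern k y \<le> C / jb y ^ k * (1 / (jb y)\<^sup>2)"
proof -
  have "kern k y \<le> C / jb y ^ (k + (2 + m))" using C(2)[of y] by (simp add: k mult_2)
  also have "\<dots> = C / jb y ^ k * (1 / (jb y)\<^sup>2) / jb y ^ m"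
    unfolding power_add by simp
  also have "\<dots> \<le> C / jb y ^ k * (1 / (jb y)\<^sup>2) / 1"
    using C(1) by (intro divide_left_mono) (auto intro!: one_le_power add_pos_nonneg)
  finally show ?thesis by simp
qed

lemma kern_integrable: "integrable lborel (kern k)"
proof (rule Bochner_Integration.integrable_bound[OF integrable_mult_right[OF integrable_inverse_1_plus_abs_square, of C]])
  have "kern k y \<le> C * (1 / (jb y)\<^sup>2)" for y
  proof -
    have "C / jb y ^ k * (1 / (jb y)\<^sup>2) \<le> C / 1 * (1 / (jb y)\<^sup>2)"
      using C(1) by (intro mult_right_mono divide_left_mono) (auto intro!: one_le_power add_pos_nonneg)
    then show ?thesis using kern_le_split[of y] by simp
  qed
  then show "AE y in lborel. norm (kern k y) \<le> norm (C * (1 / (jb y)\<^sup>2))"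
    using kern_nonneg[of k] C(1) by simp
qed measurable

lemma kern_le_C: "kern k y \<le> C"
proof -
  have "C / jb y ^ (2 * k) \<le> C / 1" using C(1) by (intro divide_left_mono) (auto intro!: one_le_power add_pos_nonneg)
  then show ?thesis using C(2)[of y] by simp
qed

definition kmass :: real where "kmass = (\<integral>w. kern k w \<partial>lborel)"

text \<open>The \<open>k\<close> powers are frozen at the edge \<open>v\<close>, and the two
  remaining ones are integrated.\<close>

lemma kern_tail:
  assumes A [measurable]: "A \<in> sets borel" and v: "\<And>w. w \<in> A \<Longrightarrow> \<bar>v\<bar> \<le> \<bar>w\<bar>"
  shows "(\<integral>w. indicator A w * kern k w \<partial>lborel) \<le> C * sq_mass / jb v ^ k"
proof -
  have "(\<integral>w. indicator A w * kern k w \<partial>lborel) \<le> (\<integral>w. C / jb v ^ k * (1 / (jb w)\<^sup>2) \<partial>lborel)"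
  proof (rule integral_mono)
    show "integrable lborel (\<lambda>w. indicator A w * kern k w)"
      using integrable_mult_indicator[OF _ kern_integrable, of A] by simp
    show "integrable lborel (\<lambda>w. C / jb v ^ k * (1 / (jb w)\<^sup>2))"
      by (rule integrable_mult_right[OF integrable_inverse_1_plus_abs_square])
    show "indicator A w * kern k w \<le> C / jb v ^ k * (1 / (jb w)\<^sup>2)" for w
    proof (cases "w \<in> A")
      case True
      have "C / jb w ^ k \<le> C / jb v ^ k"
        using C(1) v[OF True] by (intro divide_left_mono power_mono) (auto intro!: mult_pos_pos zero_less_power add_pos_nonneg)
      then have "C / jb w ^ k * (1 / (jb w)\<^sup>2) \<le> C / jb v ^ k * (1 / (jb w)\<^sup>2)"
        by (intro mult_right_mono) auto
      then show ?thesis using True kern_le_split[of w] by simp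
    qed (use C(1) in auto)
  qed
  also have "\<dots> = C / jb v ^ k * sq_mass" unfolding sq_mass_def by (rule integral_mult_right_zero)
  finally show ?thesis by simp
qed

lemma kmass_pos: "0 < kmass"
proof -
  have "(\<integral>w. c * indicator {-1..1::real} w \<partial>lborel) \<le> kmass"
    unfolding kmass_def
  proof (rule integral_mono)
    show "integrable lborel (kern k)" by (rule kern_integrable)
    show "integrable lborel (\<lambda>w. c * indicator {-1..1::real} w)"
      by (intro integrable_mult_right integrable_indicator_unit)
    show "c * indicator {-1..1} w \<le> kern k w" for w
      using c(2)[of w] kern_nonneg[of k w] by (auto simp: indicator_def abs_le_iff)
  qed
  then show ?thesis using c(1) by simp
qed

text \<open>
  Through this inequality a bound on the smoothed density controls how much mass the unsmoothed
  measure puts near a point at scale \<open>1 / T\<close>.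
\<close>

lemma inverse_power_le_convolution:
  "c / 2 ^ k / jb v ^ k \<le> (\<integral>s. 1 / jb s ^ k * kern k (v - s) \<partial>lborel)"
  "integrable lborel (\<lambda>s. 1 / jb s ^ k * kern k (v - s))"
proof -
  have ki: "integrable lborel (\<lambda>s. kern k (v - s))"
    using lborel_integrable_real_affine[OF kern_integrable, of "-1" v] by simp
  show i: "integrable lborel (\<lambda>s. 1 / jb s ^ k * kern k (v - s))"
  proof (rule Bochner_Integration.integrable_bound[OF ki])
    have "1 / jb s ^ k * kern k (v - s) \<le> 1 * kern k (v - s)" for s
      by (intro mult_right_mono kern_nonneg) (auto simp: divide_le_eq_1 intro!: one_le_power)
    then show "AE s in lborel. norm (1 / jb s ^ k * kern k (v - s)) \<le> norm (kern k (v - s))"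
      using kern_nonneg[of k] by (simp add: abs_mult)
  qed measurable
  \<comment> \<open>Restrict to the points within 1 of \<open>v\<close>: there the kernel is at
    least \<open>c\<close>, and \<open>1 + \<bar>s\<bar> \<le> 2 * (1 + \<bar>v\<bar>)\<close>
    yields \<open>2 ^ k\<close>. The length 2 of the interval is given away.\<close>
  have "c / 2 ^ k / jb v ^ k * 1 \<le> c / 2 ^ k / jb v ^ k * 2"
    using c by (intro mult_left_mono) auto
  also have "\<dots> = (\<integral>s. c / 2 ^ k / jb v ^ k * indicator {v - 1..v + 1} s \<partial>lborel)" by simp
  also have "\<dots> \<le> (\<integral>s. 1 / jb s ^ k * kern k (v - s) \<partial>lborel)"
  proof (rule integral_mono[OF _ i])
    show "integrable lborel (\<lambda>s. c / 2 ^ k / jb v ^ k * indicator {v - 1..v + 1} s)"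
      by (intro integrable_mult_right) (simp add: integrable_indicator_iff)
    fix s
    show "c / 2 ^ k / jb v ^ k * indicator {v - 1..v + 1} s \<le> 1 / jb s ^ k * kern k (v - s)"
    proof (cases "s \<in> {v - 1..v + 1}")
      case True
      then have "\<bar>v - s\<bar> \<le> 1" by auto
      then have "jb s ^ k \<le> (2 * jb v) ^ k" by (intro power_mono) auto
      then have "jb s ^ k \<le> 2 ^ k * jb v ^ k" unfolding power_mult_distrib .
      then have "1 / (2 ^ k * jb v ^ k) \<le> 1 / jb s ^ k"
        by (intro divide_left_mono) (auto intro!: mult_pos_pos zero_less_power add_pos_nonneg)
      then have "1 / (2 ^ k * jb v ^ k) * c \<le> 1 / jb s ^ k * kern k (v - s)"
        using c \<open>\<bar>v - s\<bar> \<le> 1\<close> by (intro mult_mono) auto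
      then show ?thesis using True by simp
    qed (simp add: kern_nonneg)
  qed
  finally show "c / 2 ^ k / jb v ^ k \<le> (\<integral>s. 1 / jb s ^ k * kern k (v - s) \<partial>lborel)" by simp
qed

section \<open>Mass near a point and the smoothing error\<close>

context
  fixes M :: "real measure" and T P :: real
  assumes M: "real_distribution M" and T: "1 \<le> T" and P: "0 \<le> P"
    and p_le: "\<And>x. dens k T M x \<le> P / jb x ^ m"
begin

interpretation M: real_distribution M by (rule M)

text \<open>\<open>inverse_power_le_convolution\<close> at \<open>v = T * (y - x)\<close> turns the
  expectation into an integral of smoothed densities at the points \<open>x + s / T\<close>. Moving
  the weight back to \<open>x\<close> costs \<open>(1 + \<bar>s\<bar>) ^ m\<close>, and
  \<open>k = m + 2\<close> leaves an integrable inverse square in \<open>s\<close>.\<close>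

lemma expectation_inverse_power_le:
  "(\<integral>y. 1 / jb (T * (y - x)) ^ k \<partial>M) \<le> 2 ^ k / c * sq_mass * P / (T * jb x ^ m)"
proof -
  let ?f = "\<lambda>y s. 1 / jb s ^ k * kern k (T * (y - x) - s)"
  have fm: "(\<lambda>(y, s). ?f y s) \<in> borel_measurable (borel \<Otimes>\<^sub>M borel)" by measurable
  have le: "(\<integral>s. norm (?f y s) \<partial>lborel) \<le> C * sq_mass" for y
  proof -
    have "(\<integral>s. norm (?f y s) \<partial>lborel) \<le> (\<integral>s. C * (1 / (jb s)\<^sup>2) \<partial>lborel)"
    proof (rule integral_mono)
      show "integrable lborel (\<lambda>s. C * (1 / (jb s)\<^sup>2))"
        by (rule integrable_mult_right[OF integrable_inverse_1_plus_abs_square])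
      fix s :: real
      have "(jb s)\<^sup>2 \<le> jb s ^ k" by (intro power_increasing) (auto simp: k)
      then have "1 / jb s ^ k \<le> 1 / (jb s)\<^sup>2"
        by (intro divide_left_mono) (auto intro!: mult_pos_pos zero_less_power add_pos_nonneg)
      then have "1 / jb s ^ k * kern k (T * (y - x) - s) \<le> 1 / (jb s)\<^sup>2 * C"
        by (intro mult_mono kern_le_C kern_nonneg) auto
      then show "norm (?f y s) \<le> C * (1 / (jb s)\<^sup>2)"
        using kern_nonneg[of k "T * (y - x) - s"] by (simp add: abs_mult)
    qed (intro integrable_norm inverse_power_le_convolution)
    also have "\<dots> = C * sq_mass" unfolding sq_mass_def by (rule integral_mult_right_zero)
    finally show ?thesis .
  qed
  note fub = M.fubini_lborel[OF fm inverse_power_le_convolution(2) le]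
  have fbd: "(\<integral>s. ?f y s \<partial>lborel) \<le> C * sq_mass" for y
    using le[of y] kern_nonneg[of k] by (simp add: abs_mult)
  have "(\<integral>y. c / 2 ^ k * (1 / jb (T * (y - x)) ^ k) \<partial>M) \<le> (\<integral>y. (\<integral>s. ?f y s \<partial>lborel) \<partial>M)"
  proof (rule integral_mono)
    show "integrable M (\<lambda>y. c / 2 ^ k * (1 / jb (T * (y - x)) ^ k))"
      using c by (intro M.integrable_const_bound[where B = "c / 2 ^ k"])
        (auto simp: divide_simps intro!: one_le_power mult_left_mono)
    have "(\<lambda>y. \<integral>s. ?f y s \<partial>lborel) \<in> borel_measurable borel" by measurable
    then show "integrable M (\<lambda>y. \<integral>s. ?f y s \<partial>lborel)"
      using fbd kern_nonneg[of k]
      by (intro M.integrable_const_bound[where B = "C * sq_mass"]) (auto intro!: AE_I2 simp: integral_nonneg_AE abs_of_nonneg)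
    show "c / 2 ^ k * (1 / jb (T * (y - x)) ^ k) \<le> (\<integral>s. ?f y s \<partial>lborel)" for y
      using inverse_power_le_convolution(1)[of "T * (y - x)"] by simp
  qed
  also have "\<dots> = (\<integral>s. (\<integral>y. ?f y s \<partial>M) \<partial>lborel)" by (rule fub(2))
  also have "\<dots> \<le> (\<integral>s. P / T / jb x ^ m * (1 / (jb s)\<^sup>2) \<partial>lborel)"
  proof (rule integral_mono[OF fub(1) integrable_mult_right[OF integrable_inverse_1_plus_abs_square]])
    fix s :: real
    have eq: "T * (y - x) - s = T * (y - (x + s / T))" for y using T by (simp add: field_simps)
    have "(\<integral>y. ?f y s \<partial>M) = 1 / jb s ^ k * (\<integral>y. kern k (T * (y - (x + s / T))) \<partial>M)"
      unfolding eq by (rule integral_mult_right_zero)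
    also have "\<dots> \<le> 1 / jb s ^ k * (P / T / jb (x + s / T) ^ m)"
      using p_le[of "x + s / T"] T by (intro mult_left_mono) (auto simp: field_simps)
    also have "\<dots> \<le> 1 / jb s ^ k * (P / T * (jb s ^ m / jb x ^ m))"
    proof -
      have "1 + \<bar>x\<bar> \<le> jb (x + s / T) * jb (s / T)" by (rule one_plus_abs_shift)
      also have "\<dots> \<le> jb (x + s / T) * jb s"
        using T by (intro mult_left_mono add_left_mono) (auto simp: divide_le_eq mult_le_cancel_left1)
      finally have "jb x ^ m \<le> (jb (x + s / T) * jb s) ^ m" by (intro power_mono) auto
      then have "1 / jb (x + s / T) ^ m \<le> jb s ^ m / jb x ^ m"
        by (simp add: divide_simps power_mult_distrib mult.commute add_nonneg_eq_0_iff)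
      then have "P / T * (1 / jb (x + s / T) ^ m) \<le> P / T * (jb s ^ m / jb x ^ m)"
        using P T by (intro mult_left_mono) auto
      then show ?thesis by (intro mult_left_mono) auto
    qed
    also have "\<dots> = P / T / jb x ^ m * (jb s ^ m / jb s ^ k)" by simp
    also have "jb s ^ m / jb s ^ k = 1 / (jb s)\<^sup>2"
      by (simp add: k power_add add_nonneg_eq_0_iff power2_eq_square)
    finally show "(\<integral>y. ?f y s \<partial>M) \<le> P / T / jb x ^ m * (1 / (jb s)\<^sup>2)" .
  qed
  also have "\<dots> = P / T / jb x ^ m * sq_mass" unfolding sq_mass_def by (rule integral_mult_right_zero)
  finally have "c / 2 ^ k * (\<integral>y. 1 / jb (T * (y - x)) ^ k \<partial>M) \<le> P / T / jb x ^ m * sq_mass"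
    by (simp only: integral_mult_right_zero)
  then have "2 ^ k / c * (c / 2 ^ k * (\<integral>y. 1 / jb (T * (y - x)) ^ k \<partial>M)) \<le> 2 ^ k / c * (P / T / jb x ^ m * sq_mass)"
    using c by (intro mult_left_mono) auto
  moreover have "2 ^ k / c * (P / T / jb x ^ m * sq_mass) = 2 ^ k / c * sq_mass * P / (T * jb x ^ m)" by simp
  moreover have "2 ^ k / c * (c / 2 ^ k * z) = z" for z using c by simp
  ultimately show ?thesis by (simp only:)
qed

text \<open>Smoothing the indicator of a half-line errs at \<open>y\<close> only by the kernel mass
  beyond distance \<open>T * \<bar>y - x\<bar>\<close>, and the expectation of that mass has just
  been bounded. The whole line is included so that total masses can be compared as well.\<close>

lemma smoothing_error:
  assumes A: "A = {x<..} \<or> A = UNIV"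
  shows "integrable lborel (\<lambda>u. indicator A u * (dens k T M u))"
    and "\<bar>kmass * measure M A - (\<integral>u. indicator A u * (dens k T M u) \<partial>lborel)\<bar>
      \<le> C * 2 ^ k / c * sq_mass\<^sup>2 * P / (T * jb x ^ m)"
proof -
  have Am [measurable]: "A \<in> sets borel" using A by auto
  let ?f = "\<lambda>y u. indicator A u * (T * kern k (T * (y - u)))"
  \<comment> \<open>The set \<open>A\<close> seen in the kernel variable
    \<open>w = T * (y - u)\<close>.\<close>
  let ?A' = "\<lambda>y. (\<lambda>w. y - w / T) -` A"
  have fm: "(\<lambda>(y, u). ?f y u) \<in> borel_measurable (borel \<Otimes>\<^sub>M borel)" by measurable
  have A'm [measurable]: "?A' y \<in> sets borel" for y
  proof -
    have "(\<lambda>w. y - w / T) \<in> borel_measurable borel" by measurable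
    from measurable_sets[OF this Am] show ?thesis by simp
  qed
  have g_int: "integrable lborel (\<lambda>w. indicator (?A' y) w * kern k w)" for y
    using integrable_mult_indicator[OF _ kern_integrable, of "?A' y"] by simp
  have aff1: "T * y + (- T) * u = T * (y - u)" for y u by (simp add: right_diff_distrib)
  have aff2: "y - (T * (y - u)) / T = u" for y u using T by simp
  have f_eq: "?f y u = T * (indicator (?A' y) (T * y + (- T) * u) * kern k (T * y + (- T) * u))" for y u
    unfolding aff1 by (simp add: aff2 indicator_def)
  have f_int: "integrable lborel (?f y)" for y
    unfolding f_eq using T lborel_integrable_real_affine[OF g_int[of y], of "- T" "T * y"]
    by (intro integrable_mult_right) auto
  have f_val: "(\<integral>u. ?f y u \<partial>lborel) = (\<integral>w. indicator (?A' y) w * kern k w \<partial>lborel)" for y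
    unfolding f_eq using T
    by (subst lborel_integral_real_affine[where c = "- T" and t = "T * y" and f = "\<lambda>w. indicator (?A' y) w * kern k w"]) auto
  have g_le: "(\<integral>w. indicator (?A' y) w * kern k w \<partial>lborel) \<le> kmass" for y
    unfolding kmass_def by (intro integral_mono g_int kern_integrable) (auto simp: indicator_def kern_nonneg)
  have f_le: "(\<integral>u. norm (?f y u) \<partial>lborel) \<le> kmass" for y
  proof -
    have "norm (?f y u) = ?f y u" for u using T kern_nonneg[of k] by (simp add: abs_mult)
    then show ?thesis using f_val[of y] g_le[of y] by simp
  qed
  note fub = M.fubini_lborel[OF fm f_int f_le]
  have inner: "(\<integral>y. ?f y u \<partial>M) = indicator A u * (dens k T M u)" for u by simp
  show "integrable lborel (\<lambda>u. indicator A u * (dens k T M u))"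
    using fub(1) by simp
  have swap: "(\<integral>u. indicator A u * (dens k T M u) \<partial>lborel) = (\<integral>y. (\<integral>w. indicator (?A' y) w * kern k w \<partial>lborel) \<partial>M)"
    using fub(2) by (simp add: f_val)
  have point: "\<bar>kmass * indicator A y - (\<integral>w. indicator (?A' y) w * kern k w \<partial>lborel)\<bar> \<le> C * sq_mass * (1 / jb (T * (y - x)) ^ k)" for y
  proof -
    have nn: "0 \<le> (\<integral>w. indicator B w * kern k w \<partial>lborel)" for B
      by (intro integral_nonneg_AE) (auto simp: kern_nonneg)
    show ?thesis
    proof (cases "y \<in> A")
      case True
      have "kmass = (\<integral>w. indicator (?A' y) w * kern k w + indicator (- ?A' y) w * kern k w \<partial>lborel)"
        unfolding kmass_def by (intro Bochner_Integration.integral_cong) (auto simp: indicator_def)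
      also have "\<dots> = (\<integral>w. indicator (?A' y) w * kern k w \<partial>lborel) + (\<integral>w. indicator (- ?A' y) w * kern k w \<partial>lborel)"
      proof (rule Bochner_Integration.integral_add[OF g_int])
        show "integrable lborel (\<lambda>w. indicator (- ?A' y) w * kern k w)"
          using integrable_mult_indicator[OF _ kern_integrable, of "- ?A' y"] by simp
      qed
      finally have "kmass * indicator A y - (\<integral>w. indicator (?A' y) w * kern k w \<partial>lborel) = (\<integral>w. indicator (- ?A' y) w * kern k w \<partial>lborel)"
        using True by simp
      moreover have "(\<integral>w. indicator (- ?A' y) w * kern k w \<partial>lborel) \<le> C * sq_mass / jb (T * (y - x)) ^ k"
      proof (rule kern_tail)
        fix w assume w: "w \<in> - ?A' y"
        then have Ax: "A = {x<..}" using A by auto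
        with w True have "y - w / T \<le> x" "x < y" by auto
        then have "T * (y - x) \<le> w" "0 \<le> T * (y - x)" using T by (auto simp: field_simps)
        then show "\<bar>T * (y - x)\<bar> \<le> \<bar>w\<bar>" by simp
      qed simp
      ultimately show ?thesis using nn[of "- ?A' y"] by simp
    next
      case False
      have "(\<integral>w. indicator (?A' y) w * kern k w \<partial>lborel) \<le> C * sq_mass / jb (T * (y - x)) ^ k"
      proof (rule kern_tail)
        fix w assume w: "w \<in> ?A' y"
        have Ax: "A = {x<..}" using A False by auto
        with w False have "x < y - w / T" "y \<le> x" by auto
        then have "w \<le> T * (y - x)" "T * (y - x) \<le> 0" using T by (auto simp: field_simps mult_le_0_iff)
        then show "\<bar>T * (y - x)\<bar> \<le> \<bar>w\<bar>" by simp
      qed simp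
      then show ?thesis using nn[of "?A' y"] False by simp
    qed
  qed
  have gi: "integrable M (\<lambda>y. \<integral>w. indicator (?A' y) w * kern k w \<partial>lborel)"
  proof (rule M.integrable_const_bound[where B = kmass])
    have "(\<lambda>y. \<integral>u. ?f y u \<partial>lborel) \<in> borel_measurable borel" by measurable
    then show "(\<lambda>y. \<integral>w. indicator (?A' y) w * kern k w \<partial>lborel) \<in> borel_measurable M" by (simp add: f_val)
    have "0 \<le> (\<integral>w. indicator B w * kern k w \<partial>lborel)" for B
      by (intro integral_nonneg_AE) (auto simp: kern_nonneg)
    then show "AE y in M. norm (\<integral>w. indicator (?A' y) w * kern k w \<partial>lborel) \<le> kmass" using g_le by simp
  qed
  have ii: "integrable M (\<lambda>y. kmass * indicator A y)" by (simp add: M.emeasure_finite less_top[symmetric])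
  have "kmass * measure M A = (\<integral>y. kmass * indicator A y \<partial>M)" by simp
  then have "kmass * measure M A - (\<integral>u. indicator A u * (dens k T M u) \<partial>lborel) =
      (\<integral>y. kmass * indicator A y - (\<integral>w. indicator (?A' y) w * kern k w \<partial>lborel) \<partial>M)"
    unfolding swap by (simp only: Bochner_Integration.integral_diff[OF ii gi])
  also have "\<bar>\<dots>\<bar> \<le> (\<integral>y. \<bar>kmass * indicator A y - (\<integral>w. indicator (?A' y) w * kern k w \<partial>lborel)\<bar> \<partial>M)"
    by (rule integral_abs_bound)
  also have "\<dots> \<le> (\<integral>y. C * sq_mass * (1 / jb (T * (y - x)) ^ k) \<partial>M)"
  proof (rule integral_mono[OF _ _ point])
    show "integrable M (\<lambda>y. \<bar>kmass * indicator A y - (\<integral>w. indicator (?A' y) w * kern k w \<partial>lborel)\<bar>)"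
      by (intro integrable_abs Bochner_Integration.integrable_diff ii gi)
    show "integrable M (\<lambda>y. C * sq_mass * (1 / jb (T * (y - x)) ^ k))"
      by (intro integrable_mult_right M.integrable_const_bound[where B = 1]) (auto simp: divide_le_eq_1 intro!: one_le_power)
  qed
  also have "\<dots> = C * sq_mass * (\<integral>y. 1 / jb (T * (y - x)) ^ k \<partial>M)" by (rule integral_mult_right_zero)
  also have "\<dots> \<le> C * sq_mass * (2 ^ k / c * sq_mass * P / (T * jb x ^ m))"
    using C(1) sq_mass_nonneg by (intro mult_left_mono expectation_inverse_power_le) auto
  also have "\<dots> = C * 2 ^ k / c * sq_mass\<^sup>2 * P / (T * jb x ^ m)" by (simp add: power2_eq_square)
  finally show "\<bar>kmass * measure M A - (\<integral>u. indicator A u * (dens k T M u) \<partial>lborel)\<bar>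
      \<le> C * 2 ^ k / c * sq_mass\<^sup>2 * P / (T * jb x ^ m)" .
qed

end

section \<open>Comparison of two distributions\<close>

lemma tail_compare:
  assumes M: "real_distribution M1" "real_distribution M2" and T: "1 \<le> T" and P: "0 \<le> P" and Q: "0 \<le> Q"
    and p1: "\<And>x. dens k T M1 x \<le> P / jb x ^ m"
    and p2: "\<And>x. dens k T M2 x \<le> P / jb x ^ m"
    and p12: "\<And>x. \<bar>dens k T M1 x - dens k T M2 x\<bar> \<le> Q / jb x ^ k"
  shows "\<bar>measure M1 {x<..} - measure M2 {x<..}\<bar> \<le>
    (4 * (C * 2 ^ k / c * sq_mass\<^sup>2) + sq_mass) / kmass * (P / T + Q) / jb x ^ m"
proof -
  define d1 where "d1 = (\<lambda>u. dens k T M1 u)"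
  define d2 where "d2 = (\<lambda>u. dens k T M2 u)"
  define R where "R = C * 2 ^ k / c * sq_mass\<^sup>2"
  define E where "E = R * P / (T * jb x ^ m)"
  have R: "0 \<le> R" unfolding R_def using C c by simp
  have s1: "integrable lborel (\<lambda>u. indicator A u * d1 u)"
      "\<bar>kmass * measure M1 A - (\<integral>u. indicator A u * d1 u \<partial>lborel)\<bar> \<le> E" if "A = {x<..} \<or> A = UNIV" for A
    using smoothing_error[OF M(1) T P p1 that] unfolding d1_def E_def R_def .
  have s2: "integrable lborel (\<lambda>u. indicator A u * d2 u)"
      "\<bar>kmass * measure M2 A - (\<integral>u. indicator A u * d2 u \<partial>lborel)\<bar> \<le> E" if "A = {x<..} \<or> A = UNIV" for A
    using smoothing_error[OF M(2) T P p2 that] unfolding d2_def E_def R_def .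
  have int: "integrable lborel (\<lambda>u. indicator A u * (d1 u - d2 u))" if "A = {x<..} \<or> A = UNIV" for A
    unfolding right_diff_distrib by (intro Bochner_Integration.integrable_diff s1(1) s2(1) that)
  have diff: "\<bar>kmass * measure M1 A - kmass * measure M2 A - (\<integral>u. indicator A u * (d1 u - d2 u) \<partial>lborel)\<bar> \<le> 2 * E"
    if "A = {x<..} \<or> A = UNIV" for A
  proof -
    have "(\<integral>u. indicator A u * (d1 u - d2 u) \<partial>lborel) = (\<integral>u. indicator A u * d1 u \<partial>lborel) - (\<integral>u. indicator A u * d2 u \<partial>lborel)"
      unfolding right_diff_distrib by (rule Bochner_Integration.integral_diff[OF s1(1)[OF that] s2(1)[OF that]])
    then show ?thesis using s1(2)[OF that] s2(2)[OF that] by linarith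
  qed
  \<comment> \<open>The difference of densities decays with \<open>k = m + 2\<close> powers:
    \<open>m\<close> are frozen at \<open>x\<close>, two are integrated.\<close>
  have tail: "\<bar>\<integral>u. indicator A u * (d1 u - d2 u) \<partial>lborel\<bar> \<le> Q * sq_mass / jb x ^ m"
    if A: "\<And>u. u \<in> A \<Longrightarrow> \<bar>x\<bar> \<le> \<bar>u\<bar>" for A
  proof -
    have "\<bar>\<integral>u. indicator A u * (d1 u - d2 u) \<partial>lborel\<bar> \<le> (\<integral>u. \<bar>indicator A u * (d1 u - d2 u)\<bar> \<partial>lborel)"
      by (rule integral_abs_bound)
    also have "\<dots> \<le> (\<integral>u. Q / jb x ^ m * (1 / (jb u)\<^sup>2) \<partial>lborel)"
    proof (rule integral_mono_AE')
      show "integrable lborel (\<lambda>u. Q / jb x ^ m * (1 / (jb u)\<^sup>2))"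
        by (rule integrable_mult_right[OF integrable_inverse_1_plus_abs_square])
      have "\<bar>indicator A u * (d1 u - d2 u)\<bar> \<le> Q / jb x ^ m * (1 / (jb u)\<^sup>2)" for u
      proof (cases "u \<in> A")
        case True
        have "\<bar>d1 u - d2 u\<bar> \<le> Q / jb u ^ m * (1 / (jb u)\<^sup>2)"
        proof -
          have "Q / jb u ^ k = Q / jb u ^ m * (1 / (jb u)\<^sup>2)"
            unfolding k power_add by simp
          then show ?thesis using p12[of u] by (simp only: d1_def d2_def)
        qed
        also have "\<dots> \<le> Q / jb x ^ m * (1 / (jb u)\<^sup>2)"
          using Q A[OF True]
          by (intro mult_right_mono divide_left_mono power_mono) (auto intro!: mult_pos_pos zero_less_power add_pos_nonneg)
        finally show ?thesis using True by simp
      qed (use Q in simp)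
      then show "AE u in lborel. \<bar>indicator A u * (d1 u - d2 u)\<bar> \<le> Q / jb x ^ m * (1 / (jb u)\<^sup>2)" by simp
    qed (use Q in simp)
    also have "\<dots> = Q / jb x ^ m * sq_mass" unfolding sq_mass_def by (rule integral_mult_right_zero)
    finally show ?thesis by simp
  qed
  \<comment> \<open>For negative \<open>x\<close> the half-line contains the origin and shows no
    decay. The complement is used instead; the total masses of the smoothed measures differ by at
    most \<open>2 * E\<close>, which accounts for \<open>4 * E\<close> below.\<close>
  have half: "\<bar>\<integral>u. indicator {x<..} u * (d1 u - d2 u) \<partial>lborel\<bar> \<le> 2 * E + Q * sq_mass / jb x ^ m"
  proof (cases "0 \<le> x")
    case True
    have "0 \<le> E" unfolding E_def using R P T by simp
    then show ?thesis using tail[of "{x<..}"] True by auto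
  next
    case False
    have "(\<integral>u. indicator {..x} u * (d1 u - d2 u) \<partial>lborel) =
        (\<integral>u. indicator UNIV u * (d1 u - d2 u) - indicator {x<..} u * (d1 u - d2 u) \<partial>lborel)"
      by (intro Bochner_Integration.integral_cong) (auto simp: indicator_def)
    also have "\<dots> = (\<integral>u. indicator UNIV u * (d1 u - d2 u) \<partial>lborel) - (\<integral>u. indicator {x<..} u * (d1 u - d2 u) \<partial>lborel)"
      by (intro Bochner_Integration.integral_diff int) auto
    finally have eq: "(\<integral>u. indicator {x<..} u * (d1 u - d2 u) \<partial>lborel) =
        (\<integral>u. indicator UNIV u * (d1 u - d2 u) \<partial>lborel) - (\<integral>u. indicator {..x} u * (d1 u - d2 u) \<partial>lborel)" by linarith
    have "measure M1 UNIV = 1" "measure M2 UNIV = 1"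
      using M prob_space.prob_space[of M1] prob_space.prob_space[of M2]
      by (auto simp: real_distribution_def real_distribution_axioms_def dest: sets_eq_imp_space_eq)
    then have "\<bar>\<integral>u. indicator UNIV u * (d1 u - d2 u) \<partial>lborel\<bar> \<le> 2 * E" using diff[of UNIV] by simp
    moreover have "\<bar>\<integral>u. indicator {..x} u * (d1 u - d2 u) \<partial>lborel\<bar> \<le> Q * sq_mass / jb x ^ m"
      using False by (intro tail) auto
    ultimately show ?thesis unfolding eq by linarith
  qed
  have "\<bar>kmass * measure M1 {x<..} - kmass * measure M2 {x<..}\<bar> \<le> 4 * E + Q * sq_mass / jb x ^ m"
    using diff[of "{x<..}"] half by auto
  also have "4 * E + Q * sq_mass / jb x ^ m = (4 * R * (P / T) + sq_mass * Q) / jb x ^ m"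
    by (simp add: E_def add_divide_distrib mult_ac)
  also have "\<dots> \<le> (4 * R + sq_mass) * (P / T + Q) / jb x ^ m"
  proof (rule divide_right_mono)
    have "0 \<le> 4 * R * Q" "0 \<le> sq_mass * (P / T)" using R P Q T sq_mass_nonneg by auto
    then show "4 * R * (P / T) + sq_mass * Q \<le> (4 * R + sq_mass) * (P / T + Q)"
      unfolding distrib_left distrib_right by linarith
  qed simp
  finally have "kmass * \<bar>measure M1 {x<..} - measure M2 {x<..}\<bar> \<le> (4 * R + sq_mass) * (P / T + Q) / jb x ^ m"
    using kmass_pos by (simp add: abs_mult right_diff_distrib[symmetric])
  then have "\<bar>measure M1 {x<..} - measure M2 {x<..}\<bar> \<le> (4 * R + sq_mass) * (P / T + Q) / jb x ^ m / kmass"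
    using kmass_pos by (subst pos_le_divide_eq) (simp_all only: mult.commute)
  then show ?thesis by (simp add: R_def mult_ac)
qed

end

text \<open>The kernel constants are fixed by \<open>m\<close> alone, so one \<open>K\<close> serves
  all pairs of distributions and all scales \<open>T\<close>.\<close>

lemma tail_comparison:
  fixes m :: nat
  obtains K where "0 \<le> K"
    "\<And>M1 M2 T P Q x. real_distribution M1 \<Longrightarrow> real_distribution M2 \<Longrightarrow> 1 \<le> T \<Longrightarrow> 0 \<le> P \<Longrightarrow> 0 \<le> Q \<Longrightarrow>
      (\<And>x. dens (m + 2) T M1 x \<le> P / jb x ^ m) \<Longrightarrow>
      (\<And>x. dens (m + 2) T M2 x \<le> P / jb x ^ m) \<Longrightarrow>
      (\<And>x. \<bar>dens (m + 2) T M1 x - dens (m + 2) T M2 x\<bar>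
        \<le> Q / jb x ^ (m + 2)) \<Longrightarrow>
      \<bar>measure M1 {x<..} - measure M2 {x<..}\<bar> \<le> K * (P / T + Q) / jb x ^ m"
proof -
  obtain C where C: "0 \<le> C" "\<And>y. kern (m + 2) y \<le> C / jb y ^ (2 * (m + 2))" using kern_decay[of "m + 2"] by blast
  obtain c where c: "0 < c" "\<And>y. \<bar>y\<bar> \<le> 1 \<Longrightarrow> c \<le> kern (m + 2) y" using kern_pos[of "m + 2"] by blast
  let ?K = "(4 * (C * 2 ^ (m + 2) / c * sq_mass\<^sup>2) + sq_mass) / kmass (m + 2)"
  show ?thesis
  proof (rule that[of ?K])
    show "0 \<le> ?K" using C c kmass_pos[OF refl C c] sq_mass_nonneg by simp
  qed (rule tail_compare[OF refl C c])
qed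

section \<open>Nonuniform Berry--Esseen bound\<close>

text \<open>The inequality \<open>x \<le> exp x\<close> at \<open>x = u ^ 2 / 48\<close>, cubed;
  \<open>110592 = 48 ^ 3\<close>.\<close>

lemma exp_minus_square_le:
  fixes u :: real
  assumes "1 \<le> u"
  shows "exp (- u\<^sup>2 / 16) \<le> 110592 / u ^ 5"
proof -
  have "u ^ 5 \<le> u ^ 6" using assms by (intro power_increasing) auto
  also have "u ^ 6 = 110592 * (u\<^sup>2 / 48) ^ 3" by (simp add: power_divide power_mult[symmetric])
  also have "\<dots> \<le> 110592 * exp (u\<^sup>2 / 48) ^ 3"
  proof (intro mult_left_mono power_mono)
    show "u\<^sup>2 / 48 \<le> exp (u\<^sup>2 / 48)" using exp_ge_add_one_self[of "u\<^sup>2 / 48"] by linarith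
  qed auto
  also have "exp (u\<^sup>2 / 48) ^ 3 = exp (u\<^sup>2 / 16)" by (simp add: exp_of_nat_mult[symmetric])
  finally have "exp (- u\<^sup>2 / 16) * u ^ 5 \<le> exp (- u\<^sup>2 / 16) * (110592 * exp (u\<^sup>2 / 16))"
    by (intro mult_left_mono) auto
  also have "\<dots> = 110592" by (simp add: exp_minus)
  finally show ?thesis using assms by (simp add: pos_le_divide_eq)
qed

text \<open>The imaginary part costs at most \<open>exp (1 / 2)\<close>, and the shift of the real
  part at most halves \<open>t ^ 2\<close> up to a constant. The result is stated in
  \<open>2 + \<bar>t\<bar>\<close> because this quantity dominates
  \<open>1 + cmod w\<close>.\<close>

lemma cmod_gaussian_le:
  fixes t :: real and w :: complex
  assumes w: "cmod (w - of_real t) \<le> 1"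
  shows "cmod (exp (- w\<^sup>2 / 2)) \<le> exp (2 - (2 + \<bar>t\<bar>)\<^sup>2 / 8)"
proof -
  define a where "a = Re w - t"
  have a: "\<bar>a\<bar> \<le> 1" and im: "\<bar>Im w\<bar> \<le> 1"
    using order.trans[OF abs_Re_le_cmod w] order.trans[OF abs_Im_le_cmod w] by (auto simp: a_def)
  have "a\<^sup>2 \<le> 1" "(Im w)\<^sup>2 \<le> 1" using a im by (auto simp: abs_square_le_1)
  moreover have "(Re w)\<^sup>2 \<ge> t\<^sup>2 / 2 - a\<^sup>2"
  proof -
    have "0 \<le> (t / 2 + a)\<^sup>2 * 2" by simp
    then show ?thesis by (simp add: a_def power2_eq_square field_simps)
  qed
  moreover have "(2 + \<bar>t\<bar>)\<^sup>2 \<le> 2 * t\<^sup>2 + 8"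
  proof -
    have "0 \<le> (\<bar>t\<bar> - 2)\<^sup>2" by simp
    then show ?thesis by (simp add: power2_sum power2_diff)
  qed
  moreover have "Re (- w\<^sup>2 / 2) = - (Re w)\<^sup>2 / 2 + (Im w)\<^sup>2 / 2" by (simp add: power2_eq_square algebra_simps diff_divide_distrib)
  ultimately have "Re (- w\<^sup>2 / 2) \<le> 2 - (2 + \<bar>t\<bar>)\<^sup>2 / 8" by linarith
  then show ?thesis by simp
qed

definition gauss_const :: real where "gauss_const = exp 2 * 110592"

lemma exp_le_gauss_const:
  "exp (2 - (2 + \<bar>t\<bar>)\<^sup>2 / 8 + (2 + \<bar>t\<bar>)\<^sup>2 / 16) \<le> gauss_const / (2 + \<bar>t\<bar>) ^ 5" for t :: real
proof -
  have "exp (2 - (2 + \<bar>t\<bar>)\<^sup>2 / 8 + (2 + \<bar>t\<bar>)\<^sup>2 / 16) = exp 2 * exp (- (2 + \<bar>t\<bar>)\<^sup>2 / 16)"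
    unfolding exp_add[symmetric] by (rule arg_cong[of _ _ exp]) (simp add: field_simps)
  also have "\<dots> \<le> exp 2 * (110592 / (2 + \<bar>t\<bar>) ^ 5)"
    by (intro mult_left_mono exp_minus_square_le) auto
  finally show ?thesis by (simp add: gauss_const_def)
qed

lemma inverse_power_le_inverse_square:
  fixes t :: real
  assumes "0 \<le> G" shows "G / (2 + \<bar>t\<bar>) ^ 5 \<le> G / (jb t)\<^sup>2"
proof -
  have "(jb t)\<^sup>2 \<le> (2 + \<bar>t\<bar>)\<^sup>2" by (intro power_mono) auto
  also have "\<dots> \<le> (2 + \<bar>t\<bar>) ^ 5" by (intro power_increasing) auto
  finally show ?thesis using assms
    by (intro divide_left_mono) (auto intro!: mult_pos_pos zero_less_power add_pos_nonneg)
qed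

text \<open>With \<open>u = 2 + \<bar>t\<bar>\<close>, smallness gives
  \<open>cmod E \<le> u ^ 2 / 16\<close>, half of the Gaussian exponent \<open>u ^ 2 / 8\<close>.
  The other half yields \<open>u ^ (- 5)\<close>: three powers for the cubic bound on
  \<open>E\<close>, two for the integrable weight.\<close>

lemma perturbed_gaussian_le:
  fixes t s C\<^sub>0 :: real and w E :: complex
  assumes w: "cmod (w - of_real t) \<le> 1" and C\<^sub>0: "0 \<le> C\<^sub>0" and s: "0 < s"
    and E: "cmod E \<le> C\<^sub>0 * (1 + cmod w) ^ 3 / s" and small: "C\<^sub>0 * (1 + cmod w) / s \<le> 1 / 16"
  shows "cmod (exp (- w\<^sup>2 / 2)) \<le> gauss_const / (jb t)\<^sup>2"
    and "cmod (exp (- w\<^sup>2 / 2 + E)) \<le> gauss_const / (jb t)\<^sup>2"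
    and "cmod (exp (- w\<^sup>2 / 2 + E) - exp (- w\<^sup>2 / 2)) \<le> C\<^sub>0 * gauss_const / s / (jb t)\<^sup>2"
proof -
  define u where "u = 2 + \<bar>t\<bar>"
  have u: "2 \<le> u" "1 + cmod w \<le> u"
    using norm_triangle_ineq[of "w - of_real t" "of_real t"] w by (auto simp: u_def)
  have G: "0 \<le> gauss_const" by (simp add: gauss_const_def)
  have E1: "cmod E \<le> C\<^sub>0 * u ^ 3 / s"
    using E C\<^sub>0 s u by (elim order.trans, intro divide_right_mono mult_left_mono power_mono) auto
  have E2: "cmod E \<le> u\<^sup>2 / 16"
  proof -
    have "C\<^sub>0 * (1 + cmod w) ^ 3 / s = (C\<^sub>0 * (1 + cmod w) / s) * (1 + cmod w)\<^sup>2"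
      by (simp add: power2_eq_square power3_eq_cube)
    also have "\<dots> \<le> (1 / 16) * u\<^sup>2" using small u C\<^sub>0 s by (intro mult_mono power_mono) auto
    finally show ?thesis using E by linarith
  qed
  have g: "cmod (exp (- w\<^sup>2 / 2)) \<le> exp (2 - u\<^sup>2 / 8)" unfolding u_def by (rule cmod_gaussian_le[OF w])
  have gE: "cmod (exp (- w\<^sup>2 / 2)) * exp (cmod E) \<le> gauss_const / u ^ 5"
  proof -
    have "cmod (exp (- w\<^sup>2 / 2)) * exp (cmod E) \<le> exp (2 - u\<^sup>2 / 8) * exp (u\<^sup>2 / 16)"
      using g E2 by (intro mult_mono) auto
    also have "\<dots> \<le> gauss_const / u ^ 5"
      using exp_le_gauss_const[of t] unfolding u_def exp_add[symmetric] .
    finally show ?thesis .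
  qed
  have fin: "gauss_const / u ^ 5 \<le> gauss_const / (jb t)\<^sup>2"
    unfolding u_def by (rule inverse_power_le_inverse_square[OF G])
  have "cmod (exp (- w\<^sup>2 / 2)) * 1 \<le> cmod (exp (- w\<^sup>2 / 2)) * exp (cmod E)" by (intro mult_left_mono) auto
  then show "cmod (exp (- w\<^sup>2 / 2)) \<le> gauss_const / (jb t)\<^sup>2" using gE fin by linarith
  have "cmod (exp (- w\<^sup>2 / 2 + E)) \<le> cmod (exp (- w\<^sup>2 / 2)) * exp (cmod E)"
    unfolding exp_add norm_mult by (intro mult_left_mono norm_exp) auto
  then show "cmod (exp (- w\<^sup>2 / 2 + E)) \<le> gauss_const / (jb t)\<^sup>2" using gE fin by linarith
  have "exp (- w\<^sup>2 / 2 + E) - exp (- w\<^sup>2 / 2) = exp (- w\<^sup>2 / 2) * (exp E - 1)"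
    by (simp only: exp_add right_diff_distrib mult_1_right)
  then have "cmod (exp (- w\<^sup>2 / 2 + E) - exp (- w\<^sup>2 / 2)) \<le> cmod (exp (- w\<^sup>2 / 2)) * (cmod E * exp (cmod E))"
    by (simp only: norm_mult) (intro mult_left_mono cmod_exp_minus_1_le, simp)
  also have "\<dots> = cmod E * (cmod (exp (- w\<^sup>2 / 2)) * exp (cmod E))" by simp
  also have "\<dots> \<le> (C\<^sub>0 * u ^ 3 / s) * (gauss_const / u ^ 5)"
    using E1 gE by (intro mult_mono) (auto intro: order.trans[OF norm_ge_zero])
  also have "\<dots> = C\<^sub>0 * gauss_const / s / u\<^sup>2"
  proof -
    have eq: "u ^ 5 = u ^ 3 * u\<^sup>2" by (simp add: power_add[symmetric])
    have "C\<^sub>0 * a / s * (gauss_const / (a * b)) = C\<^sub>0 * gauss_const / s / b" if "a \<noteq> 0" for a b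
      using that by simp
    then show ?thesis unfolding eq by this (use u in simp)
  qed
  also have "\<dots> \<le> C\<^sub>0 * gauss_const / s / (jb t)\<^sup>2"
    using C\<^sub>0 G s by (intro divide_left_mono power_mono)
      (auto simp: u_def intro!: mult_pos_pos zero_less_power add_pos_nonneg)
  finally show "cmod (exp (- w\<^sup>2 / 2 + E) - exp (- w\<^sup>2 / 2)) \<le> C\<^sub>0 * gauss_const / s / (jb t)\<^sup>2" .
qed

text \<open>\<open>K\<close> and \<open>s\<^sub>0\<close> are chosen before the law, the scale and
  the extension \<open>D\<close>, so a single constant will serve the whole sequence.\<close>

lemma nonuniform_berry_esseen:
  fixes m :: nat and C\<^sub>0 r :: real
  assumes C\<^sub>0: "0 \<le> C\<^sub>0" and r: "0 < r"
  obtains K s\<^sub>0 where "0 \<le> K" "0 < s\<^sub>0"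
    "\<And>M s D x. real_distribution M \<Longrightarrow> s\<^sub>0 \<le> s \<Longrightarrow> D holomorphic_on ball 0 (r * s) \<Longrightarrow>
      (\<And>t. \<bar>t\<bar> < r * s \<Longrightarrow> D (of_real t) = char M t) \<Longrightarrow>
      (\<And>w. cmod w < r * s \<Longrightarrow> \<exists>E. D w = exp (- w\<^sup>2 / 2 + E) \<and> cmod E \<le> C\<^sub>0 * (1 + cmod w) ^ 3 / s) \<Longrightarrow>
      \<bar>measure M {x<..} - measure \<N> {x<..}\<bar> \<le> K / s / jb x ^ m"
proof -
  obtain K where K: "0 \<le> K"
    "\<And>M1 M2 T P Q x. real_distribution M1 \<Longrightarrow> real_distribution M2 \<Longrightarrow> 1 \<le> T \<Longrightarrow> 0 \<le> P \<Longrightarrow> 0 \<le> Q \<Longrightarrow>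
      (\<And>x. dens (m + 2) T M1 x \<le> P / jb x ^ m) \<Longrightarrow>
      (\<And>x. dens (m + 2) T M2 x \<le> P / jb x ^ m) \<Longrightarrow>
      (\<And>x. \<bar>dens (m + 2) T M1 x - dens (m + 2) T M2 x\<bar>
        \<le> Q / jb x ^ (m + 2)) \<Longrightarrow>
      \<bar>measure M1 {x<..} - measure M2 {x<..}\<bar> \<le> K * (P / T + Q) / jb x ^ m"
    using tail_comparison[of m] by blast
  \<comment> \<open>With \<open>T = \<epsilon> * s\<close>, the first entry gives
    \<open>2 * T \<le> r * s / 2\<close>. The second bounds \<open>4 * C\<^sub>0 * T / s\<close> by
    1/16, the smallness required in \<open>perturbed_gaussian_le\<close>.\<close>
  define \<epsilon> where "\<epsilon> = min (r / 4) (1 / (64 * (C\<^sub>0 + 1)))"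
  have \<epsilon>: "0 < \<epsilon>" "\<epsilon> \<le> r / 4" "\<epsilon> \<le> 1 / (64 * (C\<^sub>0 + 1))" using r C\<^sub>0 by (auto simp: \<epsilon>_def)
  \<comment> \<open>The first entry ensures \<open>T \<ge> 1\<close>; the second ensures
    \<open>2 \<le> r * s / 2\<close>, so that the disc of radius \<open>2 * T + 2\<close>
    fits.\<close>
  define s\<^sub>0 where "s\<^sub>0 = max (1 / \<epsilon>) (4 / r)"
  define P where "P = smooth_const (m + 2) * gauss_const"
  define Q where "Q = smooth_const (m + 2) * (C\<^sub>0 * gauss_const)"
  have G: "0 \<le> gauss_const" by (simp add: gauss_const_def)
  have P: "0 \<le> P" and Q: "0 \<le> Q" using smooth_const_nonneg G C\<^sub>0 by (auto simp: P_def Q_def)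
  show ?thesis
  proof (rule that[of "K * (P / \<epsilon> + Q)" s\<^sub>0])
    show "0 \<le> K * (P / \<epsilon> + Q)" using K(1) P Q \<epsilon> by simp
    show "0 < s\<^sub>0" using \<epsilon> r by (simp add: s\<^sub>0_def less_max_iff_disj)
    fix M s D x
    assume M: "real_distribution M" and s: "s\<^sub>0 \<le> s" and D: "D holomorphic_on ball 0 (r * s)"
      and D_char: "\<And>t. \<bar>t\<bar> < r * s \<Longrightarrow> D (of_real t) = char M t"
      and D_exp: "\<And>w. cmod w < r * s \<Longrightarrow> \<exists>E. D w = exp (- w\<^sup>2 / 2 + E) \<and> cmod E \<le> C\<^sub>0 * (1 + cmod w) ^ 3 / s"
    interpret M: real_distribution M by (rule M)
    interpret N: real_distribution \<N> by (rule real_dist_normal_dist)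
    have s_pos: "0 < s" using s \<epsilon>(1) r by (auto simp: s\<^sub>0_def intro: less_le_trans[of 0 "4 / r"])
    define T where "T = \<epsilon> * s"
    have T: "1 \<le> T" using s \<epsilon>(1) by (simp add: T_def s\<^sub>0_def divide_le_eq mult.commute)
    have "2 \<le> r * s / 2" using s r by (simp add: s\<^sub>0_def divide_le_eq mult.commute)
    moreover have "2 * T \<le> r * s / 2" using mult_right_mono[OF \<epsilon>(2), of s] s_pos by (simp add: T_def)
    ultimately have rs: "2 * T + 2 \<le> r * s" by simp
    have sub: "ball 0 (2 * T + 2) \<subseteq> ball (0::complex) (r * s)" using rs by auto
    have wT: "cmod w \<le> 2 * T + 1" "cmod w < r * s" "C\<^sub>0 * (1 + cmod w) / s \<le> 1 / 16"
      if "\<bar>t\<bar> \<le> 2 * T" "cmod (w - of_real t) \<le> 1" for t w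
    proof -
      show 1: "cmod w \<le> 2 * T + 1" using norm_triangle_ineq[of "w - of_real t" "of_real t"] that by simp
      then show "cmod w < r * s" using rs by simp
      have "C\<^sub>0 * (1 + cmod w) \<le> C\<^sub>0 * (4 * T)" using 1 T C\<^sub>0 by (intro mult_left_mono) auto
      also have "\<dots> \<le> (C\<^sub>0 + 1) * (4 * T)" using T by (intro mult_right_mono) auto
      also have "\<dots> = 4 * (C\<^sub>0 + 1) * s * \<epsilon>" by (simp add: T_def)
      also have "\<dots> \<le> 4 * (C\<^sub>0 + 1) * s * (1 / (64 * (C\<^sub>0 + 1)))" using \<epsilon>(3) C\<^sub>0 s_pos by (intro mult_left_mono) auto
      also have "\<dots> = s / 16" using C\<^sub>0 by (simp add: field_simps)
      finally show "C\<^sub>0 * (1 + cmod w) / s \<le> 1 / 16" using s_pos by (simp add: divide_le_eq)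
    qed
    have pw: "P / jb x ^ (m + 2) \<le> P / jb x ^ m" for x :: real
      using P by (intro divide_left_mono power_increasing) (auto intro!: mult_pos_pos zero_less_power add_pos_nonneg)
    have "\<bar>measure M {x<..} - measure \<N> {x<..}\<bar> \<le> K * (P / T + Q / s) / jb x ^ m"
    proof (rule K(2)[OF M real_dist_normal_dist T P])
      show "0 \<le> Q / s" using Q s_pos by simp
      show "dens (m + 2) T M x \<le> P / jb x ^ m" for x
        unfolding P_def
      proof (rule order.trans[OF M.integral_kern_le[OF T G holomorphic_on_subset[OF D sub]] pw[unfolded P_def]])
        show "D (of_real t) = char M t" if "\<bar>t\<bar> \<le> 2 * T" for t
          using that rs by (intro D_char) auto
        fix t w assume *: "\<bar>t\<bar> \<le> 2 * T" "cmod (w - of_real t) \<le> 1"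
        obtain E where "D w = exp (- w\<^sup>2 / 2 + E)" "cmod E \<le> C\<^sub>0 * (1 + cmod w) ^ 3 / s"
          using D_exp[OF wT(2)[OF *]] by blast
        then show "cmod (D w) \<le> gauss_const / (jb t)\<^sup>2"
          using perturbed_gaussian_le(2)[OF *(2) C\<^sub>0 s_pos _ wT(3)[OF *]] by simp
      qed
      show "dens (m + 2) T \<N> x \<le> P / jb x ^ m" for x
        unfolding P_def
      proof (rule order.trans[OF N.integral_kern_le[OF T G, where D = "\<lambda>w. exp (- w\<^sup>2 / 2)"] pw[unfolded P_def]])
        show "exp (- (complex_of_real t)\<^sup>2 / 2) = char \<N> t" for t
          by (simp add: char_std_normal_distribution exp_of_real[symmetric])
        show "cmod (exp (- w\<^sup>2 / 2)) \<le> gauss_const / (jb t)\<^sup>2"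
          if "\<bar>t\<bar> \<le> 2 * T" "cmod (w - of_real t) \<le> 1" for t w
          using perturbed_gaussian_le(1)[OF that(2) C\<^sub>0 s_pos, of 0] wT(3)[OF that] C\<^sub>0 s_pos by simp
      qed (intro holomorphic_intros, simp)
      show "\<bar>dens (m + 2) T M x - dens (m + 2) T \<N> x\<bar>
          \<le> Q / s / jb x ^ (m + 2)" for x
      proof -
        have "\<bar>dens (m + 2) T M x - dens (m + 2) T \<N> x\<bar>
          \<le> smooth_const (m + 2) * (C\<^sub>0 * gauss_const / s) / jb x ^ (m + 2)"
        proof (rule integral_kern_diff_le[OF M real_dist_normal_dist T, where D = "\<lambda>w. D w - exp (- w\<^sup>2 / 2)"])
          show "0 \<le> C\<^sub>0 * gauss_const / s" using C\<^sub>0 G s_pos by simp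
          show "(\<lambda>w. D w - exp (- w\<^sup>2 / 2)) holomorphic_on ball 0 (2 * T + 2)"
            by (intro holomorphic_intros holomorphic_on_subset[OF D sub]) simp
          show "D (of_real t) - exp (- (complex_of_real t)\<^sup>2 / 2) = char M t - char \<N> t" if "\<bar>t\<bar> \<le> 2 * T" for t
            using that rs by (simp add: D_char char_std_normal_distribution exp_of_real[symmetric])
          fix t w assume *: "\<bar>t\<bar> \<le> 2 * T" "cmod (w - of_real t) \<le> 1"
          obtain E where "D w = exp (- w\<^sup>2 / 2 + E)" "cmod E \<le> C\<^sub>0 * (1 + cmod w) ^ 3 / s"
            using D_exp[OF wT(2)[OF *]] by blast
          then show "cmod (D w - exp (- w\<^sup>2 / 2)) \<le> C\<^sub>0 * gauss_const / s / (jb t)\<^sup>2"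
            using perturbed_gaussian_le(3)[OF *(2) C\<^sub>0 s_pos _ wT(3)[OF *]] by simp
        qed
        then show ?thesis by (simp add: Q_def)
      qed
    qed
    also have "K * (P / T + Q / s) / jb x ^ m = K * (P / \<epsilon> + Q) / s / jb x ^ m"
      by (simp add: T_def add_divide_distrib distrib_left)
    finally show "\<bar>measure M {x<..} - measure \<N> {x<..}\<bar> \<le> K * (P / \<epsilon> + Q) / s / jb x ^ m" .
  qed
qed

section \<open>From distribution functions to expectations\<close>

lemma integral_std_normal:
  fixes g :: "real \<Rightarrow> real"
  assumes "g \<in> borel_measurable borel"
  shows "(\<integral>x. g x \<partial>\<N>) = (\<integral>x. g x * std_normal_density x \<partial>lborel)"
    and "integrable \<N> g \<longleftrightarrow> integrable lborel (\<lambda>x. g x * std_normal_density x)"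
  using assms by (simp_all add: integral_density integrable_density mult.commute)

text \<open>Raising \<open>x / m \<le> exp (x / m)\<close> to the power \<open>m\<close> reduces the
  weight to an exponential, and \<open>(\<bar>z\<bar> - 1) ^ 2 \<ge> 0\<close> bounds the combined
  exponent by 3/2.\<close>

lemma std_normal_density_le: "\<exists>G\<ge>0. \<forall>z. std_normal_density z \<le> G / jb z ^ m"
proof -
  have "std_normal_density z \<le> real m ^ m * exp (3 / 2) / jb z ^ m" for z
  proof -
    have pow: "x ^ m \<le> real m ^ m * exp x" if "0 \<le> x" for x
    proof (cases "m = 0")
      case False
      have "(x / m) ^ m \<le> exp (x / m) ^ m"
      proof (intro power_mono)
        show "x / m \<le> exp (x / m)" using exp_ge_add_one_self[of "x / m"] by linarith
      qed (use that in simp)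
      also have "\<dots> = exp x" using False by (simp add: exp_of_nat_mult[symmetric])
      finally show ?thesis using False by (simp add: power_divide pos_divide_le_eq mult.commute)
    qed (use that in simp)
    have "0 \<le> (\<bar>z\<bar> - 1)\<^sup>2" by simp
    then have sq: "1 + \<bar>z\<bar> - z\<^sup>2 / 2 \<le> 3 / 2" by (simp add: power2_diff)
    have "std_normal_density z * jb z ^ m \<le> exp (- z\<^sup>2 / 2) * (real m ^ m * exp (jb z))"
    proof (intro mult_mono pow)
      have "1 \<le> sqrt (2 * pi)" using pi_gt3 by (simp add: real_le_rsqrt)
      then have "1 / sqrt (2 * pi) * exp (- z\<^sup>2 / 2) \<le> 1 * exp (- z\<^sup>2 / 2)" by (intro mult_right_mono) auto
      then show "std_normal_density z \<le> exp (- z\<^sup>2 / 2)" by (simp add: std_normal_density_def)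
    qed auto
    also have "\<dots> = real m ^ m * exp (1 + \<bar>z\<bar> - z\<^sup>2 / 2)" by (simp add: exp_add[symmetric] exp_diff exp_minus field_simps)
    also have "\<dots> \<le> real m ^ m * exp (3 / 2)" using sq by (intro mult_left_mono) auto
    finally show ?thesis by (subst pos_le_divide_eq) (auto intro: add_pos_nonneg)
  qed
  then show ?thesis by (intro exI[of _ "real m ^ m * exp (3 / 2)"]) auto
qed

lemma measure_std_normal:
  assumes "A \<in> sets borel"
  shows "measure \<N> A = (\<integral>z. indicator A z * std_normal_density z \<partial>lborel)"
proof -
  interpret N: real_distribution \<N> by (rule real_dist_normal_dist)
  have "measure \<N> A = (\<integral>z. indicator A z \<partial>\<N>)" using assms by simp
  also have "\<dots> = (\<integral>z. indicator A z * std_normal_density z \<partial>lborel)" using assms by (intro integral_std_normal) auto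
  finally show ?thesis .
qed

lemma std_normal_tail_le:
  fixes G x :: real
  assumes G: "0 \<le> G" "\<And>z. std_normal_density z \<le> G / jb z ^ (m + 2)"
    and A: "A \<in> sets borel" "\<And>z. z \<in> A \<Longrightarrow> \<bar>x\<bar> \<le> \<bar>z\<bar>"
  shows "measure \<N> A \<le> G * sq_mass / jb x ^ m"
proof -
  have "measure \<N> A = (\<integral>z. indicator A z * std_normal_density z \<partial>lborel)"
    by (rule measure_std_normal[OF A(1)])
  also have "\<dots> \<le> (\<integral>z. G / jb x ^ m * (1 / (jb z)\<^sup>2) \<partial>lborel)"
  proof (rule integral_mono_AE')
    show "integrable lborel (\<lambda>z. G / jb x ^ m * (1 / (jb z)\<^sup>2))"
      by (rule integrable_mult_right[OF integrable_inverse_1_plus_abs_square])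
    have "indicator A z * std_normal_density z \<le> G / jb x ^ m * (1 / (jb z)\<^sup>2)" for z
    proof (cases "z \<in> A")
      case True
      have "std_normal_density z \<le> G / jb z ^ m * (1 / (jb z)\<^sup>2)"
        using G(2)[of z] unfolding power_add by simp
      also have "\<dots> \<le> G / jb x ^ m * (1 / (jb z)\<^sup>2)"
        using G(1) A(2)[OF True]
        by (intro mult_right_mono divide_left_mono power_mono) (auto intro!: mult_pos_pos zero_less_power add_pos_nonneg)
      finally show ?thesis using True by simp
    qed (use G(1) in simp)
    then show "AE z in lborel. indicator A z * std_normal_density z \<le> G / jb x ^ m * (1 / (jb z)\<^sup>2)" by simp
  qed (use G(1) in simp)
  also have "\<dots> = G / jb x ^ m * sq_mass" unfolding sq_mass_def by (rule integral_mult_right_zero)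
  finally show ?thesis by simp
qed

lemma std_normal_interval_le:
  fixes x y c :: real
  assumes "x \<le> y" and c: "0 \<le> c" "\<And>z. z \<in> {x..y} \<Longrightarrow> std_normal_density z \<le> c"
  shows "\<bar>measure \<N> {..y} - measure \<N> {..x}\<bar> \<le> c * (y - x)"
proof -
  interpret N: real_distribution \<N> by (rule real_dist_normal_dist)
  have "measure \<N> {..y} = measure \<N> ({..x} \<union> {x<..y})"
    using assms(1) by (intro arg_cong[of _ _ "measure _"]) auto
  also have "\<dots> = measure \<N> {..x} + measure \<N> {x<..y}"
    by (intro N.finite_measure_Union) auto
  finally have "measure \<N> {..y} - measure \<N> {..x} =
      (\<integral>z. indicator {x<..y} z * std_normal_density z \<partial>lborel)" by (simp add: measure_std_normal)
  moreover have "0 \<le> (\<integral>z. indicator {x<..y} z * std_normal_density z \<partial>lborel)"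
    by (intro integral_nonneg_AE) auto
  moreover have "(\<integral>z. indicator {x<..y} z * std_normal_density z \<partial>lborel) \<le> (\<integral>z. c * indicator {x<..y} z \<partial>lborel)"
  proof (rule integral_mono_AE')
    show "integrable lborel (\<lambda>z. c * indicator {x<..y} z)"
      using assms(1) by (intro integrable_mult_right) (simp add: integrable_indicator_iff)
    show "AE z in lborel. indicator {x<..y} z * std_normal_density z \<le> c * indicator {x<..y} z"
      using c(2) by (intro AE_I2) (auto simp: indicator_def)
  qed (use c(1) in simp)
  moreover have "(\<integral>z. c * indicator {x<..y} z \<partial>lborel) = c * (y - x)" using assms(1) by simp
  ultimately show ?thesis by linarith
qed

text \<open>An affine change of the variable moves \<open>x\<close> by an amount proportional to
  \<open>1 + \<bar>x\<bar>\<close>. The condition \<open>2 * \<gamma> \<le> s\<close> keeps all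
  weights between \<open>x\<close> and \<open>y\<close> comparable within a factor 2. The density is
  bounded with \<open>m + 1\<close> powers because one of them pays for the growth of the
  displacement.\<close>

lemma cdf_transfer:
  fixes x y s K G \<gamma> :: real
  assumes K: "0 \<le> K" "\<And>x. \<bar>measure M {..x} - measure \<N> {..x}\<bar> \<le> K / s / jb x ^ m"
    and G: "0 \<le> G" "\<And>z. std_normal_density z \<le> G / jb z ^ Suc m"
    and \<gamma>: "0 \<le> \<gamma>" "2 * \<gamma> \<le> s" and s: "0 < s" and xy: "\<bar>y - x\<bar> \<le> \<gamma> * jb x / s"
  shows "\<bar>measure M {..y} - measure \<N> {..x}\<bar> \<le> (2 ^ m * K + 2 ^ Suc m * G * \<gamma>) / s / jb x ^ m"
proof -
  have half: "jb x / 2 \<le> 1 + \<bar>z\<bar>" if "\<bar>z - x\<bar> \<le> \<bar>y - x\<bar>" for z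
  proof -
    have "\<gamma> * jb x / s \<le> (s / 2) * jb x / s" using \<gamma> s by (intro divide_right_mono mult_right_mono) auto
    also have "\<dots> = jb x / 2" using s by simp
    finally have "\<bar>z - x\<bar> \<le> jb x / 2" using that xy by linarith
    moreover have "\<bar>x\<bar> \<le> \<bar>z\<bar> + \<bar>z - x\<bar>" by arith
    moreover have "(1 + p) / 2 \<le> 1 + q" if "d \<le> (1 + p) / 2" "p \<le> q + d" for p q d :: real
      using that by (simp add: field_simps)
    ultimately show ?thesis by blast
  qed
  have inv: "1 / jb z ^ j \<le> 2 ^ j / jb x ^ j" if "\<bar>z - x\<bar> \<le> \<bar>y - x\<bar>" for z j
  proof -
    have "(jb x / 2) ^ j \<le> jb z ^ j" using half[OF that] by (intro power_mono) auto
    then have "1 / jb z ^ j \<le> 1 / (jb x / 2) ^ j"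
      by (intro divide_left_mono) (auto intro!: mult_pos_pos zero_less_power divide_pos_pos add_pos_nonneg)
    then show ?thesis by (simp add: power_divide)
  qed
  have 1: "\<bar>measure M {..y} - measure \<N> {..y}\<bar> \<le> K / s * (2 ^ m / jb x ^ m)"
  proof -
    have "K / s * (1 / jb y ^ m) \<le> K / s * (2 ^ m / jb x ^ m)" using K(1) s by (intro mult_left_mono inv) auto
    then show ?thesis using K(2)[of y] by simp
  qed
  have 2: "\<bar>measure \<N> {..y} - measure \<N> {..x}\<bar> \<le> 2 ^ Suc m * G * \<gamma> / s / jb x ^ m"
  proof -
    define c where "c = G * (2 ^ Suc m / jb x ^ Suc m)"
    have c: "0 \<le> c" using G(1) by (simp add: c_def)
    have dens: "std_normal_density z \<le> c" if "\<bar>z - x\<bar> \<le> \<bar>y - x\<bar>" for z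
    proof -
      have "G * (1 / jb z ^ Suc m) \<le> c" unfolding c_def by (intro mult_left_mono inv that G(1))
      then show ?thesis using G(2)[of z] by simp
    qed
    have "\<bar>measure \<N> {..y} - measure \<N> {..x}\<bar> \<le> c * \<bar>y - x\<bar>"
    proof (cases "x \<le> y")
      case True
      then show ?thesis using std_normal_interval_le[OF True c] dens by force
    next
      case False
      then have "y \<le> x" by simp
      then show ?thesis using std_normal_interval_le[OF _ c, of y x] dens by (force simp: abs_minus_commute)
    qed
    also have "\<dots> \<le> c * (\<gamma> * jb x / s)" by (intro mult_left_mono xy c)
    also have "\<dots> = 2 ^ Suc m * G * \<gamma> / s * (jb x / jb x ^ Suc m)"
    proof -
      have "G * (p / q) * (\<gamma> * t / s) = p * G * \<gamma> / s * (t / q)" for p q t :: real by (simp add: mult_ac)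
      then show ?thesis unfolding c_def .
    qed
    also have "jb x / jb x ^ Suc m = 1 / jb x ^ m"
    proof -
      have "t / t ^ Suc m = 1 / t ^ m" if "t \<noteq> 0" for t :: real using that by simp
      moreover have "1 + \<bar>x\<bar> \<noteq> 0" by arith
      ultimately show ?thesis by blast
    qed
    finally show ?thesis by simp
  qed
  have "\<bar>measure M {..y} - measure \<N> {..x}\<bar> \<le> K / s * (2 ^ m / jb x ^ m) + 2 ^ Suc m * G * \<gamma> / s / jb x ^ m"
    using 1 2 by linarith
  also have "\<dots> = (2 ^ m * K + 2 ^ Suc m * G * \<gamma>) / s / jb x ^ m" by (simp add: add_divide_distrib mult.commute)
  finally show ?thesis .
qed

section \<open>Weighted integrability on the line\<close>

lemma integrable_even:
  fixes g :: "real \<Rightarrow> real"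
  assumes "integrable lborel (\<lambda>x. indicator {0..} x * g x)"
  shows "integrable lborel (\<lambda>x. g \<bar>x\<bar>)"
proof -
  have "integrable lborel (\<lambda>x. indicator {0..} (- x) * g (- x))"
    using lborel_integrable_real_affine[OF assms, of "-1" 0] by simp
  from Bochner_Integration.integrable_add[OF assms this]
  have i: "integrable lborel (\<lambda>x. indicator {0..} x * g x + indicator {0..} (- x) * g (- x))" .
  \<comment> \<open>Both half-lines contain the origin, so its value is subtracted once.\<close>
  have "(\<lambda>x. g \<bar>x\<bar>) = (\<lambda>x. (indicator {0..} x * g x + indicator {0..} (- x) * g (- x)) - indicator {0} x * g 0)"
    by (auto simp: indicator_def fun_eq_iff)
  moreover have "integrable lborel (\<lambda>x. (indicator {0..} x * g x + indicator {0..} (- x) * g (- x)) - indicator {0} x * g 0)"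
    by (intro Bochner_Integration.integrable_diff i integrable_mult_left) (simp add: integrable_indicator_iff)
  ultimately show ?thesis by simp
qed

lemma integrable_one_plus_abs_powr:
  fixes a :: real
  assumes "1 < a"
  shows "integrable lborel (\<lambda>x. jb x powr (- a))"
proof (rule integrable_even)
  let ?F = "\<lambda>x::real. (1 + x) powr (1 - a) / (1 - a)"
  have "((\<lambda>x::real. (1 + x) powr (1 - a)) \<longlongrightarrow> 0) at_top"
    using assms by (intro tendsto_neg_powr filterlim_tendsto_add_at_top[OF tendsto_const filterlim_ident]) auto
  then have lim: "(?F \<longlongrightarrow> 0) at_top" using tendsto_divide[OF _ tendsto_const, of _ 0 at_top "1 - a"] assms by fastforce
  have "(\<integral>\<^sup>+x. ennreal ((1 + x) powr (- a)) * indicator {0..} x \<partial>lborel) = ennreal (0 - ?F 0)"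
  proof (rule nn_integral_FTC_atLeast[OF _ _ _ lim])
    show "DERIV ?F x :> (1 + x) powr (- a)" if "0 \<le> x" for x
    proof -
      have "((\<lambda>x. (1 + x) powr (1 - a)) has_real_derivative ((1 - a) * (1 + x) powr (1 - a - 1)) * 1) (at x)"
        using that by (intro DERIV_chain2[OF has_real_derivative_powr]) (auto intro!: derivative_eq_intros)
      from DERIV_cdivide[OF this, of "1 - a"] show ?thesis using assms by simp
    qed
  qed auto
  then show "integrable lborel (\<lambda>x. indicator {0..} x * (1 + x) powr - a)"
    by (intro integrableI_nonneg) (auto simp: ennreal_mult' ennreal_indicator mult.commute cong: nn_integral_cong_simp)
qed

text \<open>The condition \<open>p > 1 / m\<close> says \<open>m * p > 1\<close>, which makes the
  \<open>p\<close>-th power of the weight integrable.\<close>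

lemma weighted_Lp_bound:
  fixes u :: "real \<Rightarrow> real" and p C :: real
  assumes u: "u \<in> borel_measurable borel" "\<And>x. \<bar>u x\<bar> \<le> C / jb x ^ m"
    and p: "1 / real m < p" and m: "0 < m" and C: "0 \<le> C"
  shows "integrable lborel (\<lambda>x. \<bar>u x\<bar> powr p)"
    "(\<integral>x. \<bar>u x\<bar> powr p \<partial>lborel) powr (1 / p) \<le> C * (\<integral>x. jb x powr (- (real m * p)) \<partial>lborel) powr (1 / p)"
proof -
  have p0: "0 < p" using p m by (auto intro: less_trans[of 0 "1 / real m"])
  have mp: "1 < real m * p" using p m by (simp add: divide_less_eq mult.commute)
  note I = integrable_mult_right[OF integrable_one_plus_abs_powr[OF mp], of "C powr p"]
  have le: "\<bar>u x\<bar> powr p \<le> C powr p * jb x powr (- (real m * p))" for x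
  proof -
    have "\<bar>u x\<bar> powr p \<le> (C / jb x ^ m) powr p" using p0 u(2) by (intro powr_mono2) auto
    also have "\<dots> = C powr p / (jb x ^ m) powr p" using C by (intro powr_divide)
    also have "(jb x ^ m) powr p = jb x powr (real m * p)"
      by (simp add: powr_powr[symmetric] powr_realpow add_pos_nonneg)
    finally show ?thesis by (simp add: powr_minus divide_inverse)
  qed
  show i: "integrable lborel (\<lambda>x. \<bar>u x\<bar> powr p)"
    by (rule Bochner_Integration.integrable_bound[OF I]) (use u(1) le in auto)
  have "(\<integral>x. \<bar>u x\<bar> powr p \<partial>lborel) \<le> (\<integral>x. C powr p * jb x powr (- (real m * p)) \<partial>lborel)"
    by (rule integral_mono[OF i I le])
  also have "\<dots> = C powr p * (\<integral>x. jb x powr (- (real m * p)) \<partial>lborel)" by (rule integral_mult_right_zero)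
  finally have "(\<integral>x. \<bar>u x\<bar> powr p \<partial>lborel) powr (1 / p) \<le> (C powr p * (\<integral>x. jb x powr (- (real m * p)) \<partial>lborel)) powr (1 / p)"
    using p0 by (intro powr_mono2) (auto intro!: integral_nonneg_AE)
  also have "\<dots> = (C powr p) powr (1 / p) * (\<integral>x. jb x powr (- (real m * p)) \<partial>lborel) powr (1 / p)"
    by (rule powr_mult)
  also have "(C powr p) powr (1 / p) = C" using C p0 by (simp add: powr_powr)
  finally show "(\<integral>x. \<bar>u x\<bar> powr p \<partial>lborel) powr (1 / p) \<le> C * (\<integral>x. jb x powr (- (real m * p)) \<partial>lborel) powr (1 / p)" .
qed

text \<open>\<open>deriv g\<close> is only known to be Lebesgue measurable, while the exchange of
  integrals takes place over Borel sets; it is replaced by a Borel function equal to it almost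
  everywhere.\<close>

lemma ae_differentiable_borel_derivative:
  assumes g: "ae_differentiable g" and H: "H_finite m g"
  obtains d where "d \<in> borel_measurable borel" "integrable lborel (\<lambda>y. \<bar>d y\<bar> / jb y ^ m)"
    "H_weight m g = (\<integral>y. \<bar>d y\<bar> / jb y ^ m \<partial>lborel)"
    "\<And>a b. a \<le> b \<Longrightarrow> g b - g a = (\<integral>y. indicator {a..b} y * d y \<partial>lborel)"
proof -
  have int: "integrable lebesgue (\<lambda>y. indicator {a..b} y * deriv g y)"
    and eq: "g b - g a = (\<integral>y. indicator {a..b} y * deriv g y \<partial>lebesgue)" if "a \<le> b" for a b
    using g that by (auto simp: ae_differentiable_def set_integrable_def set_lebesgue_integral_def)
  \<comment> \<open>The derivative is integrable only locally, so measurability is obtained as a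
    pointwise limit of truncations.\<close>
  have "deriv g \<in> borel_measurable lebesgue"
  proof (rule borel_measurable_LIMSEQ_real)
    show "(\<lambda>y. indicator {- real n..real n} y * deriv g y) \<in> borel_measurable lebesgue" for n
      using int[of "- real n" "real n"] by (intro borel_measurable_integrable) auto
    fix y :: real
    obtain n0 where n0: "\<bar>y\<bar> \<le> real n0" using real_arch_simple by blast
    have "\<forall>\<^sub>F n in sequentially. indicator {- real n..real n} y * deriv g y = deriv g y"
      using eventually_ge_at_top[of n0]
    proof eventually_elim
      case (elim n)
      then have "\<bar>y\<bar> \<le> real n" using n0 by linarith
      then show ?case by (auto simp: indicator_def abs_le_iff)
    qed
    then show "(\<lambda>n. indicator {- real n..real n} y * deriv g y) \<longlonglongrightarrow> deriv g y"
      by (rule tendsto_eventually)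
  qed
  from completion_ex_borel_measurable_real[OF this]
  obtain d where d: "d \<in> borel_measurable lborel" "AE y in lborel. deriv g y = d y" by blast
  have d_meas [measurable]: "d \<in> borel_measurable borel" using d(1) by simp
  have d_AE: "AE y in lebesgue. deriv g y = d y" using d(2) by (rule AE_completion)
  have weight: "integrable lebesgue (\<lambda>y. \<bar>d y\<bar> / jb y ^ m)"
      "H_weight m g = (\<integral>y. \<bar>d y\<bar> / jb y ^ m \<partial>lebesgue)"
  proof -
    have ae: "AE y in lebesgue. \<bar>deriv g y\<bar> / jb y ^ m = \<bar>d y\<bar> / jb y ^ m"
      using d_AE by eventually_elim simp
    have m1: "(\<lambda>y. \<bar>d y\<bar> / jb y ^ m) \<in> borel_measurable lebesgue"
      by (intro measurable_completion) simp
    note Hm = H[unfolded H_finite_def]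
    show "integrable lebesgue (\<lambda>y. \<bar>d y\<bar> / jb y ^ m)"
      using integrable_cong_AE[OF borel_measurable_integrable[OF Hm] m1 ae] Hm by simp
    show "H_weight m g = (\<integral>y. \<bar>d y\<bar> / jb y ^ m \<partial>lebesgue)"
      unfolding H_weight_def by (rule integral_cong_AE[OF borel_measurable_integrable[OF Hm] m1 ae])
  qed
  show ?thesis
  proof (rule that[of d])
    show "integrable lborel (\<lambda>y. \<bar>d y\<bar> / jb y ^ m)"
      using weight(1) by (subst (asm) integrable_completion) auto
    show "H_weight m g = (\<integral>y. \<bar>d y\<bar> / jb y ^ m \<partial>lborel)"
      unfolding weight(2) by (rule integral_completion) simp
    show "g b - g a = (\<integral>y. indicator {a..b} y * d y \<partial>lborel)" if "a \<le> b" for a b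
    proof -
      have m1: "(\<lambda>y. indicator {a..b} y * d y) \<in> borel_measurable lborel" by simp
      have "g b - g a = (\<integral>y. indicator {a..b} y * d y \<partial>lebesgue)"
        unfolding eq[OF that] using d_AE
        by (intro integral_cong_AE borel_measurable_integrable[OF int[OF that]] measurable_completion[OF m1]) auto
      also have "\<dots> = (\<integral>y. indicator {a..b} y * d y \<partial>lborel)" by (rule integral_completion[OF m1])
      finally show ?thesis .
    qed
  qed simp
qed

text \<open>The function \<open>?q\<close> vanishes unless \<open>y\<close> lies between 0 and
  \<open>x\<close>, so its mean absolute value is an upper tail for positive \<open>y\<close> and a
  lower tail for the others. This two-sided decay is what matches the weight on \<open>d\<close> and
  permits Fubini.\<close>

lemma (in real_distribution) expectation_by_tails:
  fixes g d :: "real \<Rightarrow> real"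
  assumes d [measurable]: "d \<in> borel_measurable borel"
    and int: "integrable lborel (\<lambda>y. \<bar>d y\<bar> / jb y ^ m)"
    and g: "\<And>a b. a \<le> b \<Longrightarrow> g b - g a = (\<integral>y. indicator {a..b} y * d y \<partial>lborel)"
    and C: "0 \<le> C" "\<And>y. 0 \<le> y \<Longrightarrow> measure M {y<..} \<le> C / jb y ^ m"
      "\<And>y. y \<le> 0 \<Longrightarrow> measure M {..y} \<le> C / jb y ^ m"
  shows "integrable M g" "integrable lborel (\<lambda>y. d y * (measure M {y<..} - indicator {..0} y))"
    "(\<integral>x. g x \<partial>M) = g 0 + (\<integral>y. d y * (measure M {y<..} - indicator {..0} y) \<partial>lborel)"
proof -
  interpret P: pair_sigma_finite lborel M ..
  let ?q = "\<lambda>y x. indicator {y<..} x - indicator {..0} y :: real"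
  let ?f = "\<lambda>y x. d y * ?q y x"
  have m: "(\<lambda>(y, x). ?f y x) \<in> borel_measurable (lborel \<Otimes>\<^sub>M M)"
  proof -
    have "(\<lambda>(y, x). d y * ((if y < x then 1 else 0) - indicator {..0} y)) \<in> borel_measurable (borel \<Otimes>\<^sub>M borel :: (real \<times> real) measure)"
      by measurable
    then show ?thesis
      by (simp add: indicator_def of_bool_def cong: measurable_cong_sets sets_pair_measure_cong if_cong)
  qed
  have q_int: "integrable M (\<lambda>x. ?q y x)" for y
    by (intro integrable_const_bound[where B = 1]) (auto simp: indicator_def)
  have inner: "(\<integral>x. ?f y x \<partial>M) = d y * (measure M {y<..} - indicator {..0} y)" for y
  proof -
    have "(\<integral>x. ?q y x \<partial>M) = measure M {y<..} - indicator {..0} y"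
      by (subst Bochner_Integration.integral_diff) (auto simp: prob_space[unfolded space_eq_univ] emeasure_finite less_top[symmetric])
    then show ?thesis by simp
  qed
  have abs_q: "(\<integral>x. \<bar>?q y x\<bar> \<partial>M) \<le> C / jb y ^ m" for y
  proof (cases "y \<le> 0")
    case True
    have "(\<integral>x. \<bar>?q y x\<bar> \<partial>M) = (\<integral>x. indicator {..y} x \<partial>M)"
      using True by (intro Bochner_Integration.integral_cong) (auto simp: indicator_def)
    then show ?thesis using C(3)[OF True] by simp
  next
    case False
    have "(\<integral>x. \<bar>?q y x\<bar> \<partial>M) = (\<integral>x. indicator {y<..} x \<partial>M)"
      using False by (intro Bochner_Integration.integral_cong) (auto simp: indicator_def)
    then show ?thesis using C(2)[of y] False by simp
  qed
  have i: "integrable (lborel \<Otimes>\<^sub>M M) (\<lambda>(y, x). ?f y x)"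
  proof (rule P.Fubini_integrable[OF m])
    have nm: "(\<lambda>(y, x). norm (?f y x)) \<in> borel_measurable (lborel \<Otimes>\<^sub>M M)"
      using measurable_compose[OF m borel_measurable_norm] by (simp add: case_prod_unfold)
    have "(\<lambda>y. \<integral>x. norm (?f y x) \<partial>M) \<in> borel_measurable lborel"
      using borel_measurable_lebesgue_integral[OF nm] .
    moreover have "norm (\<integral>x. norm (?f y x) \<partial>M) \<le> norm (C * (\<bar>d y\<bar> / jb y ^ m))" for y
    proof -
      have "(\<integral>x. norm (?f y x) \<partial>M) = \<bar>d y\<bar> * (\<integral>x. \<bar>?q y x\<bar> \<partial>M)" by (simp add: abs_mult)
      also have "\<dots> \<le> \<bar>d y\<bar> * (C / jb y ^ m)" by (intro mult_left_mono abs_q) auto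
      finally show ?thesis using C(1) by (simp add: mult.commute)
    qed
    ultimately show "integrable lborel (\<lambda>y. \<integral>x. norm (case (y, x) of (y, x) \<Rightarrow> ?f y x) \<partial>M)"
      by (intro Bochner_Integration.integrable_bound[OF integrable_mult_right[OF int, of C]]) auto
    show "AE y in lborel. integrable M (\<lambda>x. case (y, x) of (y, x) \<Rightarrow> ?f y x)"
      using q_int by simp
  qed
  have outer: "(\<integral>y. ?f y x \<partial>lborel) = g x - g 0" for x
  proof (cases "0 \<le> x")
    case True
    have "(\<integral>y. ?f y x \<partial>lborel) = (\<integral>y. indicator {0..x} y * d y \<partial>lborel)"
    proof (rule integral_cong_AE)
      have "(\<lambda>y. d y * ((if y < x then 1 else 0) - indicator {..0} y)) \<in> borel_measurable borel" by measurable
      then show "(\<lambda>y. ?f y x) \<in> borel_measurable lborel" by (simp add: indicator_def of_bool_def cong: if_cong)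
      show "AE y in lborel. ?f y x = indicator {0..x} y * d y"
        using AE_lborel_singleton[of 0] AE_lborel_singleton[of x] by eventually_elim (use True in \<open>auto simp: indicator_def\<close>)
    qed auto
    then show ?thesis using g[OF True] by simp
  next
    case False
    have "(\<integral>y. ?f y x \<partial>lborel) = (\<integral>y. - (indicator {x..0} y * d y) \<partial>lborel)"
      using False by (intro Bochner_Integration.integral_cong) (auto simp: indicator_def)
    then show ?thesis using g[of x 0] False by simp
  qed
  have "integrable M (\<lambda>x. g x - g 0)" using P.integrable_snd[OF i] by (simp add: outer)
  from Bochner_Integration.integrable_add[OF this, of "\<lambda>_. g 0"] show ig: "integrable M g" by simp
  show "integrable lborel (\<lambda>y. d y * (measure M {y<..} - indicator {..0} y))"
    using P.integrable_fst[OF i] by (simp only: inner)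
  have "(\<integral>x. g x - g 0 \<partial>M) = (\<integral>y. d y * (measure M {y<..} - indicator {..0} y) \<partial>lborel)"
    using P.Fubini_integral[OF i] by (simp only: inner outer)
  then show "(\<integral>x. g x \<partial>M) = g 0 + (\<integral>y. d y * (measure M {y<..} - indicator {..0} y) \<partial>lborel)"
    using ig by (simp add: prob_space[unfolded space_eq_univ])
qed

text \<open>In the difference of the two tail formulas \<open>g 0\<close> and the indicator cancel,
  leaving \<open>d\<close> times a difference of distribution functions. The cruder tail constant
  \<open>C\<close>, a normal tail plus \<open>B\<close>, secures the existence of both
  expectations.\<close>

lemma expectation_difference_le:
  fixes C B :: real
  assumes M: "real_distribution M" and g: "ae_differentiable g" "H_finite m g"
    and B: "0 \<le> B" "\<And>x. \<bar>measure M {..x} - measure \<N> {..x}\<bar> \<le> B / jb x ^ m"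
  shows "integrable M g" "integrable \<N> g"
    "\<bar>(\<integral>x. g x \<partial>M) - (\<integral>x. g x \<partial>\<N>)\<bar> \<le> B * H_weight m g"
proof -
  interpret M: real_distribution M by (rule M)
  interpret N: real_distribution \<N> by (rule real_dist_normal_dist)
  obtain d where d: "d \<in> borel_measurable borel" "integrable lborel (\<lambda>y. \<bar>d y\<bar> / jb y ^ m)"
    "H_weight m g = (\<integral>y. \<bar>d y\<bar> / jb y ^ m \<partial>lborel)"
    "\<And>a b. a \<le> b \<Longrightarrow> g b - g a = (\<integral>y. indicator {a..b} y * d y \<partial>lborel)"
    by (rule ae_differentiable_borel_derivative[OF g]) blast
  obtain G where G: "0 \<le> G" "\<And>z. std_normal_density z \<le> G / jb z ^ (m + 2)"
    using std_normal_density_le[of "m + 2"] by blast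
  have compl: "measure M' {y<..} = 1 - measure M' {..y}" if "real_distribution M'" for M' and y :: real
  proof -
    interpret M': real_distribution M' by (rule that)
    have "{y<..} = UNIV - {..y}" by auto
    then show ?thesis using M'.prob_compl[of "{..y}"] by simp
  qed
  define C where "C = G * sq_mass + B"
  have C: "0 \<le> C" using G(1) B(1) sq_mass_nonneg by (simp add: C_def)
  have N_up: "measure \<N> {y<..} \<le> G * sq_mass / jb y ^ m" if "0 \<le> y" for y
    using that by (intro std_normal_tail_le G) auto
  have N_low: "measure \<N> {..y} \<le> G * sq_mass / jb y ^ m" if "y \<le> 0" for y
    using that by (intro std_normal_tail_le G) auto
  have C_split: "C / jb y ^ m = G * sq_mass / jb y ^ m + B / jb y ^ m" for y :: real
    by (simp add: C_def add_divide_distrib)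
  have B_nn: "0 \<le> B / jb y ^ m" for y using B(1) by simp
  have M_up: "measure M {y<..} \<le> C / jb y ^ m" if "0 \<le> y" for y
    using N_up[OF that] B(2)[of y] unfolding compl[OF M] compl[OF real_dist_normal_dist] C_split by linarith
  have M_low: "measure M {..y} \<le> C / jb y ^ m" if "y \<le> 0" for y
    using N_low[OF that] B(2)[of y] unfolding C_split by linarith
  have tM: "integrable M g" "integrable lborel (\<lambda>y. d y * (measure M {y<..} - indicator {..0} y))"
      "(\<integral>x. g x \<partial>M) = g 0 + (\<integral>y. d y * (measure M {y<..} - indicator {..0} y) \<partial>lborel)"
    by (rule M.expectation_by_tails[where C = C and m = m and d = d and g = g]; fact d C M_up M_low)+
  have N_up': "measure \<N> {y<..} \<le> C / jb y ^ m" if "0 \<le> y" for y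
    using N_up[OF that] B_nn[of y] unfolding C_split by linarith
  have N_low': "measure \<N> {..y} \<le> C / jb y ^ m" if "y \<le> 0" for y
    using N_low[OF that] B_nn[of y] unfolding C_split by linarith
  have tN: "integrable \<N> g" "integrable lborel (\<lambda>y. d y * (measure \<N> {y<..} - indicator {..0} y))"
      "(\<integral>x. g x \<partial>\<N>) = g 0 + (\<integral>y. d y * (measure \<N> {y<..} - indicator {..0} y) \<partial>lborel)"
    by (rule N.expectation_by_tails[where C = C and m = m and d = d and g = g]; fact d C N_up' N_low')+

  show "integrable M g" by (rule tM(1))
  show "integrable \<N> g" by (rule tN(1))
  define e where "e = (\<lambda>y. d y * (measure M {y<..} - indicator {..0} y) - d y * (measure \<N> {y<..} - indicator {..0} y))"
  have e_int: "integrable lborel e"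
    unfolding e_def by (rule Bochner_Integration.integrable_diff[OF tM(2) tN(2)])
  have e_le: "\<bar>e y\<bar> \<le> B * (\<bar>d y\<bar> / jb y ^ m)" for y
  proof -
    have "e y = d y * (measure \<N> {..y} - measure M {..y})"
      unfolding e_def compl[OF M] compl[OF real_dist_normal_dist] by (simp add: algebra_simps)
    then have "\<bar>e y\<bar> = \<bar>d y\<bar> * \<bar>measure M {..y} - measure \<N> {..y}\<bar>"
      by (simp add: abs_mult abs_minus_commute)
    also have "\<dots> \<le> \<bar>d y\<bar> * (B / jb y ^ m)" by (intro mult_left_mono B(2)) auto
    finally show ?thesis by (simp add: mult.commute)
  qed
  have "(\<integral>x. g x \<partial>M) - (\<integral>x. g x \<partial>\<N>) = (\<integral>y. e y \<partial>lborel)"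
    unfolding tM(3) tN(3) e_def by (subst Bochner_Integration.integral_diff[OF tM(2) tN(2)]) simp
  moreover have "\<bar>\<integral>y. e y \<partial>lborel\<bar> \<le> (\<integral>y. \<bar>e y\<bar> \<partial>lborel)" by (rule integral_abs_bound)
  moreover have "(\<integral>y. \<bar>e y\<bar> \<partial>lborel) \<le> (\<integral>y. B * (\<bar>d y\<bar> / jb y ^ m) \<partial>lborel)"
    by (rule integral_mono[OF integrable_abs[OF e_int] integrable_mult_right[OF d(2)] e_le])
  moreover have "(\<integral>y. B * (\<bar>d y\<bar> / jb y ^ m) \<partial>lborel) = B * H_weight m g"
    unfolding d(3) by (rule integral_mult_right_zero)
  ultimately show "\<bar>(\<integral>x. g x \<partial>M) - (\<integral>x. g x \<partial>\<N>)\<bar> \<le> B * H_weight m g"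
    by linarith
qed

section \<open>Power functions\<close>

lemma AE_lebesgue_neq_0: "AE x in lebesgue. x \<noteq> (0::real)"
  by (rule AE_completion[OF AE_lborel_singleton])

context
  fixes g g' :: "real \<Rightarrow> real"
  assumes g': "g' \<in> borel_measurable borel"
    and deriv: "\<And>x. x \<noteq> 0 \<Longrightarrow> (g has_real_derivative g' x) (at x)"
begin

lemma AE_deriv_eq: "AE x in lebesgue. g' x = deriv g x"
  using AE_lebesgue_neq_0 by eventually_elim (use deriv DERIV_imp_deriv in metis)

lemma deriv_lebesgue_measurable: "deriv g \<in> borel_measurable lebesgue"
  by (rule borel_measurable_AE[OF _ AE_deriv_eq]) (use g' in \<open>intro measurable_completion, simp\<close>)

text \<open>The origin is excepted because \<open>\<bar>x\<bar> powr q\<close> has no derivative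
  there for \<open>0 < q \<le> 1\<close>. By continuity the fundamental theorem tolerates this one
  point.\<close>

lemma ae_differentiableI:
  assumes cont: "continuous_on UNIV g"
    and int: "\<And>a b. integrable lborel (\<lambda>x. indicator {a..b} x * g' x)"
  shows "ae_differentiable g"
  unfolding ae_differentiable_def
proof (intro conjI allI impI)
  show "AE x in lebesgue. g differentiable (at x)"
    using AE_lebesgue_neq_0 by eventually_elim (use deriv real_differentiable_def in blast)
  fix a b :: real assume ab: "a \<le> b"
  have m: "(\<lambda>x. indicator {a..b} x * g' x) \<in> borel_measurable lborel" using g' by simp
  have m': "(\<lambda>x. indicator {a..b} x * deriv g x) \<in> borel_measurable lebesgue"
    using deriv_lebesgue_measurable by (intro borel_measurable_times borel_measurable_indicator) auto
  have ae: "AE x in lebesgue. indicator {a..b} x * g' x = indicator {a..b} x * deriv g x"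
    using AE_deriv_eq by eventually_elim simp
  have i: "integrable lebesgue (\<lambda>x. indicator {a..b} x * g' x)"
    using int[of a b] integrable_completion[OF m] by simp
  then show "set_integrable lebesgue {a..b} (deriv g)"
    using integrable_cong_AE[OF measurable_completion[OF m] m' ae] by (simp add: set_integrable_def)
  have "(g' has_integral (g b - g a)) {a..b}"
  proof (rule fundamental_theorem_of_calculus_interior_strong[where S = "{0}"])
    show "(g has_vector_derivative g' x) (at x)" if "x \<in> {a<..<b} - {0}" for x
      using deriv[of x] that by (simp add: has_real_derivative_iff_has_vector_derivative)
    show "continuous_on {a..b} g" by (rule continuous_on_subset[OF cont]) simp
  qed (use ab in auto)
  then have "g b - g a = integral {a..b} g'" by (simp add: integral_unique)
  also have "\<dots> = (LINT x:{a..b}|lborel. g' x)"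
    using int[of a b] by (intro set_borel_integral_eq_integral(2)[symmetric]) (simp add: set_integrable_def)
  also have "\<dots> = (\<integral>x. indicator {a..b} x * g' x \<partial>lebesgue)"
    using integral_completion[OF m] by (simp add: set_lebesgue_integral_def)
  also have "\<dots> = (LINT x:{a..b}|lebesgue. deriv g x)"
    using integral_cong_AE[OF measurable_completion[OF m] m' ae] by (simp add: set_lebesgue_integral_def)
  finally show "g b - g a = (LINT x:{a..b}|lebesgue. deriv g x)" .
qed

lemma H_finiteI:
  assumes "integrable lborel (\<lambda>x. \<bar>g' x\<bar> / jb x ^ m)"
  shows "H_finite m g"
proof -
  have m: "(\<lambda>x. \<bar>g' x\<bar> / jb x ^ m) \<in> borel_measurable lborel" using g' by simp
  have m': "(\<lambda>x. \<bar>deriv g x\<bar> / jb x ^ m) \<in> borel_measurable lebesgue"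
  proof -
    have "(\<lambda>x::real. jb x ^ m) \<in> borel_measurable lebesgue" by (intro measurable_completion) simp
    then show ?thesis using deriv_lebesgue_measurable by (intro borel_measurable_divide borel_measurable_abs)
  qed
  have ae: "AE x in lebesgue. \<bar>g' x\<bar> / jb x ^ m = \<bar>deriv g x\<bar> / jb x ^ m"
    using AE_deriv_eq by eventually_elim simp
  show ?thesis
    unfolding H_finite_def
    using integrable_cong_AE[OF measurable_completion[OF m] m' ae] integrable_completion[OF m] assms by simp
qed

end

lemma integrable_powr_unit:
  fixes q :: real
  assumes "0 < q"
  shows "integrable lborel (\<lambda>x. indicator {0..1} x * x powr (q - 1))"
proof -
  have "(\<lambda>x. x powr (q - 1)) integrable_on {0..1}"
    using has_integral_powr_from_0[of "q - 1" 1] assms by auto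
  then have "(\<lambda>x. x powr (q - 1)) absolutely_integrable_on {0..1}"
    by (rule nonnegative_absolutely_integrable_1) auto
  then have "integrable lebesgue (\<lambda>x. indicator {0..1} x * x powr (q - 1))"
    by (simp add: set_integrable_def)
  then show ?thesis by (subst (asm) integrable_completion) auto
qed

text \<open>Near the origin \<open>q > 0\<close> makes \<open>x powr (q - 1)\<close> integrable; at
  infinity the integrand behaves like the power \<open>q - 1 - m\<close>, integrable because
  \<open>q < m\<close>.\<close>

lemma integrable_weighted_powr:
  fixes q :: real
  assumes q: "0 < q" "q < real m"
  shows "integrable lborel (\<lambda>x. \<bar>x\<bar> powr (q - 1) / jb x ^ m)"
proof (rule integrable_even)
  let ?a = "real m - q + 1"
  have i: "integrable lborel (\<lambda>x. indicator {0..1} x * x powr (q - 1) + 2 * jb x powr (- ?a))"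
    using q by (intro Bochner_Integration.integrable_add integrable_powr_unit integrable_mult_right integrable_one_plus_abs_powr) auto
  have le: "x powr (q - 1) / (1 + x) ^ m \<le> indicator {0..1} x * x powr (q - 1) + 2 * jb x powr (- ?a)" if x: "0 \<le> x" for x
  proof (cases "x \<le> 1")
    case True
    have "x powr (q - 1) / (1 + x) ^ m \<le> x powr (q - 1) / 1"
      using x by (intro divide_left_mono) (auto intro!: one_le_power)
    moreover have "0 \<le> 2 * jb x powr (- ?a)" by simp
    moreover have "indicator {0..1} x * x powr (q - 1) = x powr (q - 1)" using True x by simp
    ultimately show ?thesis by linarith
  next
    case False
    have "x powr (q - 1) \<le> 2 * (1 + x) powr (q - 1)"
    proof (cases "1 \<le> q")
      case True
      then have "x powr (q - 1) \<le> (1 + x) powr (q - 1)" using x by (intro powr_mono2) auto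
      moreover have "0 \<le> (1 + x) powr (q - 1)" by simp
      ultimately show ?thesis by linarith
    next
      case q1: False
      \<comment> \<open>The exponent is negative and \<open>x > 1\<close> gives
        \<open>x \<ge> (1 + x) / 2\<close>; the resulting factor \<open>2 powr (1 - q)\<close> is at
        most 2.\<close>
      have "x powr (q - 1) \<le> ((1 + x) / 2) powr (q - 1)" using q1 False by (intro powr_mono2') auto
      also have "\<dots> = (1 + x) powr (q - 1) * 2 powr (1 - q)"
        by (subst powr_divide) (simp add: powr_minus[symmetric] divide_inverse)
      also have "\<dots> \<le> (1 + x) powr (q - 1) * 2 powr 1" using q by (intro mult_left_mono powr_mono) auto
      finally show ?thesis by simp
    qed
    then have "x powr (q - 1) / (1 + x) ^ m \<le> 2 * (1 + x) powr (q - 1) / (1 + x) ^ m"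
      using x by (intro divide_right_mono) auto
    also have "\<dots> = 2 * jb x powr (- ?a)"
    proof -
      have "(1 + x) ^ m = (1 + x) powr real m" using x by (simp add: powr_realpow)
      then have "(1 + x) powr (q - 1) / (1 + x) ^ m = (1 + x) powr (q - 1 - real m)" by (simp add: powr_diff)
      moreover have "q - 1 - real m = - ?a" by simp
      ultimately show ?thesis using x by simp
    qed
    finally show ?thesis using False by (simp add: indicator_def)
  qed
  show "integrable lborel (\<lambda>x. indicator {0..} x * (x powr (q - 1) / (1 + x) ^ m))"
  proof (rule Bochner_Integration.integrable_bound[OF i])
    have "norm (indicator {0..} x * (x powr (q - 1) / (1 + x) ^ m)) \<le>
        norm (indicator {0..1} x * x powr (q - 1) + 2 * jb x powr (- ?a))" for x
    proof (cases "0 \<le> x")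
      case True
      then show ?thesis using le[OF True] by simp
    qed simp
    then show "AE x in lborel. norm (indicator {0..} x * (x powr (q - 1) / (1 + x) ^ m)) \<le>
        norm (indicator {0..1} x * x powr (q - 1) + 2 * jb x powr (- ?a))" by simp
  qed measurable
qed

lemma has_real_derivative_abs_powr:
  fixes x q :: real
  assumes "x \<noteq> 0"
  shows "((\<lambda>x. \<bar>x\<bar> powr q) has_real_derivative q * \<bar>x\<bar> powr (q - 1) * sgn x) (at x)"
proof (cases "0 < x")
  case True
  have "((\<lambda>x. x powr q) has_real_derivative q * x powr (q - 1)) (at x)"
    by (rule has_real_derivative_powr[OF True])
  then have "((\<lambda>x. \<bar>x\<bar> powr q) has_real_derivative q * x powr (q - 1)) (at x)"
    by (rule has_field_derivative_transform_within_open[where S = "{0<..}"]) (use True in auto)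
  then show ?thesis using True by simp
next
  case False
  then have x: "0 < - x" using assms by simp
  have "((\<lambda>x. (- x) powr q) has_real_derivative (q * (- x) powr (q - 1)) * (- 1)) (at x)"
    by (rule DERIV_chain2[where f = "\<lambda>y. y powr q" and g = "\<lambda>x. - x", OF has_real_derivative_powr[OF x]])
      (auto intro!: derivative_eq_intros)
  then have "((\<lambda>x. \<bar>x\<bar> powr q) has_real_derivative (q * (- x) powr (q - 1)) * (- 1)) (at x)"
    by (rule has_field_derivative_transform_within_open[where S = "{..<0}"]) (use x in auto)
  then show ?thesis using x by (simp add: sgn_if)
qed

lemma abs_powr_admissible:
  fixes q :: real
  assumes q: "0 < q" "q < real m"
  shows "ae_differentiable (\<lambda>x. \<bar>x\<bar> powr q)" "H_finite m (\<lambda>x. \<bar>x\<bar> powr q)"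
proof -
  let ?g' = "\<lambda>x::real. q * \<bar>x\<bar> powr (q - 1) * sgn x"
  note i = integrable_mult_right[OF integrable_weighted_powr[OF q], of q]
  have meas: "?g' \<in> borel_measurable borel" by measurable
  have abs_le: "\<bar>?g' x\<bar> \<le> q * \<bar>x\<bar> powr (q - 1)" for x
    using q(1) by (simp add: abs_mult sgn_if)
  show "ae_differentiable (\<lambda>x. \<bar>x\<bar> powr q)"
  proof (rule ae_differentiableI[OF meas has_real_derivative_abs_powr])
    show "continuous_on UNIV (\<lambda>x::real. \<bar>x\<bar> powr q)"
      using q by (intro continuous_on_powr' continuous_intros) auto
    fix a b :: real
    define c where "c = (1 + max \<bar>a\<bar> \<bar>b\<bar>) ^ m"
    show "integrable lborel (\<lambda>x. indicator {a..b} x * ?g' x)"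
    proof (rule Bochner_Integration.integrable_bound[OF integrable_mult_right[OF i, of c]])
      have "norm (indicator {a..b} x * ?g' x) \<le> norm (c * (q * (\<bar>x\<bar> powr (q - 1) / jb x ^ m)))" for x
      proof (cases "x \<in> {a..b}")
        case True
        then have "jb x ^ m \<le> c" unfolding c_def by (intro power_mono) auto
        then have "1 \<le> c / jb x ^ m" by (subst pos_le_divide_eq) (auto intro: add_pos_nonneg)
        then have "1 * (q * \<bar>x\<bar> powr (q - 1)) \<le> c / jb x ^ m * (q * \<bar>x\<bar> powr (q - 1))"
          using q by (intro mult_right_mono) auto
        moreover have "0 \<le> c" by (simp add: c_def)
        ultimately show ?thesis using True abs_le[of x] q by (simp add: abs_mult)
      qed simp
      then show "AE x in lborel. norm (indicator {a..b} x * ?g' x) \<le> norm (c * (q * (\<bar>x\<bar> powr (q - 1) / jb x ^ m)))"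
        by simp
    qed measurable
  qed auto
  show "H_finite m (\<lambda>x. \<bar>x\<bar> powr q)"
  proof (rule H_finiteI[OF meas has_real_derivative_abs_powr])
    show "integrable lborel (\<lambda>x. \<bar>?g' x\<bar> / jb x ^ m)"
    proof (rule Bochner_Integration.integrable_bound[OF i])
      have "norm (\<bar>?g' x\<bar> / jb x ^ m) \<le> norm (q * (\<bar>x\<bar> powr (q - 1) / jb x ^ m))" for x
        using divide_right_mono[OF abs_le[of x], of "jb x ^ m"] q by simp
      then show "AE x in lborel. norm (\<bar>?g' x\<bar> / jb x ^ m) \<le> norm (q * (\<bar>x\<bar> powr (q - 1) / jb x ^ m))" by simp
    qed measurable
  qed auto
qed

lemma power_admissible:
  assumes q: "q < m"
  shows "ae_differentiable (\<lambda>x. x ^ q)" "H_finite m (\<lambda>x. x ^ q)"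
proof -
  let ?g' = "\<lambda>x::real. real q * x ^ (q - 1)"
  have meas: "?g' \<in> borel_measurable borel" by measurable
  have d: "((\<lambda>x. x ^ q) has_real_derivative ?g' x) (at x)" for x :: real
    by (auto intro!: derivative_eq_intros)
  show "ae_differentiable (\<lambda>x. x ^ q)"
  proof (rule ae_differentiableI[OF meas d])
    show "continuous_on UNIV (\<lambda>x::real. x ^ q)" by (intro continuous_intros)
    fix a b :: real
    have "integrable lborel (\<lambda>x. indicator {a..b} x *\<^sub>R ?g' x)"
      by (rule borel_integrable_compact) (auto intro!: continuous_intros)
    then show "integrable lborel (\<lambda>x. indicator {a..b} x * ?g' x)" by simp
  qed
  show "H_finite m (\<lambda>x. x ^ q)"
  proof (rule H_finiteI[OF meas d])
    show "integrable lborel (\<lambda>x. \<bar>?g' x\<bar> / jb x ^ m)"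
    \<comment> \<open>For \<open>q = 0\<close> the derivative vanishes, whereas
      \<open>integrable_weighted_powr\<close> asks for a positive exponent.\<close>
    proof (cases "q = 0")
      case True
      then show ?thesis by (simp only: of_nat_0 mult_zero_left abs_zero div_0 integrable_zero)
    next
      case False
      have i: "integrable lborel (\<lambda>x. real q * (\<bar>x\<bar> powr (real q - 1) / jb x ^ m))"
        using False q by (intro integrable_mult_right integrable_weighted_powr) auto
      \<comment> \<open>Only almost everywhere: for \<open>q = 1\<close> the two sides differ at the
        origin, as \<open>0 powr 0 = 0\<close> but \<open>0 ^ 0 = 1\<close>.\<close>
      have ae: "AE x in lborel. real q * (\<bar>x\<bar> powr (real q - 1) / jb x ^ m) = \<bar>?g' x\<bar> / jb x ^ m"
        using AE_lborel_singleton[of 0]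
      proof eventually_elim
        case (elim x)
        have "\<bar>x\<bar> powr (real q - 1) = \<bar>x\<bar> powr real (q - 1)" using False by (simp add: of_nat_diff)
        also have "\<dots> = \<bar>x\<bar> ^ (q - 1)" using elim by (intro powr_realpow) simp
        finally show ?case by (simp add: abs_mult power_abs)
      qed
      have m: "(\<lambda>x. \<bar>?g' x\<bar> / jb x ^ m) \<in> borel_measurable lborel" by simp
      show ?thesis by (rule iffD1[OF integrable_cong_AE[OF borel_measurable_integrable[OF i] m ae] i])
    qed
  qed
qed

section \<open>Normal approximation of Birkhoff sums\<close>

context bounded_sums
begin

lemma measure_normalised_eq:
  fixes X :: "'a \<Rightarrow> real"
  assumes [measurable]: "X \<in> borel_measurable M"
  shows "measure (distr M borel X) {..x} = measure M {z \<in> space M. X z \<le> x}"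
    and "real_distribution (distr M borel X)"
proof -
  show "measure (distr M borel X) {..x} = measure M {z \<in> space M. X z \<le> x}"
    by (subst measure_distr) (auto intro!: arg_cong[of _ _ "measure M"])
  show "real_distribution (distr M borel X)" by (rule real_distribution_distr) simp
qed

text \<open>The extension is \<open>exp (l n (\<i> * w / \<sigma> n))\<close>, and \<open>E\<close>
  is the error of the logarithmic expansion. The radius is \<open>r / 2\<close> since that expansion
  holds there.\<close>

lemma normalised_berry_esseen:
  assumes mean: "\<And>n. \<bar>\<integral>x. S n x \<partial>M\<bar> \<le> \<mu>"
  shows "\<exists>K\<ge>0. \<exists>s\<^sub>0>0. \<forall>n x. s\<^sub>0 \<le> \<sigma> n \<longrightarrow>
    \<bar>measure (distr M borel (\<lambda>z. S n z / \<sigma> n)) {..x} - measure \<N> {..x}\<bar>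
      \<le> K / \<sigma> n / jb x ^ m"
proof -
  obtain C where C: "0 \<le> C" "\<And>n w. 1 \<le> \<sigma> n \<Longrightarrow> cmod w \<le> r / 2 * \<sigma> n \<Longrightarrow>
      cmod (l n (\<i> * w / of_real (\<sigma> n)) + w\<^sup>2 / 2) \<le> C * (1 + cmod w) ^ 3 / \<sigma> n"
    using log_char_expansion[OF mean] by blast
  obtain K s\<^sub>0 where K: "0 \<le> K" "0 < s\<^sub>0"
    "\<And>M s D x. real_distribution M \<Longrightarrow> s\<^sub>0 \<le> s \<Longrightarrow> D holomorphic_on ball 0 (r / 2 * s) \<Longrightarrow>
      (\<And>t. \<bar>t\<bar> < r / 2 * s \<Longrightarrow> D (of_real t) = char M t) \<Longrightarrow>
      (\<And>w. cmod w < r / 2 * s \<Longrightarrow> \<exists>E. D w = exp (- w\<^sup>2 / 2 + E) \<and> cmod E \<le> C * (1 + cmod w) ^ 3 / s) \<Longrightarrow>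
      \<bar>measure M {x<..} - measure \<N> {x<..}\<bar> \<le> K / s / jb x ^ m"
    using nonuniform_berry_esseen[OF C(1) half_gt_zero[OF r]] by metis
  have "\<bar>measure (distr M borel (\<lambda>z. S n z / \<sigma> n)) {..x} - measure \<N> {..x}\<bar>
      \<le> K / \<sigma> n / jb x ^ m" if s: "max s\<^sub>0 1 \<le> \<sigma> n" for n x
  proof -
    have V: "real_distribution (distr M borel (\<lambda>z. S n z / \<sigma> n))" by (rule measure_normalised_eq) simp
    have s1: "1 \<le> \<sigma> n" "s\<^sub>0 \<le> \<sigma> n" "0 < \<sigma> n" using s by auto
    define D where "D = (\<lambda>w. exp (l n (\<i> * w / of_real (\<sigma> n))))"
    have in_ball: "\<i> * w / of_real (\<sigma> n) \<in> ball 0 r" if "cmod w < r / 2 * \<sigma> n" for w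
    proof -
      have "cmod w / \<sigma> n < r / 2" using that s1 by (simp add: divide_less_eq)
      then have "cmod w / \<sigma> n < r" using r by linarith
      then show ?thesis using s1 by (simp add: norm_mult norm_divide)
    qed
    have "\<bar>measure (distr M borel (\<lambda>z. S n z / \<sigma> n)) {x<..} - measure \<N> {x<..}\<bar> \<le> K / \<sigma> n / jb x ^ m"
    proof (rule K(3)[OF V s1(2)])
      have "l n \<circ> (\<lambda>w. \<i> * w / of_real (\<sigma> n)) holomorphic_on ball 0 (r / 2 * \<sigma> n)"
        by (rule holomorphic_on_compose_gen[OF _ l_holo]) (use in_ball s1 in \<open>auto intro!: holomorphic_intros\<close>)
      then show "D holomorphic_on ball 0 (r / 2 * \<sigma> n)"
        unfolding D_def by (intro holomorphic_intros) (simp add: comp_def)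
      show "D (of_real t) = char (distr M borel (\<lambda>z. S n z / \<sigma> n)) t" if "\<bar>t\<bar> < r / 2 * \<sigma> n" for t
        using exp_l[OF in_ball[of "of_real t"], of n] that by (simp add: D_def char_normalised)
      fix w assume w: "cmod w < r / 2 * \<sigma> n"
      show "\<exists>E. D w = exp (- w\<^sup>2 / 2 + E) \<and> cmod E \<le> C * (1 + cmod w) ^ 3 / \<sigma> n"
        using C(2)[OF s1(1) less_imp_le[OF w]]
        by (intro exI[of _ "l n (\<i> * w / of_real (\<sigma> n)) + w\<^sup>2 / 2"]) (simp add: D_def)
    qed
    moreover have "measure M' {x<..} = 1 - measure M' {..x}" if "real_distribution M'" for M'
    proof -
      interpret M': real_distribution M' by (rule that)
      have "{x<..} = UNIV - {..x}" by auto
      then show ?thesis using M'.prob_compl[of "{..x}"] by simp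
    qed
    ultimately show ?thesis using V real_dist_normal_dist by (simp add: abs_minus_commute)
  qed
  then show ?thesis using K(1) by (intro exI[of _ K] conjI exI[of _ "max s\<^sub>0 1"]) auto
qed

text \<open>Meant for the finitely many indices below a threshold. Beyond \<open>wb\<close> the
  distribution function is 0 or 1 and only a normal tail remains; within \<open>wb\<close> the
  weight is bounded, so the trivial estimate by 1 suffices.\<close>

lemma bounded_variable_cdf_bound:
  assumes X [measurable]: "X \<in> borel_measurable M" and wb: "\<And>z. z \<in> space M \<Longrightarrow> \<bar>X z\<bar> \<le> wb" and wb0: "0 \<le> wb"
    and G: "0 \<le> G" "\<And>z. std_normal_density z \<le> G / jb z ^ (m + 2)"
  shows "\<bar>measure (distr M borel X) {..x} - measure \<N> {..x}\<bar>
    \<le> ((1 + wb) ^ m + G * sq_mass) / jb x ^ m"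
proof -
  interpret N: real_distribution \<N> by (rule real_dist_normal_dist)
  interpret X: real_distribution "distr M borel X" by (rule measure_normalised_eq) simp
  have nn: "0 \<le> (1 + wb) ^ m / jb x ^ m" "0 \<le> G * sq_mass / jb x ^ m"
    using wb0 G(1) sq_mass_nonneg by auto
  consider "\<bar>x\<bar> \<le> wb" | "wb < x" | "x < - wb" by linarith
  then have "\<bar>measure (distr M borel X) {..x} - measure \<N> {..x}\<bar>
      \<le> (1 + wb) ^ m / jb x ^ m + G * sq_mass / jb x ^ m"
  proof cases
    case 1
    then have "jb x ^ m \<le> (1 + wb) ^ m" by (intro power_mono) auto
    then have "1 \<le> (1 + wb) ^ m / jb x ^ m" by (subst pos_le_divide_eq) (auto intro: add_pos_nonneg)
    moreover have "\<bar>measure (distr M borel X) {..x} - measure \<N> {..x}\<bar> \<le> 1"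
      using X.prob_le_1[of "{..x}"] N.prob_le_1[of "{..x}"]
        measure_nonneg[of "distr M borel X" "{..x}"] measure_nonneg[of \<N> "{..x}"] by linarith
    ultimately show ?thesis using nn by linarith
  next
    case 2
    have "{z \<in> space M. X z \<le> x} = space M" using wb 2 by force
    then have "measure (distr M borel X) {..x} = 1" by (simp add: measure_normalised_eq prob_space)
    moreover have "measure \<N> {..x} = 1 - measure \<N> {x<..}"
    proof -
      have "{x<..} = UNIV - {..x}" by auto
      then show ?thesis using N.prob_compl[of "{..x}"] by simp
    qed
    moreover have "measure \<N> {x<..} \<le> G * sq_mass / jb x ^ m"
      using 2 wb0 by (intro std_normal_tail_le G) auto
    moreover have "0 \<le> measure \<N> {x<..}" by (rule measure_nonneg)
    ultimately show ?thesis using nn by linarith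
  next
    case 3
    have "{z \<in> space M. X z \<le> x} = {}" using wb 3 by force
    then have "measure (distr M borel X) {..x} = 0" by (simp only: measure_normalised_eq[OF X] measure_empty)
    moreover have "measure \<N> {..x} \<le> G * sq_mass / jb x ^ m"
      using 3 wb0 by (intro std_normal_tail_le G) auto
    moreover have "0 \<le> measure \<N> {..x}" by (rule measure_nonneg)
    ultimately show ?thesis using nn by linarith
  qed
  then show ?thesis by (simp add: add_divide_distrib)
qed

lemma affine_berry_esseen:
  fixes a b :: "nat \<Rightarrow> real"
  assumes mean: "\<And>n. \<bar>\<integral>x. S n x \<partial>M\<bar> \<le> \<mu>" and lim: "filterlim \<sigma> at_top sequentially"
    and a: "bounded (range a)" and b: "(\<lambda>n. b n - \<sigma> n) \<in> O(\<lambda>_. 1)"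
  shows "\<exists>C\<ge>0. \<forall>n. 0 < \<sigma> n \<longrightarrow> b n \<noteq> 0 \<longrightarrow> (\<forall>x.
    \<bar>measure (distr M borel (\<lambda>z. (S n z - a n) / b n)) {..x} - measure \<N> {..x}\<bar>
      \<le> C / \<sigma> n / jb x ^ m)"
proof -
  obtain K s\<^sub>0 where K: "0 \<le> K" "0 < s\<^sub>0" "\<And>n x. s\<^sub>0 \<le> \<sigma> n \<Longrightarrow>
    \<bar>measure (distr M borel (\<lambda>z. S n z / \<sigma> n)) {..x} - measure \<N> {..x}\<bar>
      \<le> K / \<sigma> n / jb x ^ m"
    using normalised_berry_esseen[OF mean] by blast
  obtain \<alpha> where \<alpha>: "\<And>n. \<bar>a n\<bar> \<le> \<alpha>" using a by (auto simp: bounded_iff)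
  obtain \<beta> where \<beta>: "\<forall>\<^sub>F n in sequentially. \<bar>b n - \<sigma> n\<bar> \<le> \<beta>"
    using b by (auto elim!: landau_o.bigE)
  obtain G where G: "0 \<le> G" "\<And>z. std_normal_density z \<le> G / jb z ^ Suc m"
    using std_normal_density_le[of "Suc m"] by blast
  obtain G' where G': "0 \<le> G'" "\<And>z. std_normal_density z \<le> G' / jb z ^ (m + 2)"
    using std_normal_density_le[of "m + 2"] by blast
  define \<gamma> where "\<gamma> = \<alpha> + \<bar>\<beta>\<bar>"
  have \<alpha>0: "0 \<le> \<alpha>" using \<alpha>[of 0] by simp
  then have \<gamma>: "0 \<le> \<gamma>" by (simp add: \<gamma>_def)
  define K' where "K' = 2 ^ m * K + 2 ^ Suc m * G * \<gamma>"
  have K': "0 \<le> K'" using K(1) G(1) \<gamma> by (simp add: K'_def)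
  \<comment> \<open>The value \<open>2 * \<gamma> + 1\<close> serves twice: it makes
    \<open>b n\<close> positive, and it gives \<open>2 * \<gamma> \<le> \<sigma> n\<close> for
    \<open>cdf_transfer\<close>.\<close>
  have "\<forall>\<^sub>F n in sequentially. max s\<^sub>0 (2 * \<gamma> + 1) \<le> \<sigma> n"
    using lim unfolding filterlim_at_top by blast
  with \<beta> have "\<forall>\<^sub>F n in sequentially. \<bar>b n - \<sigma> n\<bar> \<le> \<beta> \<and> max s\<^sub>0 (2 * \<gamma> + 1) \<le> \<sigma> n"
    by eventually_elim simp
  then obtain n\<^sub>0 where n\<^sub>0: "\<And>n. n\<^sub>0 \<le> n \<Longrightarrow> \<bar>b n - \<sigma> n\<bar> \<le> \<beta> \<and> max s\<^sub>0 (2 * \<gamma> + 1) \<le> \<sigma> n"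
    by (auto simp: eventually_sequentially)
  define W where "W = (\<lambda>n z. (S n z - a n) / b n)"
  have W_meas [measurable]: "W n \<in> borel_measurable M" for n unfolding W_def by measurable
  have large: "\<bar>measure (distr M borel (W n)) {..x} - measure \<N> {..x}\<bar> \<le> K' / \<sigma> n / jb x ^ m"
    if n: "n\<^sub>0 \<le> n" for n x
  proof -
    have s: "s\<^sub>0 \<le> \<sigma> n" "2 * \<gamma> + 1 \<le> \<sigma> n" and bs: "\<bar>b n - \<sigma> n\<bar> \<le> \<beta>" using n\<^sub>0[OF n] by auto
    have s_pos: "0 < \<sigma> n" using s(2) \<gamma> by simp
    have "\<beta> \<le> \<gamma>" using \<alpha>0 by (simp add: \<gamma>_def)
    then have b_pos: "0 < b n" using bs s(2) \<gamma> by (simp add: abs_le_iff)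
    \<comment> \<open>The event that the affinely normalised sum is at most \<open>x\<close> is the
      event that \<open>S n / \<sigma> n\<close> is at most \<open>y\<close>.\<close>
    define y where "y = (b n * x + a n) / \<sigma> n"
    have "{z \<in> space M. W n z \<le> x} = {z \<in> space M. S n z / \<sigma> n \<le> y}"
      using b_pos s_pos unfolding W_def y_def by (auto simp: pos_divide_le_eq divide_right_mono divide_le_cancel mult.commute algebra_simps)
    then have eq: "measure (distr M borel (W n)) {..x} = measure (distr M borel (\<lambda>z. S n z / \<sigma> n)) {..y}"
      by (subst (1 2) measure_normalised_eq) auto
    have "y - x = ((b n - \<sigma> n) * x + a n) / \<sigma> n" using s_pos by (simp add: y_def field_simps)
    then have "\<bar>y - x\<bar> = \<bar>(b n - \<sigma> n) * x + a n\<bar> / \<sigma> n" using s_pos by simp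
    also have "\<dots> \<le> \<gamma> * jb x / \<sigma> n"
    proof (rule divide_right_mono)
      have "\<bar>(b n - \<sigma> n) * x\<bar> \<le> \<bar>\<beta>\<bar> * \<bar>x\<bar>" unfolding abs_mult using bs by (intro mult_right_mono) auto
      moreover have "0 \<le> \<alpha> * \<bar>x\<bar>" using \<alpha>0 by simp
      moreover have "\<gamma> * jb x = \<alpha> + \<bar>\<beta>\<bar> + \<alpha> * \<bar>x\<bar> + \<bar>\<beta>\<bar> * \<bar>x\<bar>" by (simp add: \<gamma>_def algebra_simps)
      ultimately show "\<bar>(b n - \<sigma> n) * x + a n\<bar> \<le> \<gamma> * jb x" using \<alpha>[of n] by linarith
    qed (use s_pos in simp)
    finally have xy: "\<bar>y - x\<bar> \<le> \<gamma> * jb x / \<sigma> n" .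
    show ?thesis
      unfolding eq K'_def
      by (rule cdf_transfer[OF K(1) K(3)[OF s(1)] G \<gamma> _ s_pos xy]) (use s(2) in simp)
  qed
  define wb where "wb = (\<lambda>n. (bd n + \<alpha>) / \<bar>b n\<bar>)"
  obtain z0 where z0: "z0 \<in> space M" using not_empty by blast
  have bd: "0 \<le> bd n" for n using S_bound[OF z0, of n] by simp
  define E where "E = (\<lambda>n. (1 + wb n) ^ m + G' * sq_mass)"
  have E: "0 \<le> E n" for n using bd \<alpha>0 G'(1) sq_mass_nonneg by (simp add: E_def wb_def)
  have small: "\<bar>measure (distr M borel (W n)) {..x} - measure \<N> {..x}\<bar> \<le> E n / jb x ^ m"
    if "b n \<noteq> 0" for n x
    unfolding E_def
  proof (rule bounded_variable_cdf_bound[OF W_meas _ _ G'])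
    show "\<bar>W n z\<bar> \<le> wb n" if "z \<in> space M" for z
    proof -
      have "\<bar>S n z - a n\<bar> \<le> bd n + \<alpha>" using S_bound[OF that, of n] \<alpha>[of n] by linarith
      then show ?thesis unfolding W_def wb_def abs_divide by (intro divide_right_mono) auto
    qed
    show "0 \<le> wb n" using bd \<alpha>0 by (simp add: wb_def)
  qed
  \<comment> \<open>The early indices enter through \<open>E n * \<sigma> n\<close>, so that
    division by \<open>\<sigma> n\<close> returns the bound \<open>E n\<close>.\<close>
  define C where "C = K' + (\<Sum>n<n\<^sub>0. E n * \<bar>\<sigma> n\<bar>)"
  have "\<bar>measure (distr M borel (W n)) {..x} - measure \<N> {..x}\<bar> \<le> C / \<sigma> n / jb x ^ m"
    if s: "0 < \<sigma> n" and bn: "b n \<noteq> 0" for n x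
  proof (cases "n\<^sub>0 \<le> n")
    case True
    have "K' / \<sigma> n / jb x ^ m \<le> C / \<sigma> n / jb x ^ m"
      using s E by (intro divide_right_mono) (auto simp: C_def intro!: sum_nonneg)
    then show ?thesis using large[OF True, of x] by linarith
  next
    case False
    have "E n * \<bar>\<sigma> n\<bar> \<le> (\<Sum>n<n\<^sub>0. E n * \<bar>\<sigma> n\<bar>)" using False E by (intro member_le_sum) auto
    then have "E n * \<sigma> n \<le> C" using K' s by (simp add: C_def)
    then have "E n \<le> C / \<sigma> n" using s by (simp add: pos_le_divide_eq)
    then have "E n / jb x ^ m \<le> C / \<sigma> n / jb x ^ m" by (intro divide_right_mono) auto
    then show ?thesis using small[OF bn, of x] by linarith
  qed
  moreover have "0 \<le> C" unfolding C_def using K' E by (intro add_nonneg_nonneg sum_nonneg) auto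
  ultimately show ?thesis unfolding W_def by (intro exI[of _ C]) auto
qed

lemma normal_approximation:
  fixes a b :: "nat \<Rightarrow> real" and m :: nat
  assumes mean: "\<And>n. \<bar>\<integral>x. S n x \<partial>M\<bar> \<le> \<mu>" and lim: "filterlim \<sigma> at_top sequentially"
    and a: "bounded (range a)" and b: "(\<lambda>n. b n - \<sigma> n) \<in> O(\<lambda>_. 1)" and m: "2 \<le> m"
  defines "W \<equiv> \<lambda>n x. (S n x - a n) / b n"
  defines "F \<equiv> \<lambda>n x. \<P>(y in M. W n y \<le> x)"
  defines "\<Phi> \<equiv> cdf \<N>"
  defines "adm \<equiv> {n. \<sigma> n > 0 \<and> b n \<noteq> 0}"
  shows "(\<exists>C. \<forall>n\<in>adm. \<forall>x. \<bar>F n x - \<Phi> x\<bar> \<le> C * inverse (\<sigma> n) * inverse (jb x ^ m))"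
    and "\<And>p::real. p > 1 / real m \<Longrightarrow>
      \<exists>C. \<forall>n\<in>adm. integrable lborel (\<lambda>x. \<bar>F n x - \<Phi> x\<bar> powr p) \<and>
        (\<integral>x. \<bar>F n x - \<Phi> x\<bar> powr p \<partial>lborel) powr (1 / p) \<le> C * inverse (\<sigma> n)"
    and "\<exists>R>0. \<forall>g. ae_differentiable g \<and> H_finite m g \<longrightarrow>
      (\<forall>n\<in>adm. expectation_bound M (W n) g (R * H_weight m g * inverse (\<sigma> n)))"
proof -
  obtain C where C: "0 \<le> C" "\<And>n x. 0 < \<sigma> n \<Longrightarrow> b n \<noteq> 0 \<Longrightarrow>
    \<bar>measure (distr M borel (W n)) {..x} - measure \<N> {..x}\<bar> \<le> C / \<sigma> n / jb x ^ m"
    unfolding W_def using affine_berry_esseen[OF mean lim a b, of m] by blast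
  have W_meas [measurable]: "W n \<in> borel_measurable M" for n unfolding W_def by measurable
  have dist: "real_distribution (distr M borel (W n))" for n by (rule measure_normalised_eq(2)[OF W_meas])
  have F: "F n x = measure (distr M borel (W n)) {..x}" for n x
    unfolding F_def by (rule measure_normalised_eq(1)[OF W_meas, symmetric])
  have \<Phi>: "\<Phi> x = measure \<N> {..x}" for x unfolding \<Phi>_def cdf_def ..
  have main: "\<bar>F n x - \<Phi> x\<bar> \<le> C / \<sigma> n / jb x ^ m" if "n \<in> adm" for n x
    using C(2) that unfolding F \<Phi> adm_def by blast
  show "\<exists>C. \<forall>n\<in>adm. \<forall>x. \<bar>F n x - \<Phi> x\<bar> \<le> C * inverse (\<sigma> n) * inverse (jb x ^ m)"
    using main by (intro exI[of _ C]) (simp add: divide_inverse)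
  have meas: "(\<lambda>x. F n x - \<Phi> x) \<in> borel_measurable borel" for n
  proof -
    \<comment> \<open>Distribution functions are monotone, hence Borel measurable.\<close>
    have "mono (F n)" unfolding F using dist[of n]
      by (intro monoI finite_measure.finite_measure_mono)
        (auto simp: real_distribution_def prob_space_def)
    moreover have "mono \<Phi>" unfolding \<Phi>
      using real_dist_normal_dist
      by (intro monoI finite_measure.finite_measure_mono) (auto simp: real_distribution_def prob_space_def)
    ultimately show ?thesis by (intro borel_measurable_diff borel_measurable_mono)
  qed
  show "\<exists>C. \<forall>n\<in>adm. integrable lborel (\<lambda>x. \<bar>F n x - \<Phi> x\<bar> powr p) \<and>
      (\<integral>x. \<bar>F n x - \<Phi> x\<bar> powr p \<partial>lborel) powr (1 / p) \<le> C * inverse (\<sigma> n)" if p: "p > 1 / real m" for p :: real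
  proof (rule exI[of _ "C * (\<integral>x. jb x powr (- (real m * p)) \<partial>lborel) powr (1 / p)"], rule ballI)
    fix n assume n: "n \<in> adm"
    then have "0 \<le> C / \<sigma> n" using C(1) by (simp add: adm_def)
    from weighted_Lp_bound[OF meas main[OF n] p _ this]
    show "integrable lborel (\<lambda>x. \<bar>F n x - \<Phi> x\<bar> powr p) \<and>
      (\<integral>x. \<bar>F n x - \<Phi> x\<bar> powr p \<partial>lborel) powr (1 / p)
        \<le> C * (\<integral>x. jb x powr (- (real m * p)) \<partial>lborel) powr (1 / p) * inverse (\<sigma> n)"
      using m by (simp add: divide_inverse mult_ac)
  qed
  show "\<exists>R>0. \<forall>g. ae_differentiable g \<and> H_finite m g \<longrightarrow>
      (\<forall>n\<in>adm. expectation_bound M (W n) g (R * H_weight m g * inverse (\<sigma> n)))"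
  \<comment> \<open>\<open>C\<close> may be 0, while \<open>R\<close> must be positive.\<close>
  proof (intro exI[of _ "C + 1"] conjI allI impI ballI)
    show "0 < C + 1" using C(1) by simp
    fix g n assume g: "ae_differentiable g \<and> H_finite m g" and n: "n \<in> adm"
    then have s: "0 < \<sigma> n" by (simp add: adm_def)
    have Cs: "0 \<le> C / \<sigma> n" using C(1) s by simp
    note ed = expectation_difference_le[OF dist conjunct1[OF g] conjunct2[OF g] Cs main[OF n, unfolded F \<Phi>]]
    have g_meas: "g \<in> borel_measurable borel" using borel_measurable_integrable[OF ed(1)] by simp
    have H: "0 \<le> H_weight m g" unfolding H_weight_def by (intro integral_nonneg_AE) auto
    show "expectation_bound M (W n) g ((C + 1) * H_weight m g * inverse (\<sigma> n))"
      unfolding expectation_bound_def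
    proof (intro conjI)
      show "integrable M (\<lambda>x. g (W n x))" using integrable_distr[OF W_meas ed(1)] .
      show "integrable lborel (\<lambda>x. g x * std_normal_density x)"
        using ed(2) integral_std_normal(2)[OF g_meas] by simp
      have "\<bar>(\<integral>x. g (W n x) \<partial>M) - (\<integral>x. g x * std_normal_density x \<partial>lborel)\<bar> \<le> C / \<sigma> n * H_weight m g"
        using ed(3) by (simp only: integral_distr[OF W_meas g_meas] integral_std_normal(1)[OF g_meas])
      also have "\<dots> = C * H_weight m g * inverse (\<sigma> n)" by (simp add: divide_inverse)
      also have "\<dots> \<le> (C + 1) * H_weight m g * inverse (\<sigma> n)" using H s by (intro mult_right_mono) auto
      finally show "\<bar>(\<integral>x. g (W n x) \<partial>M) - (\<integral>x. g x * std_normal_density x \<partial>lborel)\<bar> \<le> (C + 1) * H_weight m g * inverse (\<sigma> n)" .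
    qed
  qed
qed

end

text \<open>At time \<open>j\<close> the orbit has the image law of \<open>\<mu>_0\<close>, not
  \<open>\<mu>_j\<close>, so \<open>f_mean\<close> does not centre \<open>S n\<close>; as
  \<open>\<sigma> n\<close> is an uncentred L2 norm, \<open>mean_bdd\<close> keeps the effect of the
  mean of order \<open>1 / \<sigma> n\<close>. The hypothesis \<open>one_mem\<close> supplies the
  start of the iteration and \<open>h_bdd\<close> bounds its limits. The set \<open>adm\<close>
  selects the indices at which the normalised sum and the rate make sense. The exponent of
  \<open>\<bar>x\<bar> powr q\<close> is positive because \<open>\<bar>x\<bar> powr 0\<close> jumps
  at the origin; the constant function is the case \<open>q = 0\<close> of
  \<open>x ^ q\<close>.\<close>

theorem theorem38:
  fixes M :: "nat \<Rightarrow> 'a measure"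
    and T :: "nat \<Rightarrow> 'a \<Rightarrow> 'a"
    and L :: "nat \<Rightarrow> ('a \<Rightarrow> complex) \<Rightarrow> ('a \<Rightarrow> complex)"
    and B :: "nat \<Rightarrow> ('a \<Rightarrow> complex) set"
    and N :: "nat \<Rightarrow> ('a \<Rightarrow> complex) \<Rightarrow> real"
    and h f :: "nat \<Rightarrow> 'a \<Rightarrow> real"
    and S :: "nat \<Rightarrow> 'a \<Rightarrow> real"
    and \<sigma> :: "nat \<Rightarrow> real"
    and A \<delta> :: real
  assumes prob: "\<And>j. prob_space (M j)"
    and T_meas: "\<And>j. T j \<in> measurable (M j) (M (Suc j))"
    and transfer: "\<And>j. transfer_operator (M j) (M (Suc j)) (T j) (L j)"
    and banach: "\<And>j. banach_function_space (M j) (B j) (N j)"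
    and sup_le: "\<exists>C. \<forall>j. \<forall>g\<in>B j. \<forall>x\<in>space (M j). cmod (g x) \<le> C * N j g"
    and \<delta>: "0 < \<delta>" "\<delta> < 1"
    and h_mem: "\<And>j. (\<lambda>x. complex_of_real (h j x)) \<in> B j"
    and h_pos: "\<And>j x. x \<in> space (M j) \<Longrightarrow> 0 < h j x"
    and decay: "\<And>j n g. g \<in> B j \<Longrightarrow> n \<ge> 1 \<Longrightarrow>
        N (j + n) (\<lambda>x. transfer_iter L j n g x -
                        (\<integral>y. g y \<partial>M j) * complex_of_real (h (j + n) x)) \<le> A * N j g * \<delta> ^ n"
    and f_mem: "\<And>j. (\<lambda>x. complex_of_real (f j x)) \<in> B j"
    and f_bdd: "\<exists>K. \<forall>j. N j (\<lambda>x. complex_of_real (f j x)) \<le> K"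
    and f_mean: "\<And>j. (\<integral>x. f j x \<partial>M j) = 0"
    and analytic: "uniformly_analytic_at_0 B N (\<lambda>j. twisted (L j) (f j))"
    and one_mem: "indicator (space (M 0)) \<in> B 0"
    and h_bdd: "\<exists>K. \<forall>j. N j (\<lambda>x. complex_of_real (h j x)) \<le> K"
    and S_def: "S = birkhoff_sum T f"
    and \<sigma>_def: "\<sigma> = (\<lambda>n. rv_L2_norm (M 0) (S n))"
    and mean_bdd: "\<exists>K. \<forall>n. \<bar>prob_space.expectation (M 0) (S n)\<bar> \<le> K"
    and variance: "\<exists>c\<^sub>0>0. \<forall>\<^sub>F n in sequentially. prob_space.variance (M 0) (S n) \<ge> c\<^sub>0 * real n"
  shows "(\<forall>m\<ge>2. growth_condition (M 0) S m) \<and>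
    (\<forall>a b :: nat \<Rightarrow> real. bounded (range a) \<longrightarrow> (\<lambda>n. b n - \<sigma> n) \<in> O(\<lambda>_. 1) \<longrightarrow>
      (let W = (\<lambda>n x. (S n x - a n) / b n);
           F = (\<lambda>n x. \<P>(y in M 0. W n y \<le> x));
           \<Phi> = cdf std_normal_distribution;
           adm = {n. \<sigma> n > 0 \<and> b n \<noteq> 0}
       in \<forall>m::nat. m \<ge> 2 \<longrightarrow>
         (\<exists>C. \<forall>n\<in>adm. \<forall>x. \<bar>F n x - \<Phi> x\<bar> \<le> C * inverse (\<sigma> n) * inverse ((1 + \<bar>x\<bar>) ^ m)) \<and>
         (\<forall>p::real. p > 1 / real m \<longrightarrow>
            (\<exists>C. \<forall>n\<in>adm. integrable lborel (\<lambda>x. \<bar>F n x - \<Phi> x\<bar> powr p) \<and>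
               (\<integral>x. \<bar>F n x - \<Phi> x\<bar> powr p \<partial>lborel) powr (1 / p) \<le> C * inverse (\<sigma> n))) \<and>
         (\<exists>R>0.
            (\<forall>g. ae_differentiable g \<and> H_finite m g \<longrightarrow>
               (\<forall>n\<in>adm. expectation_bound (M 0) (W n) g (R * H_weight m g * inverse (\<sigma> n)))) \<and>
            (\<forall>q::nat. q < m \<longrightarrow> H_finite m (\<lambda>x. x ^ q) \<and>
               (\<forall>n\<in>adm. expectation_bound (M 0) (W n) (\<lambda>x. x ^ q)
                  (R * H_weight m (\<lambda>x. x ^ q) * inverse (\<sigma> n)))) \<and>
            (\<forall>q::real. 0 < q \<and> q < real m \<longrightarrow> H_finite m (\<lambda>x. \<bar>x\<bar> powr q) \<and>
               (\<forall>n\<in>adm. expectation_bound (M 0) (W n) (\<lambda>x. \<bar>x\<bar> powr q)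
                  (R * H_weight m (\<lambda>x. \<bar>x\<bar> powr q) * inverse (\<sigma> n)))))))"
proof -
  obtain C' where C': "\<And>j g x. g \<in> B j \<Longrightarrow> x \<in> space (M j) \<Longrightarrow> cmod (g x) \<le> C' * N j g" using sup_le by blast
  define C where "C = max 0 C'"
  have C: "cmod (g x) \<le> C * N j g" if "g \<in> B j" "x \<in> space (M j)" for g j x
  proof -
    interpret J: banach_functions "M j" "B j" "N j" by unfold_locales (rule banach)
    have "C' * N j g \<le> C * N j g" using J.N_nonneg[OF that(1)] by (intro mult_right_mono) (auto simp: C_def)
    then show ?thesis using C'[OF that] by linarith
  qed
  obtain H where H: "\<And>j. N j (\<lambda>x. complex_of_real (h j x)) \<le> H" using h_bdd by blast
  obtain Kf where Kf: "\<And>j. N j (\<lambda>x. complex_of_real (f j x)) \<le> Kf" using f_bdd by blast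
  have C0: "0 \<le> C" by (simp add: C_def)
  have f_le: "\<bar>f j x\<bar> \<le> C * \<bar>Kf\<bar>" if "x \<in> space (M j)" for j x
  proof -
    have "\<bar>f j x\<bar> = cmod (complex_of_real (f j x))" by simp
    also have "\<dots> \<le> C * N j (\<lambda>x. complex_of_real (f j x))" by (rule C[OF f_mem that])
    also have "\<dots> \<le> C * \<bar>Kf\<bar>" using Kf[of j] C0 by (intro mult_left_mono) auto
    finally show ?thesis .
  qed
  have f_meas: "f j \<in> borel_measurable (M j)" for j
  proof -
    interpret J: banach_functions "M j" "B j" "N j" by unfold_locales (rule banach)
    note J.measurable_mem[OF f_mem, measurable]
    have "(\<lambda>x. Re (complex_of_real (f j x))) \<in> borel_measurable (M j)" by measurable
    then show ?thesis by simp
  qed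
  obtain r\<^sub>0 K where r\<^sub>0: "0 < r\<^sub>0" "0 \<le> K"
    "\<And>j z. cmod z \<le> r\<^sub>0 \<Longrightarrow> bounded_linear_between (B j) (N j) (B (Suc j)) (N (Suc j)) (twisted (L j) (f j) z)"
    "\<And>j z g. cmod z \<le> r\<^sub>0 \<Longrightarrow> g \<in> B j \<Longrightarrow>
      N (Suc j) (\<lambda>x. twisted (L j) (f j) z g x - twisted (L j) (f j) 0 g x) \<le> K * cmod z * N j g"
    by (rule uniformly_analytic_lipschitz[OF banach analytic]) blast
  interpret Q: sequential_system M T L B N h f A \<delta> C H "C * \<bar>Kf\<bar>" r\<^sub>0 K
  proof (rule sequential_system.intro)
    show "0 \<le> C * \<bar>Kf\<bar>" using C0 by simp
  qed (fact prob T_meas transfer banach C0 C \<delta> h_mem H decay f_meas f_le r\<^sub>0 one_mem)+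
  obtain r l where r: "0 < r" and l: "\<And>n. l n holomorphic_on ball 0 r" "\<And>n. l n 0 = 0"
    "\<And>n z. z \<in> ball 0 r \<Longrightarrow> exp (l n z) = Q.Z n z" "\<And>n z. z \<in> ball 0 r \<Longrightarrow> cmod (l n z) \<le> real n"
    using Q.log_Z by blast
  have S_meas: "S n \<in> borel_measurable (M 0)" for n unfolding S_def by (rule Q.S_measurable)
  have S_bound: "\<bar>S n x\<bar> \<le> real n * (C * \<bar>Kf\<bar>)" if "x \<in> space (M 0)" for n x
    unfolding S_def by (rule Q.S_le[OF that])
  obtain c\<^sub>0 n\<^sub>0 where c\<^sub>0: "0 < c\<^sub>0" "\<And>n. n\<^sub>0 \<le> n \<Longrightarrow> c\<^sub>0 * real n \<le> prob_space.variance (M 0) (S n)"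
    using variance by (auto simp: eventually_sequentially)
  have int_S: "integrable (M 0) (S n)" "integrable (M 0) (\<lambda>x. (S n x)\<^sup>2)" for n
  proof -
    show "integrable (M 0) (S n)" by (rule Q.M.integrable_bounded[OF S_meas]) (use S_bound in auto)
    show "integrable (M 0) (\<lambda>x. (S n x)\<^sup>2)"
    proof (rule Q.M.integrable_bounded)
      show "norm ((S n x)\<^sup>2) \<le> (real n * (C * \<bar>Kf\<bar>))\<^sup>2" if "x \<in> space (M 0)" for x
        using power_mono[OF S_bound[OF that, of n], of 2] by simp
    qed (use S_meas in measurable)
  qed
  have \<sigma>_nonneg: "0 \<le> \<sigma> n" for n by (simp add: \<sigma>_def rv_L2_norm_def)
  have \<sigma>_sq: "(\<sigma> n)\<^sup>2 = (\<integral>x. (S n x)\<^sup>2 \<partial>M 0)" for n by (simp add: \<sigma>_def rv_L2_norm_def)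
  \<comment> \<open>The second moment dominates the variance, so linear growth passes to
    \<open>\<sigma> n ^ 2\<close>.\<close>
  have \<sigma>_ge: "c\<^sub>0 * real n \<le> (\<sigma> n)\<^sup>2" if "n\<^sub>0 \<le> n" for n
  proof -
    have "prob_space.variance (M 0) (S n) = (\<sigma> n)\<^sup>2 - (prob_space.expectation (M 0) (S n))\<^sup>2"
      unfolding \<sigma>_sq by (rule Q.M.variance_eq[OF int_S])
    then show ?thesis using c\<^sub>0(2)[OF that] by (smt (verit) zero_le_power2)
  qed
  \<comment> \<open>\<open>1 / c\<^sub>0\<close> handles \<open>n \<ge> n\<^sub>0\<close>, and the
    sum handles the finitely many earlier indices; a term with \<open>\<sigma> n = 0\<close> is 0 by
    the convention for division.\<close>
  define c where "c = 1 / c\<^sub>0 + (\<Sum>n<n\<^sub>0. real n / (\<sigma> n)\<^sup>2)"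
  have c: "0 \<le> c" unfolding c_def using c\<^sub>0 by (intro add_nonneg_nonneg sum_nonneg) auto
  have n_le: "real n \<le> c * (\<sigma> n)\<^sup>2" if s: "0 < \<sigma> n" for n
  proof (cases "n\<^sub>0 \<le> n")
    case True
    have "real n \<le> 1 / c\<^sub>0 * (\<sigma> n)\<^sup>2" using \<sigma>_ge[OF True] c\<^sub>0(1) by (simp add: field_simps)
    also have "\<dots> \<le> c * (\<sigma> n)\<^sup>2" unfolding c_def by (intro mult_right_mono) (auto intro!: sum_nonneg)
    finally show ?thesis .
  next
    case False
    have "real n / (\<sigma> n)\<^sup>2 \<le> (\<Sum>n<n\<^sub>0. real n / (\<sigma> n)\<^sup>2)" using False by (intro member_le_sum) auto
    also have "\<dots> \<le> c" unfolding c_def using c\<^sub>0 by simp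
    finally show ?thesis using s by (simp add: pos_divide_le_eq)
  qed
  interpret Bs: bounded_sums "M 0" S "\<lambda>n. real n * (C * \<bar>Kf\<bar>)" l r c
  proof (rule bounded_sums.intro[OF prob bounded_sums_axioms.intro])
    show "exp (l n z) = (\<integral>x. exp (z * of_real (S n x)) \<partial>M 0)" if "z \<in> ball 0 r" for n z
      using l(3)[OF that] by (simp add: Q.Z_def S_def)
    show "real n \<le> c * (rv_L2_norm (M 0) (S n))\<^sup>2" if "0 < rv_L2_norm (M 0) (S n)" for n
      using n_le[of n] that by (simp add: \<sigma>_def)
  qed (fact S_meas S_bound r l c)+
  obtain \<mu> where \<mu>: "\<And>n. \<bar>prob_space.expectation (M 0) (S n)\<bar> \<le> \<mu>" using mean_bdd by blast
  have lim: "filterlim \<sigma> at_top sequentially"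
  proof (rule filterlim_at_top_mono)
    show "filterlim (\<lambda>n. sqrt (c\<^sub>0 * real n)) at_top sequentially"
      using c\<^sub>0(1) by (intro filterlim_compose[OF sqrt_at_top] filterlim_tendsto_pos_mult_at_top[OF tendsto_const _ filterlim_real_sequentially]) auto
    show "\<forall>\<^sub>F n in sequentially. sqrt (c\<^sub>0 * real n) \<le> \<sigma> n"
      using eventually_ge_at_top[of n\<^sub>0] by eventually_elim (use \<sigma>_ge \<sigma>_nonneg real_le_lsqrt in metis)
  qed
  have \<sigma>: "rv_L2_norm (M 0) (S n) = \<sigma> n" for n by (simp add: \<sigma>_def)
  have ab: "filterlim (\<lambda>n. rv_L2_norm (M 0) (S n)) at_top sequentially"
      "(\<lambda>n. b n - \<sigma> n) \<in> O(\<lambda>_. 1) \<Longrightarrow> (\<lambda>n. b n - rv_L2_norm (M 0) (S n)) \<in> O(\<lambda>_. 1)" for b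
    using lim by (simp_all add: \<sigma>_def)
  show ?thesis
    unfolding Let_def
  proof (intro conjI allI impI, goal_cases)
    case 1
    show ?case by (rule Bs.growth_condition)
  next
    case (2 a b m)
    then show ?case by (rule Bs.normal_approximation(1)[OF \<mu> ab(1) _ ab(2), unfolded \<sigma>])
  next
    case (3 a b m p)
    then show ?case by (intro Bs.normal_approximation(2)[OF \<mu> ab(1) _ ab(2), unfolded \<sigma>])
  next
    case (4 a b m)
    obtain R where "0 < R" "\<And>g n. ae_differentiable g \<Longrightarrow> H_finite m g \<Longrightarrow> 0 < \<sigma> n \<Longrightarrow> b n \<noteq> 0 \<Longrightarrow>
          expectation_bound (M 0) (\<lambda>x. (S n x - a n) / b n) g (R * H_weight m g * inverse (\<sigma> n))"
      using Bs.normal_approximation(3)[OF \<mu> ab(1) 4(1) ab(2)[OF 4(2)] 4(3), unfolded \<sigma>] by blast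
    then show ?case using power_admissible abs_powr_admissible by (intro exI[of _ R]) auto
  qed
qed

end
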